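(* Let $K_0=\frac{(a,b;q)_\infty}{(q;q)_\infty}$. Then $$\mathrm{U}_{q,E}(a,b;z)=\frac{-K_0}{2\pi i}\int_{-i\infty}^{i\infty}\frac{\pi\,(q^{1+s};q)_\infty\,q^{-\binom s2}z^s}{\sin(\pi s)\,(aq^s,bq^s;q)_\infty}\,ds,$$ $$\mathrm{U}_{q,\theta}(a,b;z)=\frac{K_0}{2\pi i\,(q;q)_\infty^3\ln q}\int_{-i\infty}^{i\infty}\frac{\pi^2\,(q^{1+s};q)_\infty\,\theta_q(-q^s)\,z^s}{\sin^2(\pi s)\,(aq^s,bq^s;q)_\infty}\,ds,$$ $$\mathrm{U}_{q,\lambda}(a,b;z)=\frac{-K_0}{2\pi i}\int_{-i\infty}^{i\infty}\frac{\pi\,(q^{1+s};q)_\infty\,\lambda^s\,\theta_q\!\left(\frac\lambda zq^s\right)}{\sin(\pi s)\,(aq^s,bq^s;q)_\infty\,\theta_q\!\left(\frac\lambda z\right)}\,ds,$$ in which the contour of integration separates the poles at $s=0,1,2,\ldots$ from the poles at $s+\frac{\ln a}{\ln q}=-m-n\frac{2\pi i}{\ln q}$ and $s+\frac{\ln b}{\ln q}=-m-n\frac{2\pi i}{\ln q}$ with $m\in\mathbb{N}_0$ and $n\in\mathbb{Z}$.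
   Context: Throughout $0<q<1$; $(a;q)_\infty=\prod_{n\ge0}(1-aq^n)$, $(a;q)_n=(a;q)_\infty/(aq^n;q)_\infty$, $(a_1,\dots,a_k;q)_n=\prod_j(a_j;q)_n$, $\binom s2=\frac{s(s-1)}2$ for complex $s$, $C_q=1/\sqrt{-2\pi\ln q}$, $$E_q(\tau)=\exp\left(\frac{\ln^2(\tau/\sqrt q)}{2\ln q}\right),\qquad\theta_q(\tau)=(q,-\tau,-q/\tau;q)_\infty=\sum_{n=-\infty}^\infty q^{\binom n2}\tau^n.$$ Let ${}_2\phi_1\!\left({a,b\atop0};q;x\right)=\sum_{n\ge0}\frac{(a,b;q)_n}{(q;q)_n}x^n$ for $|x|<1$, extended by analytic continuation in $x$. The functions are defined by $$\mathrm{U}_{q,E}(a,b;z)=C_q\int_0^\infty{}_2\phi_1\!\left({a,b\atop0};q;-t\right)E_q\!\left(\tfrac tz\right)\frac{dt}t,\qquad\mathrm{U}_{q,\theta}(a,b;z)=\frac{-1}{\ln q}\int_0^\infty\frac{{}_2\phi_1\!\left({a,b\atop0};q;-t\right)}{\theta_q(t/z)}\frac{dt}t,$$ $$\mathrm{U}_{q,\lambda}(a,b;z)=\sum_{n=-\infty}^\infty\frac{{}_2\phi_1\!\left({a,b\atop0};q;-q^n\lambda\right)}{\theta_q(q^n\lambda/z)}.$$ Here $a,b$ are nonzero complex numbers for which a separating contour exists (the two families of poles are disjoint). For $e=E,\theta$ take $|\arg z|<\pi$; for $e=\lambda$ take $|\arg\lambda|<\pi$, $z\neq0$ and $z\notin\{-q^n\lambda:n\in\mathbb{Z}\}$.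 Powers and logarithms are principal. *)

theory Defs
  imports "HOL-Complex_Analysis.Complex_Analysis"
begin

section \<open>Basic hypergeometric notation\<close>

definition qpoch_inf :: "real \<Rightarrow> complex \<Rightarrow> complex" where
  "qpoch_inf q a = (\<Prod>n. 1 - a * of_real q ^ n)"

definition qpoch :: "real \<Rightarrow> complex \<Rightarrow> nat \<Rightarrow> complex" where
  "qpoch q a n = qpoch_inf q a / qpoch_inf q (a * of_real q ^ n)"

text \<open>The quotient above is \<open>0 / 0\<close> if \<open>a = q powi (- m)\<close> with \<open>m \<ge> n\<close>. Otherwise it is the usual
  finite product.\<close>

lemma qpoch_eq_prod:
  assumes q: "0 < q" "q < 1" and nz: "qpoch_inf q (a * of_real q ^ n) \<noteq> 0"
  shows "qpoch q a n = (\<Prod>k<n. 1 - a * of_real q ^ k)"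
proof -
  let ?f = "\<lambda>k. 1 - a * complex_of_real q ^ k"
  have "summable (\<lambda>k. norm (?f k - 1))"
    using q by (simp add: norm_mult norm_power summable_mult summable_geometric)
  then have "convergent_prod ?f"
    using abs_convergent_prod_conv_summable abs_convergent_prod_imp_convergent_prod by blast
  from has_prod_ignore_initial_segment'[OF this, of n]
  have "qpoch_inf q a = (\<Prod>k<n. ?f k) * qpoch_inf q (a * of_real q ^ n)"
    by (simp add: has_prod_iff qpoch_inf_def power_add mult_ac)
  with nz show ?thesis by (simp add: qpoch_def)
qed

definition theta :: "real \<Rightarrow> complex \<Rightarrow> complex" where
  "theta q \<tau> = qpoch_inf q (of_real q) * qpoch_inf q (- \<tau>) * qpoch_inf q (- of_real q / \<tau>)"

definition Egauss :: "real \<Rightarrow> complex \<Rightarrow> complex" where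
  "Egauss q \<tau> = exp ((Ln (\<tau> / of_real (sqrt q)))\<^sup>2 / (2 * of_real (ln q)))"

definition Cconst :: "real \<Rightarrow> real" where
  "Cconst q = 1 / sqrt (- 2 * pi * ln q)"

definition phi21_series :: "real \<Rightarrow> complex \<Rightarrow> complex \<Rightarrow> complex \<Rightarrow> complex" where
  "phi21_series q a b x =
     (\<Sum>n. qpoch q a n * qpoch q b n / qpoch q (of_real q) n * x ^ n)"

text \<open>The series with lower parameter \<open>0\<close>, continued to the plane slit along \<open>[1, \<infinity>)\<close>. The continuation
  exists because the sum \<open>\<phi>\<close> of the series satisfies
  \<open>(1 - x) * \<phi> x = (1 - (a + b) * x) * \<phi> (q * x) + a * b * x * \<phi> (q\<^sup>2 * x)\<close>. It is unique on the slit
  plane, which is connected; its values on the slit are not used.\<close>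

definition phi21 :: "real \<Rightarrow> complex \<Rightarrow> complex \<Rightarrow> complex \<Rightarrow> complex" where
  "phi21 q a b = (SOME f. f holomorphic_on (- (of_real ` {1::real..})) \<and>
                          (\<forall>x\<in>ball 0 1. f x = phi21_series q a b x))"


section \<open>The functions \<open>U\<close>\<close>

definition UE_integrand :: "real \<Rightarrow> complex \<Rightarrow> complex \<Rightarrow> complex \<Rightarrow> real \<Rightarrow> complex" where
  "UE_integrand q a b z t = phi21 q a b (- of_real t) * Egauss q (of_real t / z) / of_real t"

definition UE :: "real \<Rightarrow> complex \<Rightarrow> complex \<Rightarrow> complex \<Rightarrow> complex" where
  "UE q a b z = of_real (Cconst q) * integral {0<..} (UE_integrand q a b z)"

definition Utheta_integrand :: "real \<Rightarrow> complex \<Rightarrow> complex \<Rightarrow> complex \<Rightarrow> real \<Rightarrow> complex" where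
  "Utheta_integrand q a b z t = phi21 q a b (- of_real t) / theta q (of_real t / z) / of_real t"

definition Utheta :: "real \<Rightarrow> complex \<Rightarrow> complex \<Rightarrow> complex \<Rightarrow> complex" where
  "Utheta q a b z = - 1 / of_real (ln q) * integral {0<..} (Utheta_integrand q a b z)"

definition Ulambda_summand ::
    "real \<Rightarrow> complex \<Rightarrow> complex \<Rightarrow> complex \<Rightarrow> complex \<Rightarrow> int \<Rightarrow> complex" where
  "Ulambda_summand q lam a b z n =
     phi21 q a b (- (of_real q powi n * lam)) / theta q (of_real q powi n * lam / z)"

definition Ulambda :: "real \<Rightarrow> complex \<Rightarrow> complex \<Rightarrow> complex \<Rightarrow> complex \<Rightarrow> complex" where
  "Ulambda q lam a b z = (\<Sum>\<^sub>\<infinity>n\<in>UNIV. Ulambda_summand q lam a b z n)"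


section \<open>Contours from \<open>-\<i>\<infinity>\<close> to \<open>\<i>\<infinity>\<close>\<close>

text \<open>A simple, piecewise continuously differentiable deformation of the imaginary axis, directed upwards.
  The speed and the distance to the points of the imaginary axis are bounded. This admits vertical lines,
  finite deformations of them, and lines with infinitely many indentations of bounded size.\<close>

definition vertical_contour :: "(real \<Rightarrow> complex) \<Rightarrow> bool" where
  "vertical_contour \<gamma> \<longleftrightarrow>
     inj \<gamma> \<and>
     (\<forall>T>0. \<gamma> piecewise_C1_differentiable_on {-T..T}) \<and>
     (\<exists>B. B-lipschitz_on UNIV \<gamma>) \<and>
     bounded (range (\<lambda>t. \<gamma> t - \<i> * of_real t))"

text \<open>The complement of a vertical contour contains \<open>{s. Re s < - R}\<close> and \<open>{s. Re s > R}\<close> for large \<open>R\<close>.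
  The left and right sides are the connected components that contain these half planes.\<close>

definition left_of :: "(real \<Rightarrow> complex) \<Rightarrow> complex \<Rightarrow> bool" where
  "left_of \<gamma> s \<longleftrightarrow> (\<forall>\<^sub>F r in at_top. connected_component (- range \<gamma>) s (of_real (- r)))"

definition right_of :: "(real \<Rightarrow> complex) \<Rightarrow> complex \<Rightarrow> bool" where
  "right_of \<gamma> s \<longleftrightarrow> (\<forall>\<^sub>F r in at_top. connected_component (- range \<gamma>) s (of_real r))"

text \<open>The sets \<open>L\<close> and \<open>R\<close> will be infinite. The positive distance between them and the contour, which the
  convergence of the integrals requires, is not automatic for a contour with infinitely many indentations.\<close>

definition separates :: "(real \<Rightarrow> complex) \<Rightarrow> complex set \<Rightarrow> complex set \<Rightarrow> bool" where
  "separates \<gamma> L R \<longleftrightarrow>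
     (\<forall>s\<in>L. left_of \<gamma> s) \<and> (\<forall>s\<in>R. right_of \<gamma> s) \<and>
     (\<exists>\<delta>>0. \<forall>s\<in>L \<union> R. \<forall>t. \<delta> \<le> dist (\<gamma> t) s)"

definition line_integrable :: "(real \<Rightarrow> complex) \<Rightarrow> (complex \<Rightarrow> complex) \<Rightarrow> bool" where
  "line_integrable \<gamma> f \<longleftrightarrow>
     (\<lambda>t. f (\<gamma> t) * vector_derivative \<gamma> (at t)) absolutely_integrable_on UNIV"

definition line_integral :: "(real \<Rightarrow> complex) \<Rightarrow> (complex \<Rightarrow> complex) \<Rightarrow> complex" where
  "line_integral \<gamma> f = integral UNIV (\<lambda>t. f (\<gamma> t) * vector_derivative \<gamma> (at t))"


section \<open>The Mellin--Barnes integrands\<close>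

definition pole_family :: "real \<Rightarrow> complex \<Rightarrow> complex set" where
  "pole_family q a =
     {s. \<exists>(m::nat) (n::int).
        s + Ln a / of_real (ln q) = - of_nat m - of_int n * (2 * of_real pi * \<i> / of_real (ln q))}"

definition K0 :: "real \<Rightarrow> complex \<Rightarrow> complex \<Rightarrow> complex" where
  "K0 q a b = qpoch_inf q a * qpoch_inf q b / qpoch_inf q (of_real q)"

definition MB_E :: "real \<Rightarrow> complex \<Rightarrow> complex \<Rightarrow> complex \<Rightarrow> complex \<Rightarrow> complex" where
  "MB_E q a b z s =
     of_real pi * qpoch_inf q (of_real q powr (1 + s)) * of_real q powr (- (s * (s - 1) / 2)) * z powr s /
     (sin (of_real pi * s) * (qpoch_inf q (a * of_real q powr s) * qpoch_inf q (b * of_real q powr s)))"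

definition MB_theta :: "real \<Rightarrow> complex \<Rightarrow> complex \<Rightarrow> complex \<Rightarrow> complex \<Rightarrow> complex" where
  "MB_theta q a b z s =
     (of_real pi)\<^sup>2 * qpoch_inf q (of_real q powr (1 + s)) * theta q (- (of_real q powr s)) * z powr s /
     ((sin (of_real pi * s))\<^sup>2 *
      (qpoch_inf q (a * of_real q powr s) * qpoch_inf q (b * of_real q powr s)))"

definition MB_lambda ::
    "real \<Rightarrow> complex \<Rightarrow> complex \<Rightarrow> complex \<Rightarrow> complex \<Rightarrow> complex \<Rightarrow> complex" where
  "MB_lambda q lam a b z s =
     of_real pi * qpoch_inf q (of_real q powr (1 + s)) * lam powr s *
       theta q (lam / z * of_real q powr s) /
     (sin (of_real pi * s) *
      (qpoch_inf q (a * of_real q powr s) * qpoch_inf q (b * of_real q powr s)) *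
      theta q (lam / z))"

end

theory Submission
  imports
    Defs
    "HOL-Probability.Sinc_Integral"
    "HOL-Probability.Characteristic_Functions"
    "HOL-Real_Asymp.Real_Asymp"
begin

text \<open>
  The three formulas are one formula, integrated against three kernels. Let \<open>\<phi>\<close> be the continued series. On
  the sector \<open>\<bar>Arg \<tau>\<bar> < \<pi>\<close>, the function \<open>\<phi> (- \<tau>)\<close> is \<open>- K\<^sub>0 / (2 \<pi> \<i>)\<close> times the integral along \<open>\<gamma>\<close> of
  \<open>Q s * \<tau> powr s\<close>, where \<open>Q s = \<pi> (q powr (1 + s); q)\<^sub>\<infinity> / (sin (\<pi> s) (a q powr s, b q powr s; q)\<^sub>\<infinity>)\<close>
  (\<open>phi21_MB\<close>). The functions \<open>U\<close> are integrals or sums of \<open>\<phi> (- \<tau>)\<close> over positive multiples of a fixed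
  number, with a weight. Fubini's theorem (\<open>MB_superposition\<close>) replaces \<open>\<tau> powr s\<close> under the contour integral by
  its weighted integral, the moment of order \<open>s\<close> of the kernel, and the three moments are explicit.

  \<^item> For \<open>E\<^sub>q\<close> the moment is a Gaussian integral in \<open>ln t\<close> (\<open>Egauss_moment\<close>).
  \<^item> On the orbit \<open>q powi n * \<lambda>\<close> the difference equation of \<open>\<theta>\<close> turns the moment into the series
    of Jacobi's triple product (\<open>theta_has_sum\<close>, \<open>theta_moment_has_sum\<close>).
  \<^item> For \<open>1 / \<theta>\<close> on the half line, summing over the orbits of multiplication by \<open>q\<close> gives an integral over one
    period of a quotient of theta functions. This quotient is quasi-periodic in the imaginary direction,
    and a rectangle around its single pole evaluates the integral (\<open>\<Psi>_period_integral\<close>, \<open>theta_moment\<close>).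

  The representation of \<open>\<phi>\<close> is proved for \<open>\<bar>\<tau>\<bar> < 1\<close> by moving the contour to the line \<open>Re s = N + 1/2\<close>: the
  residues at \<open>0, \<dots>, N\<close> are the terms of the series, and the integral over the line tends to \<open>0\<close>
  (\<open>shift_to_line\<close>, \<open>MB_series\<close>). Both sides are holomorphic in \<open>\<tau>\<close>, which extends the identity to the sector
  and shows that the continuation exists.

  The delicate point is the residue theorem for a contour that is only known to separate the poles in the sense of
  connected components. The winding number of \<open>\<gamma>\<close> is replaced by the integral of \<open>1 / (s - p) - 1 / (s - r)\<close> along
  \<open>\<gamma>\<close>, with a base point \<open>r\<close> far to the left. It is constant on components of the complement, and it is \<open>0\<close> on
  the left and \<open>- 2 \<pi> \<i>\<close> on the right, by explicit logarithms. Closed paths are obtained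
  by truncating \<open>\<gamma>\<close> and the line at heights that keep a fixed distance to all poles (\<open>free_height\<close>). Such a path may
  wind around a pole in any way, but as the truncation grows its winding numbers converge to the
  regularised ones, with a bound that is polynomial in the pole, whereas the residues decrease exponentially.
  Dominated convergence for the sum over the poles gives \<open>residues_between_contours\<close>.
\<close>

section \<open>Infinite products and theta functions\<close>

context
  fixes q :: real
  assumes q0: "0 < q" and q1: "q < 1"
begin

lemma qpoch_inf_convergent: "convergent_prod (\<lambda>k. 1 - a * complex_of_real q ^ k)"
proof -
  have "summable (\<lambda>k. norm ((1 - a * complex_of_real q ^ k) - 1))"
    using q0 q1 by (simp add: norm_mult norm_power summable_mult summable_geometric)
  then show ?thesis
    using abs_convergent_prod_conv_summable abs_convergent_prod_imp_convergent_prod by blast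
qed

lemma qpoch_inf_LIMSEQ: "(\<lambda>n. \<Prod>k<n. 1 - a * complex_of_real q ^ k) \<longlonglongrightarrow> qpoch_inf q a"
  using convergent_prod_LIMSEQ[OF qpoch_inf_convergent[of a]]
    LIMSEQ_lessThan_iff_atMost[of "\<lambda>A. \<Prod>k\<in>A. 1 - a * complex_of_real q ^ k"]
  unfolding qpoch_inf_def by blast

lemma qpoch_inf_shift:
  "qpoch_inf q a = (\<Prod>k<n. 1 - a * complex_of_real q ^ k) * qpoch_inf q (a * of_real q ^ n)"
  using has_prod_ignore_initial_segment'[OF qpoch_inf_convergent[of a], of n]
  by (simp add: has_prod_iff qpoch_inf_def power_add mult_ac)

lemma qpoch_inf_step: "qpoch_inf q a = (1 - a) * qpoch_inf q (a * of_real q)"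
  using qpoch_inf_shift[of a 1] by simp

lemma qpoch_inf_eq_0_iff: "qpoch_inf q a = 0 \<longleftrightarrow> (\<exists>k. a * of_real q ^ k = 1)"
proof
  assume "qpoch_inf q a = 0"
  then obtain k where "1 - a * complex_of_real q ^ k = 0"
    using prodinf_nonzero[OF qpoch_inf_convergent[of a]] unfolding qpoch_inf_def by blast
  then show "\<exists>k. a * of_real q ^ k = 1" by (intro exI[of _ k]) simp
next
  assume "\<exists>k. a * complex_of_real q ^ k = 1"
  then obtain k where "a * complex_of_real q ^ k = 1" ..
  then have "(\<Prod>j<Suc k. 1 - a * complex_of_real q ^ j) = 0" by simp
  then show "qpoch_inf q a = 0" using qpoch_inf_shift[of a "Suc k"] by simp
qed

lemma qpoch_inf_0 [simp]: "qpoch_inf q 0 = 1"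
  by (simp add: qpoch_inf_def)

lemma qpoch_inf_self_nonzero: "qpoch_inf q (of_real q) \<noteq> 0"
proof
  assume "qpoch_inf q (of_real q) = 0"
  then obtain k where "complex_of_real q * of_real q ^ k = 1"
    using qpoch_inf_eq_0_iff by auto
  then have "norm (complex_of_real (q ^ Suc k)) = 1" by simp
  moreover have "q ^ Suc k < 1" using q0 q1 by (intro power_Suc_less_one) auto
  ultimately show False using q0 by (simp add: norm_power norm_mult)
qed

lemma qpoch_inf_holomorphic: "qpoch_inf q holomorphic_on UNIV"
proof (rule holomorphic_uniform_sequence[where f="\<lambda>N x. \<Prod>n<N. 1 - x * of_real q ^ n"])
  show "(\<lambda>x. \<Prod>n<N. 1 - x * complex_of_real q ^ n) holomorphic_on UNIV" for N
    by (intro holomorphic_intros)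
next
  fix x :: complex
  let ?A = "cball x 1"
  have "uniformly_convergent_on ?A (\<lambda>N x. \<Prod>n<N. 1 - x * complex_of_real q ^ n)"
  proof (rule uniformly_convergent_on_prod')
    show "uniformly_convergent_on ?A (\<lambda>N y. \<Sum>n<N. norm ((1 - y * complex_of_real q ^ n) - 1))"
    proof (rule Weierstrass_m_test'_ev)
      show "\<forall>\<^sub>F n in sequentially. \<forall>y\<in>?A. norm (norm ((1 - y * complex_of_real q ^ n) - 1)) \<le> (norm x + 1) * q ^ n"
      proof (intro always_eventually allI ballI)
        fix n y assume "y \<in> ?A"
        then have "norm y \<le> norm x + 1"
          by (metis add.commute dist_norm mem_cball norm_minus_commute norm_triangle_sub order_trans add_left_mono)
        then show "norm (norm ((1 - y * complex_of_real q ^ n) - 1)) \<le> (norm x + 1) * q ^ n"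
          using q0 by (simp add: norm_mult norm_power mult_right_mono)
      qed
    qed (use q0 q1 in \<open>auto intro!: summable_mult summable_geometric\<close>)
  qed (auto intro!: continuous_intros)
  then obtain l where l: "uniform_limit ?A (\<lambda>N x. \<Prod>n<N. 1 - x * complex_of_real q ^ n) l sequentially"
    by (auto simp: uniformly_convergent_on_def)
  have "l y = qpoch_inf q y" if "y \<in> ?A" for y
    using tendsto_uniform_limitI[OF l that] qpoch_inf_LIMSEQ[of y] LIMSEQ_unique by blast
  then have "uniform_limit ?A (\<lambda>N x. \<Prod>n<N. 1 - x * complex_of_real q ^ n) (qpoch_inf q) sequentially"
    using l uniform_limit_cong'[of ?A "\<lambda>N x. \<Prod>n<N. 1 - x * complex_of_real q ^ n" _ l "qpoch_inf q" sequentially]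
    by simp
  then show "\<exists>d>0. cball x d \<subseteq> UNIV \<and> uniform_limit (cball x d) (\<lambda>N x. \<Prod>n<N. 1 - x * complex_of_real q ^ n) (qpoch_inf q) sequentially"
    by (intro exI[of _ 1]) auto
qed simp

lemma holomorphic_on_qpoch_inf [holomorphic_intros]:
  "f holomorphic_on A \<Longrightarrow> (\<lambda>x. qpoch_inf q (f x)) holomorphic_on A"
  using holomorphic_on_compose_gen[OF _ qpoch_inf_holomorphic] by (auto simp: o_def)

lemma continuous_on_qpoch_inf [continuous_intros]:
  "continuous_on A f \<Longrightarrow> continuous_on A (\<lambda>x. qpoch_inf q (f x))"
  using continuous_on_compose2[OF holomorphic_on_imp_continuous_on[OF qpoch_inf_holomorphic]] by auto

lemma measurable_qpoch_inf [measurable]: "qpoch_inf q \<in> borel_measurable borel"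
  by (intro borel_measurable_continuous_onI continuous_intros)

lemma theta_step:
  assumes "x \<noteq> 0"
  shows "theta q (of_real q * x) = theta q x / x"
proof -
  have 1: "qpoch_inf q (- x) = (1 + x) * qpoch_inf q (- (of_real q * x))"
    using qpoch_inf_step[of "-x"] by (simp add: mult.commute)
  have 2: "qpoch_inf q (- (1 / x)) = (1 + 1 / x) * qpoch_inf q (- of_real q / x)"
    using qpoch_inf_step[of "-(1/x)"] by (simp add: mult.commute)
  show ?thesis
  proof (cases "x = -1")
    case True
    then have "qpoch_inf q (-x) = 0" "qpoch_inf q (- (1 / x)) = 0" using 1 2 by simp_all
    then show ?thesis using True q0 by (simp add: theta_def)
  next
    case False
    then have "1 + x \<noteq> 0" by (metis add.commute add_eq_0_iff)
    then have "qpoch_inf q (- (of_real q * x)) = qpoch_inf q (- x) / (1 + x)" using 1 by simp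
    then show ?thesis using 2 assms q0 \<open>1 + x \<noteq> 0\<close>
      by (simp add: theta_def divide_simps) (simp add: algebra_simps)
  qed
qed

lemma theta_eq_0_iff:
  assumes "x \<noteq> 0"
  shows "theta q x = 0 \<longleftrightarrow> (\<exists>n::int. x = - (of_real q powi n))"
proof
  assume "theta q x = 0"
  then consider k where "-x * of_real q ^ k = 1" | k where "- of_real q / x * of_real q ^ k = 1"
    using qpoch_inf_self_nonzero by (auto simp: theta_def qpoch_inf_eq_0_iff)
  then show "\<exists>n::int. x = - (of_real q powi n)"
  proof cases
    case 1
    then have "x = - (of_real q powi (- int k))" using q0
      by (simp add: power_int_minus field_simps) (metis minus_mult_minus minus_minus mult.commute)
    then show ?thesis by blast
  next
    case 2
    then have "x = - (of_real q powi (int (Suc k)))" using q0 assms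
      unfolding power_int_of_nat by (simp add: field_simps) 
    then show ?thesis by blast
  qed
next
  assume "\<exists>n::int. x = - (of_real q powi n)"
  then obtain n :: int where n: "x = - (of_real q powi n)" by blast
  show "theta q x = 0"
  proof (cases "n \<le> 0")
    case True
    then have "-x * of_real q ^ (nat (-n)) = 1" using n q0
      by (simp add: power_int_def field_simps)
    then have "qpoch_inf q (-x) = 0" using qpoch_inf_eq_0_iff by blast
    then show ?thesis by (simp add: theta_def)
  next
    case False
    then obtain m where "n = int (Suc m)" by (metis gr0_implies_Suc not_le pos_int_cases)
    then have "x = - (of_real q ^ Suc m)" using n by (metis power_int_of_nat)
    then have "- of_real q / x * of_real q ^ m = 1" using q0 by simp
    then have "qpoch_inf q (- of_real q / x) = 0" using qpoch_inf_eq_0_iff by blast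
    then show ?thesis by (simp add: theta_def)
  qed
qed

lemma holomorphic_on_theta [holomorphic_intros]:
  "f holomorphic_on A \<Longrightarrow> (\<And>x. x \<in> A \<Longrightarrow> f x \<noteq> 0) \<Longrightarrow> (\<lambda>x. theta q (f x)) holomorphic_on A"
  unfolding theta_def by (intro holomorphic_intros) auto

lemma continuous_on_theta [continuous_intros]:
  "continuous_on A f \<Longrightarrow> (\<And>x. x \<in> A \<Longrightarrow> f x \<noteq> 0) \<Longrightarrow> continuous_on A (\<lambda>x. theta q (f x))"
  unfolding theta_def by (intro continuous_intros) auto

lemma measurable_theta [measurable]: "theta q \<in> borel_measurable borel"
  unfolding theta_def[abs_def] by measurable

end

section \<open>Euler's expansions and the triple product\<close>

text \<open>The polynomial \<open>n choose 2\<close> at integers of either sign, the exponent in the theta series.\<close>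

definition tri :: "int \<Rightarrow> int" where "tri n = n * (n - 1) div 2"

lemma tri_add: "tri (n + m) = tri n + tri m + n * m"
proof -
  have e: "2 * tri k = k * (k - 1)" for k
    unfolding tri_def by (cases "even k") auto
  have "2 * tri (n + m) = 2 * (tri n + tri m + n * m)"
    by (simp add: e distrib_left) (simp add: algebra_simps)
  then show ?thesis by simp
qed

lemma tri_Suc: "tri (n + 1) = tri n + n"
  using tri_add[of n 1] by (simp add: tri_def)

lemma tri_int: "tri (int n) = int (n choose 2)"
proof (induction n)
  case (Suc n)
  have "tri (int (Suc n)) = tri (int n) + int n" using tri_Suc[of "int n"] by (simp add: add.commute)
  then show ?case using Suc by (simp add: numeral_2_eq_2)
qed (simp add: tri_def)

lemma tri_minus: "tri (- int n) = int (Suc n choose 2)"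
proof -
  have "tri (- int n) = tri (int n) + int n"
    using tri_Suc[of "int n"] unfolding tri_def by (simp add: algebra_simps)
  then show ?thesis by (simp add: tri_int numeral_2_eq_2)
qed

lemma UNIV_int_split: "(UNIV :: int set) = range int \<union> range (\<lambda>n. - int (Suc n))"
proof -
  have "k \<in> range int \<union> range (\<lambda>n. - int (Suc n))" for k
    by (cases k rule: int_cases) auto
  then show ?thesis by auto
qed

lemma summable_on_int_split:
  fixes f :: "int \<Rightarrow> 'a :: banach"
  assumes "summable (\<lambda>n. norm (f (int n)))" "summable (\<lambda>n. norm (f (- int (Suc n))))"
  shows "f summable_on UNIV"
proof -
  have "f summable_on range int" "f summable_on range (\<lambda>n. - int (Suc n))"
    using norm_summable_imp_summable_on[OF assms(1)] norm_summable_imp_summable_on[OF assms(2)]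
    by (subst summable_on_reindex; auto simp: inj_on_def o_def)+
  then show ?thesis
    unfolding UNIV_int_split by (intro summable_on_Un_disjoint) auto
qed

context
  fixes q :: real
  assumes q0: "0 < q" and q1: "q < 1"
begin

lemma gauss_summable: "summable (\<lambda>n. q ^ (n choose 2) * y ^ n)"
proof -
  have "(\<lambda>n. q ^ n * \<bar>y\<bar>) \<longlonglongrightarrow> 0 * \<bar>y\<bar>" using q0 q1 by (intro tendsto_intros LIMSEQ_realpow_zero) auto
  then have "\<forall>\<^sub>F n in sequentially. q ^ n * \<bar>y\<bar> < 1/2" by (intro order_tendstoD(2)) auto
  then obtain N where N: "\<And>n. n \<ge> N \<Longrightarrow> q ^ n * \<bar>y\<bar> < 1/2" by (auto simp: eventually_sequentially)
  show ?thesis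
  proof (rule summable_ratio_test[of "1/2" N])
    fix n assume "n \<ge> N"
    have "norm (q ^ (Suc n choose 2) * y ^ Suc n) = (q ^ n * \<bar>y\<bar>) * norm (q ^ (n choose 2) * y ^ n)"
      using q0 by (simp add: numeral_2_eq_2 power_add norm_mult norm_power abs_mult)
    also have "\<dots> \<le> 1/2 * norm (q ^ (n choose 2) * y ^ n)"
      using N[OF \<open>n \<ge> N\<close>] by (intro mult_right_mono) auto
    finally show "norm (q ^ (Suc n choose 2) * y ^ Suc n) \<le> 1/2 * norm (q ^ (n choose 2) * y ^ n)" .
  qed simp
qed

lemma theta_series_abs_summable:
  assumes "x \<noteq> (0::complex)"
  shows "(\<lambda>n. norm (complex_of_real q powi tri n * x powi n)) summable_on UNIV"
proof (rule summable_on_int_split)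
  have "norm (norm (complex_of_real q powi tri (int n) * x powi int n)) = q ^ (n choose 2) * norm x ^ n" for n
    using q0 by (simp add: tri_int norm_mult norm_power norm_power_int)
  then show "summable (\<lambda>n. norm (norm (complex_of_real q powi tri (int n) * x powi int n)))"
    using gauss_summable[of "norm x"] by (simp only:)
  have "norm (norm (complex_of_real q powi tri (- int n) * x powi (- int n))) = q ^ (n choose 2) * (q / norm x) ^ n" for n
    using q0 unfolding tri_minus power_int_of_nat
    by (simp add: norm_mult norm_power numeral_2_eq_2 power_add power_int_minus field_simps norm_inverse norm_divide)
  then have "summable (\<lambda>n. norm (norm (complex_of_real q powi tri (- int n) * x powi (- int n))))"
    using gauss_summable[of "q / norm x"] by (simp only:)
  from this[THEN summable_ignore_initial_segment, of 1]
  show "summable (\<lambda>n. norm (norm (complex_of_real q powi tri (- int (Suc n)) * x powi (- int (Suc n)))))"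
    by simp
qed

abbreviation (input) "cq \<equiv> complex_of_real q"

lemma qpoch_inf_q_powi_nonzero: "qpoch_inf q (cq * cq ^ n) \<noteq> 0"
  using qpoch_inf_self_nonzero[OF q0 q1] qpoch_inf_shift[OF q0 q1, of cq n] by auto

lemma qpoch_q_0: "qpoch q cq 0 = 1"
  using qpoch_inf_self_nonzero[OF q0 q1] by (simp add: qpoch_def)

lemma qpoch_q_nonzero: "qpoch q cq n \<noteq> 0"
  using qpoch_inf_self_nonzero[OF q0 q1] qpoch_inf_q_powi_nonzero by (simp add: qpoch_def)

lemma qpoch_q_Suc: "qpoch q cq (Suc n) = qpoch q cq n * (1 - cq ^ Suc n)"
proof -
  have "qpoch_inf q (cq * cq ^ n) = (1 - cq ^ Suc n) * qpoch_inf q (cq * cq ^ Suc n)"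
    using qpoch_inf_step[OF q0 q1, of "cq * cq ^ n"] by (simp add: mult_ac)
  then show ?thesis
    using qpoch_inf_q_powi_nonzero[of n] qpoch_inf_q_powi_nonzero[of "Suc n"]
    by (simp add: qpoch_def divide_simps)
qed

lemma norm_one_minus_qpow_ge: "1 - q \<le> norm (1 - cq ^ Suc n)"
proof -
  have "q ^ Suc n \<le> q" using q0 q1 by (simp add: mult_left_le power_le_one)
  then have "1 - q \<le> 1 - q ^ Suc n" by simp
  also have "\<dots> = norm (complex_of_real (1 - q ^ Suc n))"
    using \<open>q ^ Suc n \<le> q\<close> q1 by (subst norm_of_real) simp
  finally show ?thesis by simp
qed

lemma q_pow_tendsto_0: "(\<lambda>n. cq ^ n) \<longlonglongrightarrow> 0"
  using q0 q1 by (intro LIMSEQ_power_zero) simp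

text \<open>Both of Euler's expansions hold because the series satisfy the first-order \<open>q\<close>-difference equation of
  the product and are continuous at \<open>0\<close>, where they equal \<open>1\<close>.\<close>

lemma powser_qlimit:
  assumes "summable (\<lambda>n. a n * K ^ n)" "K \<noteq> (0::complex)"
  shows "(\<lambda>N. \<Sum>n. a n * (x * cq ^ N) ^ n) \<longlonglongrightarrow> a 0"
proof -
  have "isCont (\<lambda>x. \<Sum>n. a n * x ^ n) 0"
    using assms by (intro isCont_powser[where K=K]) auto
  moreover have "(\<lambda>N. x * cq ^ N) \<longlonglongrightarrow> 0"
    using tendsto_mult_left[OF q_pow_tendsto_0, of x] by simp
  ultimately have "(\<lambda>N. \<Sum>n. a n * (x * cq ^ N) ^ n) \<longlonglongrightarrow> (\<Sum>n. a n * 0 ^ n)"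
    using isCont_tendsto_compose by blast
  then show ?thesis by (simp only: powser_zero)
qed

lemma euler_exp_summable: "summable (\<lambda>n. norm (cq ^ (n choose 2) / qpoch q cq n * x ^ n))"
proof -
  define f where "f n = norm (cq ^ (n choose 2) / qpoch q cq n * x ^ n)" for n
  have "(\<lambda>n. q ^ n * (norm x / (1 - q))) \<longlonglongrightarrow> 0 * (norm x / (1 - q))"
    using q0 q1 by (intro tendsto_intros LIMSEQ_realpow_zero) auto
  then have "\<forall>\<^sub>F n in sequentially. q ^ n * (norm x / (1 - q)) < 1/2" by (intro order_tendstoD(2)) auto
  then obtain N where N: "\<And>n. n \<ge> N \<Longrightarrow> q ^ n * (norm x / (1 - q)) < 1/2" by (auto simp: eventually_sequentially)
  have "summable f"
  proof (rule summable_ratio_test[of "1/2" N])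
    fix n assume "n \<ge> N"
    have "norm (f (Suc n)) = (q ^ n * (norm x / norm (1 - cq ^ Suc n))) * f n"
      using q0 by (simp add: f_def qpoch_q_Suc norm_mult norm_divide norm_power numeral_2_eq_2 power_add del: power_Suc)
         (simp add: field_simps)
    also have "\<dots> \<le> (q ^ n * (norm x / (1 - q))) * f n"
      using norm_one_minus_qpow_ge[of n] q0 q1
      by (intro mult_right_mono mult_left_mono divide_left_mono mult_pos_pos) (auto simp: f_def intro: less_le_trans[of 0 "1 - q"])
    also have "\<dots> \<le> 1/2 * norm (f n)"
      using mult_right_mono[OF less_imp_le[OF N[OF \<open>n \<ge> N\<close>]], of "f n"] by (simp add: f_def)
    finally show "norm (f (Suc n)) \<le> 1/2 * norm (f n)" .
  qed simp
  then show ?thesis unfolding f_def .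
qed

lemma euler_exp: "(\<lambda>n. cq ^ (n choose 2) / qpoch q cq n * x ^ n) sums qpoch_inf q (- x)"
proof -
  define a where "a n = cq ^ (n choose 2) / qpoch q cq n" for n
  define g where "g x = (\<Sum>n. a n * x ^ n)" for x
  have sm: "summable (\<lambda>n. a n * x ^ n)" for x
    using summable_norm_cancel[OF euler_exp_summable[of x]] by (simp add: a_def)
  have rec: "a (Suc n) * (1 - cq ^ Suc n) = cq ^ n * a n" for n
  proof -
    have "1 - cq ^ Suc n \<noteq> 0" using norm_one_minus_qpow_ge[of n] q1 by auto
    then show ?thesis using qpoch_q_nonzero[of n]
      by (simp add: a_def qpoch_q_Suc numeral_2_eq_2 power_add divide_simps del: power_Suc)
  qed
  have fe: "g x = (1 + x) * g (x * cq)" for x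
  proof -
    have "g x - g (x * cq) = (\<Sum>n. a n * (1 - cq ^ n) * x ^ n)"
      unfolding g_def by (subst suminf_diff[OF sm sm]) (simp add: algebra_simps power_mult_distrib)
    also have "\<dots> = (\<Sum>n. a (Suc n) * (1 - cq ^ Suc n) * x ^ Suc n)"
    proof -
      have "(\<lambda>n. a n * (1 - cq ^ n) * x ^ n) = (\<lambda>n. a n * x ^ n - a n * (x * cq) ^ n)"
        by (auto simp: algebra_simps power_mult_distrib)
      then have "summable (\<lambda>n. a n * (1 - cq ^ n) * x ^ n)"
        using summable_diff[OF sm sm, of x "x * cq"] by simp
      from suminf_split_head[OF this] show ?thesis by simp
    qed
    also have "\<dots> = (\<Sum>n. x * (a n * (x * cq) ^ n))"
      unfolding rec by (simp add: power_mult_distrib mult_ac)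
    also have "\<dots> = x * g (x * cq)" unfolding g_def by (rule suminf_mult[OF sm])
    finally show ?thesis by (simp add: algebra_simps)
  qed
  have it: "g x = (\<Prod>k<n. 1 - (- x) * cq ^ k) * g (x * cq ^ n)" for n
    by (induction n) (simp_all add: fe[of "x * cq ^ _"] mult_ac)
  have "(\<lambda>n. (\<Prod>k<n. 1 - (- x) * cq ^ k) * g (x * cq ^ n)) \<longlonglongrightarrow> qpoch_inf q (- x) * a 0"
    unfolding g_def using sm[of 1]
    by (intro tendsto_mult qpoch_inf_LIMSEQ[OF q0 q1] powser_qlimit[of a 1]) auto
  then have "g x = qpoch_inf q (-x)"
    unfolding it[symmetric] by (simp add: a_def qpoch_q_0 LIMSEQ_const_iff numeral_2_eq_2)
  then show ?thesis using sm[of x] by (simp add: g_def a_def sums_iff)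
qed

lemma euler_inv:
  assumes "norm x < 1"
  shows "summable (\<lambda>n. norm (x ^ n / qpoch q cq n))"
    and "(\<lambda>n. x ^ n / qpoch q cq n) sums (1 / qpoch_inf q x)"
proof -
  define a where "a n = 1 / qpoch q cq n" for n
  have lim: "(\<lambda>n. qpoch q cq n) \<longlonglongrightarrow> qpoch_inf q cq / qpoch_inf q 0"
  proof -
    have "isCont (qpoch_inf q) 0"
      using continuous_on_qpoch_inf[OF q0 q1 continuous_on_id, of UNIV] by (simp add: continuous_on_eq_continuous_at)
    moreover have "(\<lambda>n. cq * cq ^ n) \<longlonglongrightarrow> 0" using tendsto_mult_left[OF q_pow_tendsto_0, of cq] by simp
    ultimately have "(\<lambda>n. qpoch_inf q (cq * cq ^ n)) \<longlonglongrightarrow> qpoch_inf q 0" by (rule isCont_tendsto_compose)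
    then show ?thesis unfolding qpoch_def by (intro tendsto_intros) (auto simp: q0 q1 qpoch_inf_0)
  qed
  have "(\<lambda>n. 1 / qpoch q cq n) \<longlonglongrightarrow> 1 / (qpoch_inf q cq / qpoch_inf q 0)"
    using qpoch_inf_self_nonzero[OF q0 q1] by (intro tendsto_intros lim) (auto simp: q0 q1 qpoch_inf_0)
  then have "Bseq a" unfolding a_def by (intro convergent_imp_Bseq convergentI)
  then obtain K where K: "\<And>n. norm (a n) \<le> K" by (auto simp: Bseq_def)
  have sm': "summable (\<lambda>n. norm (a n * y ^ n))" if "norm y < 1" for y
    by (rule summable_comparison_test'[of "\<lambda>n. K * norm y ^ n" 0])
       (use that K in \<open>auto intro!: summable_mult summable_geometric mult_right_mono simp: norm_mult norm_power\<close>)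
  show "summable (\<lambda>n. norm (x ^ n / qpoch q cq n))" using sm'[OF assms] by (simp add: a_def norm_divide norm_mult)
  have sm: "summable (\<lambda>n. a n * y ^ n)" if "norm y < 1" for y
    using summable_norm_cancel[OF sm'[OF that]] .
  define g where "g x = (\<Sum>n. a n * x ^ n)" for x
  have rec: "a (Suc n) * (1 - cq ^ Suc n) = a n" for n
  proof -
    have "1 - cq ^ Suc n \<noteq> 0" using norm_one_minus_qpow_ge[of n] q1 by auto
    then show ?thesis using qpoch_q_nonzero[of n]
      by (simp add: a_def qpoch_q_Suc divide_simps del: power_Suc)
  qed
  have less: "norm (y * cq) < 1" if "norm y < 1" for y
    using that q0 q1 mult_strict_mono[of "norm y" 1 q 1] by (simp add: norm_mult)
  have fe: "g (y * cq) = (1 - y) * g y" if y: "norm y < 1" for y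
  proof -
    have "g y - g (y * cq) = (\<Sum>n. a n * (1 - cq ^ n) * y ^ n)"
      unfolding g_def by (subst suminf_diff[OF sm sm]) (use y less in \<open>simp_all add: algebra_simps power_mult_distrib\<close>)
    also have "\<dots> = (\<Sum>n. a (Suc n) * (1 - cq ^ Suc n) * y ^ Suc n)"
    proof -
      have "(\<lambda>n. a n * (1 - cq ^ n) * y ^ n) = (\<lambda>n. a n * y ^ n - a n * (y * cq) ^ n)"
        by (auto simp: algebra_simps power_mult_distrib)
      then have "summable (\<lambda>n. a n * (1 - cq ^ n) * y ^ n)"
        using summable_diff[OF sm[OF y] sm[OF less[OF y]]] by simp
      from suminf_split_head[OF this] show ?thesis by simp
    qed
    also have "\<dots> = (\<Sum>n. y * (a n * y ^ n))"
      unfolding rec by (simp add: mult_ac)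
    also have "\<dots> = y * g y" unfolding g_def by (rule suminf_mult[OF sm[OF y]])
    finally show ?thesis by (simp add: algebra_simps)
  qed
  have lt: "norm (x * cq ^ n) < 1" for n
  proof (induction n)
    case (Suc n)
    then show ?case using less[of "x * cq ^ n"] by (simp add: mult_ac)
  qed (use assms in simp)
  have it: "g (x * cq ^ n) = (\<Prod>k<n. 1 - x * cq ^ k) * g x" for n
    by (induction n) (use fe[OF lt] in \<open>simp_all add: mult_ac\<close>)
  have "(\<lambda>n. g (x * cq ^ n)) \<longlonglongrightarrow> a 0"
    unfolding g_def using sm[of "1/2"] by (intro powser_qlimit[of a "1/2"]) auto
  moreover have "(\<lambda>n. (\<Prod>k<n. 1 - x * cq ^ k) * g x) \<longlonglongrightarrow> qpoch_inf q x * g x"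
    by (intro tendsto_intros qpoch_inf_LIMSEQ[OF q0 q1])
  ultimately have "qpoch_inf q x * g x = 1"
    unfolding it using LIMSEQ_unique by (fastforce simp: a_def qpoch_q_0)
  then have "g x = 1 / qpoch_inf q x" by (metis div_by_1 mult_eq_0_iff nonzero_eq_divide_eq mult.commute one_neq_zero)
  then show "(\<lambda>n. x ^ n / qpoch q cq n) sums (1 / qpoch_inf q x)"
    using sm[OF assms] by (simp add: g_def a_def sums_iff)
qed

lemma qpoch_inf_q_powi:
  "qpoch_inf q (cq powi (n + 1)) = (if n \<ge> 0 then qpoch_inf q cq / qpoch q cq (nat n) else 0)"
proof (cases "n \<ge> 0")
  case True
  then have "cq powi (n + 1) = cq * cq ^ nat n"
    by (simp add: power_int_def nat_add_distrib)
  then show ?thesis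
    using True qpoch_inf_q_powi_nonzero qpoch_inf_self_nonzero[OF q0 q1] by (simp add: qpoch_def)
next
  case False
  then have "cq powi (n + 1) * cq ^ nat (- n - 1) = cq powi (n + 1) * cq powi (- n - 1)"
    by (simp add: power_int_def)
  also have "\<dots> = 1" using q0 by (subst power_int_add[symmetric]) auto
  finally show ?thesis using False qpoch_inf_eq_0_iff[OF q0 q1] by auto
qed

definition theta_series :: "complex \<Rightarrow> complex" where
  "theta_series x = (\<Sum>\<^sub>\<infinity>n::int. cq powi tri n * x powi n)"

lemma theta_series_step:
  assumes "x \<noteq> 0"
  shows "theta_series (cq * x) = theta_series x / x"
proof -
  have "theta_series x = (\<Sum>\<^sub>\<infinity>n\<in>range (\<lambda>n. n + 1). cq powi tri n * x powi n)"
    unfolding theta_series_def by (intro infsum_cong_neutral) (auto simp: image_iff intro: exI[of _ "_ - 1"])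
  also have "\<dots> = (\<Sum>\<^sub>\<infinity>n. cq powi tri (n + 1) * x powi (n + 1))"
    by (subst infsum_reindex) (auto simp: o_def)
  also have "\<dots> = (\<Sum>\<^sub>\<infinity>n. x * (cq powi tri n * (cq * x) powi n))"
    using q0 assms by (simp add: tri_Suc power_int_add power_int_mult_distrib mult_ac)
  also have "\<dots> = x * theta_series (cq * x)" unfolding theta_series_def by (rule infsum_cmult_right')
  finally show ?thesis using assms by simp
qed

text \<open>A double series is summed in two orders. Summing over \<open>n\<close> first gives a shifted copy of the theta series for
  each term of Euler's series for \<open>1 / (- q / x; q)\<^sub>\<infinity>\<close>, which converges because \<open>q < \<bar>x\<bar>\<close>. Summing over \<open>m\<close> first
  gives the infinite products \<open>(q ^ (n + 1); q)\<^sub>\<infinity>\<close>; they vanish for \<open>n < 0\<close>, and the rest is Euler's series for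
  \<open>(- x; q)\<^sub>\<infinity>\<close>.\<close>

lemma theta_series_eq_theta_aux:
  assumes x: "q < norm x"
  shows "theta_series x = theta q x"
proof -
  have x0: "x \<noteq> 0" using x q0 by auto
  define f where "f m n = (- cq / x) ^ m / qpoch q cq m * (cq powi tri (n + int m) * x powi (n + int m))"
    for m :: nat and n :: int
  have f_alt: "f m n = cq powi tri n * x powi n * (cq ^ (m choose 2) / qpoch q cq m * (- (cq powi (n + 1))) ^ m)" for m n
  proof -
    have "cq powi tri (n + int m) * x powi (n + int m) =
      cq powi tri n * cq ^ (m choose 2) * cq powi (n * int m) * (x powi n * x ^ m)"
      using q0 x0 by (simp add: tri_add tri_int power_int_add)
    moreover have "(- (cq powi (n + 1))) ^ m = (-1) ^ m * cq powi (n * int m) * cq ^ m"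
      using q0 by (subst power_minus) (simp add: power_int_add power_mult_distrib power_int_mult)
    moreover have "(- cq / x) ^ m * x ^ m = (-1) ^ m * cq ^ m"
      using x0 power_minus[of cq m] by (simp add: power_mult_distrib[symmetric])
    ultimately show ?thesis using qpoch_q_nonzero[of m] by (simp add: f_def field_simps)
  qed
  have shift: "((\<lambda>n. g (n + int m)) has_sum s) UNIV" if "(g has_sum s) UNIV" for g :: "int \<Rightarrow> 'b::{topological_comm_monoid_add}" and m s
    using that by (subst has_sum_reindex_bij_betw[where g="\<lambda>n. n + int m"])
      (auto intro!: bij_betwI[where g="\<lambda>n. n - int m"])
  define G where "G n = norm (cq powi tri n * x powi n)" for n
  have G: "G summable_on UNIV" unfolding G_def by (rule theta_series_abs_summable[OF x0])
  have Sx: "((\<lambda>n. cq powi tri n * x powi n) has_sum theta_series x) UNIV"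
    unfolding theta_series_def
    using abs_summable_summable[OF theta_series_abs_summable[OF x0]] by simp
  have qx: "norm (- cq / x) < 1" using x q0 by (simp add: norm_divide divide_simps)
  have row: "((\<lambda>n. f m n) has_sum (- cq / x) ^ m / qpoch q cq m * theta_series x) UNIV" for m
    unfolding f_def by (intro has_sum_cmult_right shift Sx)
  have nrow: "((\<lambda>n. norm (f m n)) has_sum norm ((- cq / x) ^ m / qpoch q cq m) * infsum G UNIV) UNIV" for m
    using has_sum_cmult_right[OF shift[OF has_sum_infsum[OF G]], of "norm ((- cq / x) ^ m / qpoch q cq m)" m]
    by (simp add: f_def G_def norm_mult norm_divide mult_ac)
  have "(\<lambda>p. norm ((\<lambda>(m,n). f m n) p)) summable_on (UNIV \<times> UNIV)"
  proof (subst Infinite_Sum.abs_summable_on_Sigma_iff, intro conjI ballI)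
    show "(\<lambda>n. norm (case (m, n) of (m, n) \<Rightarrow> f m n)) summable_on UNIV" for m
      using nrow[of m] by (auto simp: summable_on_def)
    have "(\<lambda>m. norm ((- cq / x) ^ m / qpoch q cq m) * infsum G UNIV) summable_on UNIV"
      using euler_inv(1)[OF qx]
      by (intro summable_on_cmult_left) (auto simp: summable_on_UNIV_nonneg_real_iff)
    moreover have "(\<Sum>\<^sub>\<infinity>n. norm (f m n)) = norm ((- cq / x) ^ m / qpoch q cq m) * infsum G UNIV" for m
      using infsumI[OF nrow[of m]] .
    ultimately show "(\<lambda>m. norm (\<Sum>\<^sub>\<infinity>n. norm (case (m, n) of (m, n) \<Rightarrow> f m n))) summable_on UNIV"
      by (simp add: norm_mult G_def infsum_nonneg norm_divide norm_power abs_mult)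
  qed
  then have sm: "(\<lambda>(m,n). f m n) summable_on (UNIV \<times> UNIV)" by (rule abs_summable_summable)
  have "(\<Sum>\<^sub>\<infinity>m. \<Sum>\<^sub>\<infinity>n. f m n) = (\<Sum>\<^sub>\<infinity>n. \<Sum>\<^sub>\<infinity>m. f m n)"
    using infsum_swap_banach[OF sm] .
  moreover have "(\<Sum>\<^sub>\<infinity>m. \<Sum>\<^sub>\<infinity>n. f m n) = theta_series x / qpoch_inf q (- cq / x)"
  proof -
    have "((\<lambda>m. (- cq / x) ^ m / qpoch q cq m) has_sum (1 / qpoch_inf q (- cq / x))) UNIV"
      by (intro norm_summable_imp_has_sum euler_inv[OF qx])
    then have "((\<lambda>m. (- cq / x) ^ m / qpoch q cq m * theta_series x) has_sum (1 / qpoch_inf q (- cq / x) * theta_series x)) UNIV"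
      by (rule has_sum_cmult_left)
    then show ?thesis using infsumI[OF row] infsumI by fastforce
  qed
  moreover have "(\<Sum>\<^sub>\<infinity>n. \<Sum>\<^sub>\<infinity>m. f m n) = qpoch_inf q cq * qpoch_inf q (-x)"
  proof -
    have "(\<Sum>\<^sub>\<infinity>m. f m n) = cq powi tri n * x powi n * qpoch_inf q (cq powi (n + 1))" for n
    proof -
      have "((\<lambda>m. cq ^ (m choose 2) / qpoch q cq m * (- (cq powi (n + 1))) ^ m) has_sum qpoch_inf q (- (- (cq powi (n + 1))))) UNIV"
        by (intro norm_summable_imp_has_sum euler_exp euler_exp_summable)
      from infsumI[OF has_sum_cmult_right[OF this, of "cq powi tri n * x powi n"]]
      show ?thesis unfolding f_alt by simp
    qed
    then have "(\<Sum>\<^sub>\<infinity>n. \<Sum>\<^sub>\<infinity>m. f m n) = (\<Sum>\<^sub>\<infinity>n::int. cq powi tri n * x powi n * qpoch_inf q (cq powi (n + 1)))"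
      by simp
    also have "\<dots> = (\<Sum>\<^sub>\<infinity>n\<in>range int. cq powi tri n * x powi n * qpoch_inf q (cq powi (n + 1)))"
      by (intro infsum_cong_neutral) (auto simp: qpoch_inf_q_powi image_iff intro: nat_0_le[symmetric])
    also have "\<dots> = (\<Sum>\<^sub>\<infinity>m. qpoch_inf q cq * (cq ^ (m choose 2) / qpoch q cq m * x ^ m))"
      by (subst infsum_reindex) (auto simp: o_def qpoch_inf_q_powi tri_int intro!: infsum_cong)
    also have "\<dots> = qpoch_inf q cq * qpoch_inf q (-x)"
      by (intro infsumI has_sum_cmult_right norm_summable_imp_has_sum euler_exp euler_exp_summable)
    finally show ?thesis .
  qed
  ultimately have "theta_series x / qpoch_inf q (- cq / x) = qpoch_inf q cq * qpoch_inf q (-x)" by simp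
  moreover have "qpoch_inf q (- cq / x) \<noteq> 0"
  proof
    assume "qpoch_inf q (- cq / x) = 0"
    then obtain k where "norm (- cq / x * cq ^ k) = 1" by (metis norm_one qpoch_inf_eq_0_iff[OF q0 q1])
    moreover have "norm (- cq / x * cq ^ k) \<le> norm (- cq / x) * 1"
      unfolding norm_mult using q0 q1 by (intro mult_left_mono) (auto simp: norm_power power_le_one)
    ultimately show False using qx by simp
  qed
  ultimately show ?thesis by (simp add: theta_def field_simps)
qed

text \<open>Jacobi's triple product. Both sides satisfy the same difference equation, which carries the identity from
  \<open>q < \<bar>x\<bar>\<close> to all \<open>x \<noteq> 0\<close>.\<close>

lemma theta_has_sum:
  assumes "x \<noteq> 0"
  shows "((\<lambda>n. cq powi tri n * x powi n) has_sum theta q x) UNIV"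
proof -
  have *: "theta_series (cq ^ k * y) = theta q (cq ^ k * y)" if "q < norm y" for k y
  proof (induction k)
    case (Suc k)
    have "cq ^ k * y \<noteq> 0" using that q0 by auto
    then show ?case using Suc theta_series_step[of "cq ^ k * y"] theta_step[OF q0 q1, of "cq ^ k * y"]
      by (simp add: mult_ac)
  qed (simp add: theta_series_eq_theta_aux that)
  have "(\<lambda>k. q * q ^ k) \<longlonglongrightarrow> q * 0" using q0 q1 by (intro tendsto_intros LIMSEQ_realpow_zero) auto
  then have "\<forall>\<^sub>F k in sequentially. q * q ^ k < norm x" using assms by (intro order_tendstoD(2)) auto
  then obtain k where k: "q * q ^ k < norm x" by (auto simp: eventually_sequentially)
  then have "q < norm (x / cq ^ k)" using q0 by (simp add: norm_divide norm_power field_simps)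
  from *[OF this, of k] have "theta_series x = theta q x" using q0 by simp
  then show ?thesis
    using abs_summable_summable[OF theta_series_abs_summable[OF assms]]
    unfolding theta_series_def by (metis has_sum_infsum)
qed

lemma theta_powi:
  assumes "x \<noteq> 0"
  shows "theta q (cq powi n * x) = theta q x / (cq powi tri n * x powi n)"
proof -
  have st: "theta q (cq powi (n + 1) * x) = theta q (cq powi n * x) / (cq powi n * x)" for n
    using theta_step[OF q0 q1, of "cq powi n * x"] q0 assms by (simp add: power_int_add mult_ac)
  show ?thesis
  proof (induction n rule: int_induct[where k=0])
    case base
    then show ?case by (simp add: tri_def)
  next
    case (step1 i)
    then show ?case using q0 assms unfolding st tri_Suc by (simp add: power_int_add field_simps)
  next
    case (step2 i)
    have "theta q (cq powi (i - 1) * x) = theta q (cq powi i * x) * (cq powi (i - 1) * x)"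
      using st[of "i - 1"] q0 assms by simp
    moreover have "cq powi tri i = cq powi tri (i - 1) * cq powi (i - 1)"
      using tri_Suc[of "i - 1"] q0 by (simp add: power_int_add[symmetric])
    moreover have "x powi i = x powi (i - 1) * x"
      using assms power_int_add[of x "i - 1" 1] by simp
    moreover have "cq powi (i - 1) \<noteq> 0" using q0 by simp
    ultimately show ?case using step2(2) assms q0 by simp
  qed
qed

end

section \<open>Integration along vertical contours\<close>

text \<open>A Lebesgue integral, to which dominated convergence and Fubini's theorem apply directly. The gauge integral in
  \<^const>\<open>line_integral\<close> is compared with it at the end.\<close>

definition curve_integral :: "(real \<Rightarrow> complex) \<Rightarrow> (complex \<Rightarrow> complex) \<Rightarrow> complex" where
  "curve_integral \<gamma> f = (\<integral>t. f (\<gamma> t) * vector_derivative \<gamma> (at t) \<partial>lborel)"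

lemma integrable_inverse_1_plus_sq: "integrable lborel (\<lambda>t::real. C / (1 + t\<^sup>2))"
proof -
  have "integrable lborel (\<lambda>x::real. inverse (1 + x\<^sup>2))"
    using integrable_inverse_1_plus_square by (simp add: set_integrable_def)
  from integrable_mult_right[OF this, of C] show ?thesis by (simp add: divide_inverse)
qed

text \<open>The constant in the quadratic decay of the difference of two Cauchy kernels. Its dependence on the poles is kept
  explicit because it will be summed over all poles \<open>p'\<close>; polynomial growth is all that matters.\<close>

definition kernel_const :: "real \<Rightarrow> complex \<Rightarrow> complex \<Rightarrow> real" where
  "kernel_const \<delta> p p' = norm (p' - p) * (4 + (2 + 2 * (norm p)\<^sup>2 + 2 * (norm p')\<^sup>2) / \<delta>\<^sup>2)"

lemma kernel_const_nonneg: "\<delta> > 0 \<Longrightarrow> kernel_const \<delta> p p' \<ge> 0"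
  by (simp add: kernel_const_def)

lemma kernel_decay:
  assumes \<delta>: "\<delta> > 0" "\<delta> \<le> norm (s - p)" "\<delta> \<le> norm (s - p')"
  shows "norm (1 / (s - p') - 1 / (s - p)) \<le> kernel_const \<delta> p p' / (1 + (Im s)\<^sup>2)"
proof -
  have *: "1 + (Im s)\<^sup>2 \<le> (norm (s - p))\<^sup>2 * (2 + (1 + 2 * (norm p)\<^sup>2) / \<delta>\<^sup>2)" if "\<delta> \<le> norm (s - p)" for p
  proof -
    have "\<bar>Im s\<bar> \<le> norm (s - p) + norm p"
      using abs_Im_le_cmod[of s] norm_triangle_sub[of s p] by linarith
    then have "(Im s)\<^sup>2 \<le> (norm (s - p) + norm p)\<^sup>2" by (intro abs_le_square_iff[THEN iffD1]) auto
    also have "\<dots> \<le> 2 * (norm (s - p))\<^sup>2 + 2 * (norm p)\<^sup>2"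
      using sum_squares_ge_zero[of "norm (s - p) - norm p" 0] by (simp add: power2_eq_square algebra_simps)
    finally have "1 + (Im s)\<^sup>2 \<le> 2 * (norm (s - p))\<^sup>2 + (1 + 2 * (norm p)\<^sup>2) * 1" by simp
    also have "\<dots> \<le> 2 * (norm (s - p))\<^sup>2 + (1 + 2 * (norm p)\<^sup>2) * ((norm (s - p))\<^sup>2 / \<delta>\<^sup>2)"
      using \<delta>(1) power_mono[OF that, of 2] by (intro add_left_mono mult_left_mono) auto
    finally show ?thesis by (simp add: algebra_simps)
  qed
  define x y where "x = norm (s - p)" and "y = norm (s - p')"
  have xy: "x > 0" "y > 0" using \<delta> by (auto simp: x_def y_def)
  define A where "A = 2 + (1 + 2 * (norm p)\<^sup>2) / \<delta>\<^sup>2"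
  define A' where "A' = 2 + (1 + 2 * (norm p')\<^sup>2) / \<delta>\<^sup>2"
  define M where "M = A + A'"
  have A: "A \<ge> 0" "A' \<ge> 0" by (auto simp: A_def A'_def)
  have "1 + (Im s)\<^sup>2 \<le> x\<^sup>2 * M" "1 + (Im s)\<^sup>2 \<le> y\<^sup>2 * M"
  proof -
    have "1 + (Im s)\<^sup>2 \<le> x\<^sup>2 * A" "1 + (Im s)\<^sup>2 \<le> y\<^sup>2 * A'"
      using *[OF \<delta>(2)] *[OF \<delta>(3)] by (simp_all add: x_def y_def A_def A'_def)
    moreover have "x\<^sup>2 * A \<le> x\<^sup>2 * M" "y\<^sup>2 * A' \<le> y\<^sup>2 * M"
      using A by (auto simp: M_def intro!: mult_left_mono)
    ultimately show "1 + (Im s)\<^sup>2 \<le> x\<^sup>2 * M" "1 + (Im s)\<^sup>2 \<le> y\<^sup>2 * M" by linarith+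
  qed
  then have "(1 + (Im s)\<^sup>2) * (1 + (Im s)\<^sup>2) \<le> (x\<^sup>2 * M) * (y\<^sup>2 * M)"
    using A by (intro mult_mono) (auto simp: M_def)
  then have "(1 + (Im s)\<^sup>2)\<^sup>2 \<le> (x * y * M)\<^sup>2" by (simp add: power2_eq_square mult_ac)
  then have le: "1 + (Im s)\<^sup>2 \<le> x * y * M"
    by (rule power2_le_imp_le) (use xy A in \<open>auto simp: M_def\<close>)
  have ne: "s \<noteq> p" "s \<noteq> p'" using \<delta> by auto
  have "norm (1 / (s - p') - 1 / (s - p)) = norm (p' - p) / (x * y)"
  proof -
    have "1 / (s - p') - 1 / (s - p) = (p' - p) / ((s - p) * (s - p'))"
      using ne by (simp add: divide_simps)
    then show ?thesis by (simp add: norm_divide norm_mult x_def y_def)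
  qed
  also have "\<dots> \<le> norm (p' - p) * M / (1 + (Im s)\<^sup>2)"
  proof -
    have "1 / (x * y) \<le> M / (1 + (Im s)\<^sup>2)"
      using le xy by (simp add: divide_simps add_pos_nonneg mult_ac sum_power2_gt_zero_iff)
    from mult_left_mono[OF this, of "norm (p' - p)"] show ?thesis by simp
  qed
  also have "norm (p' - p) * M = kernel_const \<delta> p p'"
    by (simp add: kernel_const_def M_def A_def A'_def add_divide_distrib)
  finally show ?thesis .
qed

locale vertical_curve =
  fixes \<gamma> :: "real \<Rightarrow> complex" and R B :: real
  assumes pC1: "\<And>T. T > 0 \<Longrightarrow> \<gamma> piecewise_C1_differentiable_on {-T..T}"
    and lip: "B-lipschitz_on UNIV \<gamma>"
    and near: "\<And>t. norm (\<gamma> t - \<i> * of_real t) \<le> R"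
begin

abbreviation "velocity \<equiv> (\<lambda>t. vector_derivative \<gamma> (at t))"

lemma R_nonneg: "R \<ge> 0" using near[of 0] norm_ge_zero order_trans by blast

lemma B_nonneg: "B \<ge> 0" using lip by (auto simp: lipschitz_on_def)

lemma continuous_\<gamma>: "continuous_on A \<gamma>"
  using lipschitz_on_continuous_on[OF lip] continuous_on_subset by blast

lemma measurable_\<gamma> [measurable]: "\<gamma> \<in> borel_measurable borel"
  by (intro borel_measurable_continuous_onI continuous_\<gamma>)

lemma Re_\<gamma>: "\<bar>Re (\<gamma> t)\<bar> \<le> R" and Im_\<gamma>: "\<bar>Im (\<gamma> t) - t\<bar> \<le> R"
  using abs_Re_le_cmod[of "\<gamma> t - \<i> * of_real t"] abs_Im_le_cmod[of "\<gamma> t - \<i> * of_real t"] near[of t] by auto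

lemma exceptions:
  assumes "T > 0"
  obtains S where "finite S" "\<And>t. t \<in> {-T..T} - S \<Longrightarrow> (\<gamma> has_vector_derivative velocity t) (at t)"
    "continuous_on ({-T..T} - S) velocity"
proof -
  obtain S where S: "finite S" "\<gamma> C1_differentiable_on ({-T..T} - S)"
    using pC1[OF assms] by (auto simp: piecewise_C1_differentiable_on_def)
  then show ?thesis using that unfolding C1_differentiable_on_eq
    by (metis vector_derivative_works)
qed

text \<open>The corners of the curve are countable, since there are finitely many on each compact interval. Off them the
  velocity is a pointwise limit of functions that are continuous on Borel sets, hence measurable.\<close>

lemma bad_points:
  obtains N where "countable N" "\<And>t. t \<notin> N \<Longrightarrow> (\<gamma> has_vector_derivative velocity t) (at t)"
    "velocity \<in> borel_measurable borel"
proof -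
  have "\<exists>S. finite S \<and> (\<forall>t\<in>{-real (Suc n)..real (Suc n)} - S. (\<gamma> has_vector_derivative velocity t) (at t))
    \<and> continuous_on ({-real (Suc n)..real (Suc n)} - S) velocity" for n
    using exceptions[of "real (Suc n)"] by (metis of_nat_0_less_iff zero_less_Suc)
  then obtain S where S: "\<And>n. finite (S n)"
    "\<And>n t. t \<in> {-real (Suc n)..real (Suc n)} - S n \<Longrightarrow> (\<gamma> has_vector_derivative velocity t) (at t)"
    "\<And>n. continuous_on ({-real (Suc n)..real (Suc n)} - S n) velocity" by metis
  define N where "N = (\<Union>n. S n)"
  have cN: "countable N" unfolding N_def using S(1) by (auto intro: countable_finite)
  have [measurable]: "N \<in> sets borel" using cN by (rule sets.countable[rotated]) auto
  have der: "(\<gamma> has_vector_derivative velocity t) (at t)" if "t \<notin> N" for t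
  proof -
    obtain n where "\<bar>t\<bar> \<le> real n" using real_arch_simple by blast
    then show ?thesis using that S(2)[of t n] unfolding N_def by (simp add: abs_le_iff)
  qed
  have "(\<lambda>t. indicator (- N) t *\<^sub>R velocity t) \<in> borel_measurable borel"
  proof (rule borel_measurable_LIMSEQ_metric)
    show "(\<lambda>t. indicator ({-real (Suc n)..real (Suc n)} - N) t *\<^sub>R velocity t) \<in> borel_measurable borel" for n
      by (intro borel_measurable_continuous_on_indicator continuous_on_subset[OF S(3)] sets.Diff) (auto simp: N_def[symmetric], auto simp: N_def)
    fix t
    obtain n0 where "\<bar>t\<bar> \<le> real n0" using real_arch_simple by blast
    then have "\<forall>\<^sub>F n in sequentially. indicator ({-real (Suc n)..real (Suc n)} - N) t *\<^sub>R velocity t = indicator (- N) t *\<^sub>R velocity t"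
      unfolding eventually_sequentially by (intro exI[of _ n0]) (auto simp: indicator_def)
    then show "(\<lambda>n. indicator ({-real (Suc n)..real (Suc n)} - N) t *\<^sub>R velocity t) \<longlonglongrightarrow> indicator (- N) t *\<^sub>R velocity t"
      by (rule tendsto_eventually)
  qed
  then have "velocity \<in> borel_measurable borel"
    by (rule measurable_discrete_difference[where X=N]) (auto simp: cN)
  with cN der show ?thesis using that by blast
qed

lemma measurable_velocity [measurable]: "velocity \<in> borel_measurable borel"
  using bad_points by blast

lemma norm_velocity_le:
  assumes "(\<gamma> has_vector_derivative D) (at t)"
  shows "norm D \<le> B"
proof -
  have lim: "((\<lambda>h. norm (\<gamma> (t + h) - \<gamma> t - h *\<^sub>R D) / norm h) \<longlongrightarrow> 0) (at 0)"
    using assms by (simp add: has_vector_derivative_def has_derivative_at)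
  have "norm D - B \<le> 0"
  proof (rule tendsto_le[OF _ lim tendsto_const])
    show "\<forall>\<^sub>F h in at 0. norm D - B \<le> norm (\<gamma> (t + h) - \<gamma> t - h *\<^sub>R D) / norm h"
    proof (rule eventually_at_filter[THEN iffD2], intro always_eventually allI impI)
      fix h :: real assume h: "h \<noteq> 0"
      have "norm (h *\<^sub>R D) \<le> norm (\<gamma> (t + h) - \<gamma> t) + norm (\<gamma> (t + h) - \<gamma> t - h *\<^sub>R D)"
        using norm_triangle_ineq4[of "\<gamma> (t + h) - \<gamma> t" "\<gamma> (t + h) - \<gamma> t - h *\<^sub>R D"] by simp
      moreover have "norm (\<gamma> (t + h) - \<gamma> t) \<le> B * \<bar>h\<bar>"
        using lipschitz_onD[OF lip, of "t + h" t] by (simp add: dist_norm)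
      ultimately show "norm D - B \<le> norm (\<gamma> (t + h) - \<gamma> t - h *\<^sub>R D) / norm h"
        using h by (simp add: divide_simps algebra_simps)
    qed
  qed simp
  then show ?thesis by simp
qed

lemma AE_velocity: "AE t in lborel. (\<gamma> has_vector_derivative velocity t) (at t) \<and> norm (velocity t) \<le> B"
proof -
  obtain N where N: "countable N" "\<And>t. t \<notin> N \<Longrightarrow> (\<gamma> has_vector_derivative velocity t) (at t)"
    by (rule bad_points) (rule that)
  have "N \<in> null_sets lborel" using N(1) by (rule countable_imp_null_set_lborel)
  then have "AE t in lborel. t \<notin> N" by (rule AE_not_in)
  then show ?thesis by eventually_elim (simp add: N(2) norm_velocity_le[OF N(2)])
qed

text \<open>The factor that converts quadratic decay in \<open>Im (\<gamma> t)\<close> into quadratic decay in the parameter \<open>t\<close>.\<close>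

definition K :: real where "K = 2 * (1 + R\<^sup>2)"

lemma K_pos: "K > 0" by (simp add: K_def add_pos_nonneg)

lemma decay_\<gamma>: "C \<ge> 0 \<Longrightarrow> C / (1 + (Im (\<gamma> t))\<^sup>2) \<le> C * K / (1 + t\<^sup>2)"
proof -
  assume C: "C \<ge> 0"
  have "t\<^sup>2 \<le> (\<bar>Im (\<gamma> t)\<bar> + R)\<^sup>2"
    using Im_\<gamma>[of t] R_nonneg by (intro abs_le_square_iff[THEN iffD1]) auto
  also have "\<dots> \<le> 2 * (Im (\<gamma> t))\<^sup>2 + 2 * R\<^sup>2"
    using sum_squares_ge_zero[of "\<bar>Im (\<gamma> t)\<bar> - R" 0] by (simp add: power2_eq_square algebra_simps abs_mult_self_eq)
  finally have "t\<^sup>2 \<le> 2 * (Im (\<gamma> t))\<^sup>2 + 2 * R\<^sup>2" .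
  moreover have "K * (1 + (Im (\<gamma> t))\<^sup>2) = 2 + 2 * R\<^sup>2 + 2 * (Im (\<gamma> t))\<^sup>2 + 2 * (R\<^sup>2 * (Im (\<gamma> t))\<^sup>2)"
    by (simp add: K_def algebra_simps)
  moreover have "0 \<le> R\<^sup>2 * (Im (\<gamma> t))\<^sup>2" by simp
  ultimately have "1 + t\<^sup>2 \<le> K * (1 + (Im (\<gamma> t))\<^sup>2)" by linarith
  then have "C * (1 + t\<^sup>2) \<le> C * (K * (1 + (Im (\<gamma> t))\<^sup>2))" using C by (rule mult_left_mono)
  then show ?thesis by (simp add: divide_simps add_pos_nonneg mult_ac sum_power2_gt_zero_iff)
qed

lemma integrable_decay:
  assumes [measurable]: "(\<lambda>t. f (\<gamma> t)) \<in> borel_measurable borel"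
    and f: "\<And>t. norm (f (\<gamma> t)) \<le> C / (1 + t\<^sup>2)"
  shows "integrable lborel (\<lambda>t. f (\<gamma> t) * velocity t)"
    and "AE t in lborel. norm (f (\<gamma> t) * velocity t) \<le> C * B / (1 + t\<^sup>2)"
proof -
  show ae: "AE t in lborel. norm (f (\<gamma> t) * velocity t) \<le> C * B / (1 + t\<^sup>2)"
    using AE_velocity
  proof eventually_elim
    case (elim t)
    then have "norm (f (\<gamma> t)) * norm (velocity t) \<le> C / (1 + t\<^sup>2) * B"
      using f[of t] by (intro mult_mono) (auto intro: order_trans[OF norm_ge_zero])
    then show ?case by (simp add: norm_mult)
  qed
  show "integrable lborel (\<lambda>t. f (\<gamma> t) * velocity t)"
  proof (rule Bochner_Integration.integrable_bound[OF integrable_inverse_1_plus_sq[of "C * B"]])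
    show "AE t in lborel. norm (f (\<gamma> t) * velocity t) \<le> norm (C * B / (1 + t\<^sup>2))"
      using ae by eventually_elim (erule order_trans, simp only: real_norm_def abs_ge_self)
  qed measurable
qed

lemma filterlim_segments:
  fixes g :: "real \<Rightarrow> complex"
  assumes "integrable lborel g" "filterlim b at_top sequentially" "filterlim a at_bot sequentially"
  shows "(\<lambda>n. \<integral>t. indicator {a n..b n} t *\<^sub>R g t \<partial>lborel) \<longlonglongrightarrow> (\<integral>t. g t \<partial>lborel :: complex)"
proof (rule integral_dominated_convergence[where w="\<lambda>t. norm (g t)"])
  show "AE t in lborel. (\<lambda>n. indicator {a n..b n} t *\<^sub>R g t) \<longlonglongrightarrow> g t"
  proof (intro always_eventually allI)
    fix t
    have "\<forall>\<^sub>F n in sequentially. b n \<ge> t" "\<forall>\<^sub>F n in sequentially. a n \<le> t"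
      using assms(2,3) by (simp_all add: filterlim_at_top filterlim_at_bot)
    then have "\<forall>\<^sub>F n in sequentially. indicator {a n..b n} t *\<^sub>R g t = g t"
      by eventually_elim (auto simp: indicator_def)
    then show "(\<lambda>n. indicator {a n..b n} t *\<^sub>R g t) \<longlonglongrightarrow> g t" by (rule tendsto_eventually)
  qed
qed (use assms in \<open>auto simp: indicator_def intro!: borel_measurable_scaleR\<close>)

lemma segment_integral:
  fixes g :: "real \<Rightarrow> complex"
  assumes "integrable lborel g"
  shows "(g has_integral (\<integral>t. indicator {a..b} t *\<^sub>R g t \<partial>lborel :: complex)) {a..b}"
proof -
  have "set_integrable lborel {a..b} g"
    unfolding set_integrable_def by (intro integrable_mult_indicator assms) simp
  from set_borel_integral_eq_integral[OF this] show ?thesis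
    by (simp add: set_lebesgue_integral_def has_integral_iff)
qed

lemma has_integral_primitive:
  assumes "\<And>t. (\<Phi> has_field_derivative f (\<gamma> t)) (at (\<gamma> t))" "a \<le> b"
  shows "((\<lambda>t. f (\<gamma> t) * velocity t) has_integral (\<Phi> (\<gamma> b) - \<Phi> (\<gamma> a))) {a..b}"
proof -
  define T where "T = max \<bar>a\<bar> \<bar>b\<bar> + 1"
  have T: "T > 0" by (simp add: T_def add_nonneg_pos)
  obtain S where S: "finite S" "\<And>t. t \<in> {-T..T} - S \<Longrightarrow> (\<gamma> has_vector_derivative velocity t) (at t)"
    using exceptions[OF T] by metis
  show ?thesis
  proof (rule fundamental_theorem_of_calculus_interior_strong[OF S(1) assms(2), where f="\<lambda>t. \<Phi> (\<gamma> t)"])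
    fix t assume t: "t \<in> {a<..<b} - S"
    then have "t \<in> {-T..T} - S" using assms(2) by (auto simp: T_def)
    from field_vector_diff_chain_at[OF S(2)[OF this] assms(1)]
    show "((\<lambda>t. \<Phi> (\<gamma> t)) has_vector_derivative f (\<gamma> t) * velocity t) (at t)"
      by (simp add: o_def mult.commute)
  next
    have "isCont (\<lambda>t. \<Phi> (\<gamma> t)) t" for t
      using continuous_\<gamma>[of UNIV] DERIV_isCont[OF assms(1)]
      by (intro isCont_o2[of t \<gamma> \<Phi>]) (auto simp: continuous_on_eq_continuous_at)
    then show "continuous_on {a..b} (\<lambda>t. \<Phi> (\<gamma> t))" by (simp add: continuous_at_imp_continuous_on)
  qed
qed

lemma curve_integral_primitive:
  assumes "\<And>t. (\<Phi> has_field_derivative f (\<gamma> t)) (at (\<gamma> t))"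
    and "integrable lborel (\<lambda>t. f (\<gamma> t) * velocity t)"
    and "((\<lambda>t. \<Phi> (\<gamma> t)) \<longlongrightarrow> l1) at_top" "((\<lambda>t. \<Phi> (\<gamma> t)) \<longlongrightarrow> l2) at_bot"
  shows "curve_integral \<gamma> f = l1 - l2"
proof (rule LIMSEQ_unique)
  have 1: "filterlim (\<lambda>n. real n) at_top sequentially" by (rule filterlim_real_sequentially)
  have 2: "filterlim (\<lambda>n. - real n) at_bot sequentially"
    using 1 by (simp add: filterlim_uminus_at_bot)
  show "(\<lambda>n. \<integral>t. indicator {-real n..real n} t *\<^sub>R (f (\<gamma> t) * velocity t) \<partial>lborel) \<longlonglongrightarrow> curve_integral \<gamma> f"
    unfolding curve_integral_def by (rule filterlim_segments[OF assms(2) 1 2])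
  have "(\<integral>t. indicator {-real n..real n} t *\<^sub>R (f (\<gamma> t) * velocity t) \<partial>lborel) = \<Phi> (\<gamma> (real n)) - \<Phi> (\<gamma> (- real n))" for n
    using has_integral_unique[OF segment_integral[OF assms(2)] has_integral_primitive[OF assms(1)]] by simp
  then show "(\<lambda>n. \<integral>t. indicator {-real n..real n} t *\<^sub>R (f (\<gamma> t) * velocity t) \<partial>lborel) \<longlonglongrightarrow> l1 - l2"
    using tendsto_diff[OF filterlim_compose[OF assms(3) 1] filterlim_compose[OF assms(4) 2]] by simp
qed

section \<open>Regularised winding numbers\<close>

lemma closed_range: "closed (range \<gamma>)"
  unfolding closed_sequential_limits
proof (intro allI impI, elim conjE)
  fix x l assume x: "\<forall>n. x n \<in> range \<gamma>" "x \<longlonglongrightarrow> l"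
  then obtain t where t: "\<And>n. x n = \<gamma> (t n)" by (auto simp: image_iff) metis
  have "bounded (range x)" using x(2) convergent_imp_bounded by blast
  then obtain M where M: "\<And>n. norm (x n) \<le> M" by (auto simp: bounded_iff)
  have "t n \<in> {-(M+R)..M+R}" for n
    using Im_\<gamma>[of "t n"] M[of n] abs_Im_le_cmod[of "x n"] unfolding t by auto
  then obtain l' r where r: "strict_mono r" "(t \<circ> r) \<longlonglongrightarrow> l'"
    using compact_Icc[of "-(M+R)" "M+R"] unfolding compact_def by metis
  have "isCont \<gamma> l'" using continuous_\<gamma>[of UNIV] by (simp add: continuous_on_eq_continuous_at)
  then have "(\<lambda>n. \<gamma> ((t \<circ> r) n)) \<longlonglongrightarrow> \<gamma> l'" using r(2) by (rule isCont_tendsto_compose)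
  moreover have "(\<lambda>n. \<gamma> ((t \<circ> r) n)) = x \<circ> r" by (auto simp: t o_def)
  moreover have "(x \<circ> r) \<longlonglongrightarrow> l" using LIMSEQ_subseq_LIMSEQ[OF x(2) r(1)] .
  ultimately have "l = \<gamma> l'" using LIMSEQ_unique[of "x \<circ> r" l "\<gamma> l'"] by simp
  then show "l \<in> range \<gamma>" by blast
qed

lemma gap:
  assumes "p \<notin> range \<gamma>"
  obtains \<delta> where "\<delta> > 0" "\<And>t. \<delta> \<le> norm (\<gamma> t - p)"
proof -
  obtain \<delta> where \<delta>: "\<delta> > 0" "ball p \<delta> \<subseteq> - range \<gamma>"
    using assms closed_range by (metis Compl_iff open_Compl open_contains_ball)
  have "\<delta> \<le> norm (\<gamma> t - p)" for t
  proof (rule ccontr)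
    assume "\<not> \<delta> \<le> norm (\<gamma> t - p)"
    then have "\<gamma> t \<in> ball p \<delta>" by (simp add: dist_norm norm_minus_commute)
    then show False using \<delta>(2) by auto
  qed
  with \<delta>(1) show ?thesis using that by blast
qed

lemma kernel_decay_\<gamma>:
  assumes "p \<notin> range \<gamma>" "p' \<notin> range \<gamma>"
  obtains C where "\<And>t. norm (1 / (\<gamma> t - p') - 1 / (\<gamma> t - p)) \<le> C / (1 + t\<^sup>2)"
proof -
  obtain d where d: "d > 0" "\<And>t. d \<le> norm (\<gamma> t - p)" using gap[OF assms(1)] by metis
  obtain d' where d': "d' > 0" "\<And>t. d' \<le> norm (\<gamma> t - p')" using gap[OF assms(2)] by metis
  define \<delta> where "\<delta> = min d d'"
  have \<delta>: "\<delta> > 0" "\<delta> \<le> norm (\<gamma> t - p)" "\<delta> \<le> norm (\<gamma> t - p')" for t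
    using d d' by (auto simp: \<delta>_def min_le_iff_disj)
  have "norm (1 / (\<gamma> t - p') - 1 / (\<gamma> t - p)) \<le> kernel_const \<delta> p p' * K / (1 + t\<^sup>2)" for t
    using order_trans[OF kernel_decay[OF \<delta>] decay_\<gamma>[OF kernel_const_nonneg[OF \<delta>(1)]]] .
  then show ?thesis using that by blast
qed

lemma integrable_kernel:
  assumes "p \<notin> range \<gamma>" "p' \<notin> range \<gamma>"
  shows "integrable lborel (\<lambda>t. (1 / (\<gamma> t - p') - 1 / (\<gamma> t - p)) * velocity t)"
proof -
  obtain C where "\<And>t. norm (1 / (\<gamma> t - p') - 1 / (\<gamma> t - p)) \<le> C / (1 + t\<^sup>2)"
    using kernel_decay_\<gamma>[OF assms] by metis
  then show ?thesis by (intro integrable_decay(1)[where f="\<lambda>s. 1 / (s - p') - 1 / (s - p)"]) measurable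
qed

lemma tendsto_kernel_quotient:
  "((\<lambda>t. (\<gamma> t - p') / (\<gamma> t - p)) \<longlongrightarrow> 1) at_top" "((\<lambda>t. (\<gamma> t - p') / (\<gamma> t - p)) \<longlongrightarrow> 1) at_bot"
proof -
  have *: "((\<lambda>t. (\<gamma> t - p') / (\<gamma> t - p)) \<longlongrightarrow> 1) F" if F: "filterlim (\<lambda>t::real. \<bar>t\<bar>) at_top F" for F
  proof -
    have "filterlim (\<lambda>t. \<bar>t\<bar> - (R + norm p)) at_top F"
      using filterlim_tendsto_add_at_top[OF tendsto_const[of "- (R + norm p)"] F]
      by (simp add: algebra_simps)
    then have "filterlim (\<lambda>t. norm (\<gamma> t - p)) at_top F"
    proof (rule filterlim_at_top_mono, intro always_eventually allI)
      fix t
      have "\<bar>t\<bar> \<le> \<bar>Im (\<gamma> t)\<bar> + R" using Im_\<gamma>[of t] by linarith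
      also have "\<bar>Im (\<gamma> t)\<bar> \<le> norm (\<gamma> t - p) + norm p"
        using abs_Im_le_cmod[of "\<gamma> t"] norm_triangle_sub[of "\<gamma> t" p] by linarith
      finally show "\<bar>t\<bar> - (R + norm p) \<le> norm (\<gamma> t - p)" by simp
    qed
    then have inf: "filterlim (\<lambda>t. \<gamma> t - p) at_infinity F" by (rule filterlim_norm_at_top_imp_at_infinity)
    have "((\<lambda>t. 1 + (p - p') / (\<gamma> t - p)) \<longlongrightarrow> 1 + 0) F"
      by (intro tendsto_intros tendsto_divide_0[OF tendsto_const inf])
    moreover have "\<forall>\<^sub>F t in F. 1 + (p - p') / (\<gamma> t - p) = (\<gamma> t - p') / (\<gamma> t - p)"
      using filterlim_at_infinity_imp_eventually_ne[OF inf, of 0]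
      by eventually_elim (simp add: field_simps)
    ultimately show ?thesis using tendsto_cong by force
  qed
  show "((\<lambda>t. (\<gamma> t - p') / (\<gamma> t - p)) \<longlongrightarrow> 1) at_top" by (rule *[OF filterlim_abs_real])
  have "filterlim (\<lambda>t::real. \<bar>t\<bar>) at_top at_bot"
    unfolding filterlim_at_bot_mirror using filterlim_abs_real by simp
  then show "((\<lambda>t. (\<gamma> t - p') / (\<gamma> t - p)) \<longlongrightarrow> 1) at_bot" by (rule *)
qed

text \<open>The regularised winding number of the contour is locally constant off the contour: the difference of its
  values at two nearby points is the increment of a single-valued logarithm that vanishes at both ends.\<close>

lemma curve_integral_kernel_near:
  assumes "\<And>t. \<delta> \<le> norm (\<gamma> t - p)" "norm (p' - p) < \<delta>"
  shows "curve_integral \<gamma> (\<lambda>s. 1 / (s - p') - 1 / (s - p)) = 0"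
proof -
  have ne: "\<gamma> t \<noteq> p" "\<gamma> t \<noteq> p'" for t
    using assms(1)[of t] assms(2) norm_minus_commute[of p p'] le_less_trans[OF norm_ge_zero assms(2)] by auto
  have pos: "0 < Re ((\<gamma> t - p') / (\<gamma> t - p))" for t
  proof -
    have "norm ((p' - p) / (\<gamma> t - p)) < 1"
      using assms(1)[of t] assms(2) ne[of t] by (simp add: norm_divide divide_simps)
    moreover have "(\<gamma> t - p') / (\<gamma> t - p) = 1 - (p' - p) / (\<gamma> t - p)"
      using ne[of t] by (simp add: field_simps)
    ultimately show ?thesis using complex_Re_le_cmod[of "(p' - p) / (\<gamma> t - p)"] by simp
  qed
  have "curve_integral \<gamma> (\<lambda>s. 1 / (s - p') - 1 / (s - p)) = Ln 1 - Ln 1"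
  proof (rule curve_integral_primitive)
    show "((\<lambda>s. Ln ((s - p') / (s - p))) has_field_derivative 1 / (\<gamma> t - p') - 1 / (\<gamma> t - p)) (at (\<gamma> t))" for t
      using ne[of t] pos[of t]
      by (auto intro!: derivative_eq_intros simp: complex_nonpos_Reals_iff divide_simps power2_eq_square)
    show "integrable lborel (\<lambda>t. (1 / (\<gamma> t - p') - 1 / (\<gamma> t - p)) * velocity t)"
      by (rule integrable_kernel) (use ne in auto)
  qed (intro tendsto_Ln tendsto_kernel_quotient; simp add: complex_nonpos_Reals_iff)+
  then show ?thesis by simp
qed

lemma curve_integral_kernel_diff:
  assumes "p \<notin> range \<gamma>" "p' \<notin> range \<gamma>" "p0 \<notin> range \<gamma>"
  shows "curve_integral \<gamma> (\<lambda>s. 1 / (s - p') - 1 / (s - p)) =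
    curve_integral \<gamma> (\<lambda>s. 1 / (s - p') - 1 / (s - p0)) - curve_integral \<gamma> (\<lambda>s. 1 / (s - p) - 1 / (s - p0))"
  unfolding curve_integral_def
  by (subst Bochner_Integration.integral_diff[symmetric, OF integrable_kernel integrable_kernel])
    (use assms in \<open>auto intro!: Bochner_Integration.integral_cong simp: algebra_simps\<close>)

lemma curve_integral_kernel_connected:
  assumes "connected S" "S \<inter> range \<gamma> = {}" "p \<in> S" "p' \<in> S"
  shows "curve_integral \<gamma> (\<lambda>s. 1 / (s - p') - 1 / (s - p)) = 0"
proof -
  define J where "J p' = curve_integral \<gamma> (\<lambda>s. 1 / (s - p') - 1 / (s - p))" for p'
  have "J p' = J p"
  proof (rule connected_local_const[OF assms(1,4,3)], rule ballI)
    fix a assume "a \<in> S"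
    then have a: "a \<notin> range \<gamma>" using assms by auto
    obtain \<delta> where \<delta>: "\<delta> > 0" "\<And>t. \<delta> \<le> norm (\<gamma> t - a)" using gap[OF a] by metis
    show "\<forall>\<^sub>F b in at a within S. J a = J b"
      unfolding eventually_at
    proof (intro exI[of _ \<delta>] conjI ballI impI)
      fix b assume b: "b \<in> S" "b \<noteq> a \<and> dist b a < \<delta>"
      then have "b \<notin> range \<gamma>" "p \<notin> range \<gamma>" using assms by auto
      from curve_integral_kernel_diff[OF a this] curve_integral_kernel_near[OF \<delta>(2), of b] b(2)
      show "J a = J b" by (simp add: J_def dist_norm)
    qed fact
  qed
  then show ?thesis by (simp add: J_def curve_integral_def)
qed

text \<open>The arguments grow like \<open>- \<i> t\<close> and \<open>\<i> t\<close>. Divided by these numbers they tend to \<open>1\<close>; the two quarter turns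
  add up to \<open>- \<i> \<pi>\<close>.\<close>

lemma Ln_half_plane_limit:
  fixes g :: "real \<Rightarrow> complex"
  assumes g: "\<And>t. norm (g t - \<i> * of_real t) \<le> R" and r: "r > R"
  shows "((\<lambda>t. Ln (of_real r - g t) - Ln (g t + of_real r)) \<longlongrightarrow> - (\<i> * pi)) at_top"
proof -
  define u where "u t = \<i> * (of_real r - g t) / of_real t" for t
  define v where "v t = - \<i> * (of_real r + g t) / of_real t" for t
  have Reg: "\<bar>Re (g t)\<bar> \<le> R" for t using abs_Re_le_cmod[of "g t - \<i> * of_real t"] g[of t] by auto
  have inv: "((\<lambda>t. (r + R) / t) \<longlongrightarrow> 0) at_top" by real_asymp
  have u: "(u \<longlongrightarrow> 1) at_top"
  proof (rule Lim_transform2)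
    show "((\<lambda>t. 1 - u t) \<longlongrightarrow> 0) at_top"
    proof (rule Lim_null_comparison[OF _ inv], rule eventually_mono[OF eventually_gt_at_top[of 0]])
      fix t :: real assume t: "t > 0"
      have "1 - u t = \<i> * ((g t - \<i> * of_real t) - of_real r) / of_real t"
        using t by (simp add: u_def field_simps)
      then have "norm (1 - u t) = norm ((g t - \<i> * of_real t) - of_real r) / t"
        using t by (simp add: norm_divide norm_mult)
      also have "\<dots> \<le> (R + \<bar>r\<bar>) / t"
        using t norm_triangle_ineq4[of "g t - \<i> * of_real t" "of_real r"] g[of t]
        by (intro divide_right_mono) auto
      finally show "norm (1 - u t) \<le> (r + R) / t" using r R_nonneg by (simp add: add.commute)
    qed
  qed simp
  have v: "(v \<longlongrightarrow> 1) at_top"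
  proof (rule Lim_transform2)
    show "((\<lambda>t. 1 - v t) \<longlongrightarrow> 0) at_top"
    proof (rule Lim_null_comparison[OF _ inv], rule eventually_mono[OF eventually_gt_at_top[of 0]])
      fix t :: real assume t: "t > 0"
      have "1 - v t = \<i> * ((g t - \<i> * of_real t) + of_real r) / of_real t"
        using t by (simp add: v_def field_simps)
      then have "norm (1 - v t) = norm ((g t - \<i> * of_real t) + of_real r) / t"
        using t by (simp add: norm_divide norm_mult)
      also have "\<dots> \<le> (R + \<bar>r\<bar>) / t"
        using t norm_triangle_ineq[of "g t - \<i> * of_real t" "of_real r"] g[of t]
        by (intro divide_right_mono) auto
      finally show "norm (1 - v t) \<le> (r + R) / t" using r R_nonneg by (simp add: add.commute)
    qed
  qed simp
  have "((\<lambda>t. Ln (u t) - Ln (v t) - \<i> * pi) \<longlongrightarrow> Ln 1 - Ln 1 - \<i> * pi) at_top"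
    by (intro tendsto_intros tendsto_Ln u v) auto
  moreover have "\<forall>\<^sub>F t in at_top. Ln (u t) - Ln (v t) - \<i> * pi = Ln (of_real r - g t) - Ln (g t + of_real r)"
  proof -
    have "((\<lambda>t. Re (u t)) \<longlongrightarrow> Re 1) at_top" "((\<lambda>t. Re (v t)) \<longlongrightarrow> Re 1) at_top"
      by (intro tendsto_Re u v)+
    then have "\<forall>\<^sub>F t in at_top. Re (u t) > 0" "\<forall>\<^sub>F t in at_top. Re (v t) > 0"
      by (auto dest: order_tendstoD(1)[of _ _ _ 0])
    then show ?thesis using eventually_gt_at_top[of 0]
    proof eventually_elim
      case (elim t)
      have 1: "\<i> * (of_real r - g t) = of_real t * u t" "of_real r + g t = \<i> * (of_real t * v t)"
        using elim by (simp_all add: u_def v_def)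
      have pos: "Re (of_real r - g t) > 0" "Re (of_real t * v t) > 0"
        using Reg[of t] r elim by auto
      have nz: "of_real r - g t \<noteq> 0" "of_real t * v t \<noteq> 0" "u t \<noteq> 0" "v t \<noteq> 0"
        using pos elim by (metis less_irrefl zero_complex.sel(1))+
      have "Ln (\<i> * (of_real r - g t)) = Ln (of_real r - g t) + \<i> * pi / 2"
        using Ln_times_ii[OF nz(1)] pos by simp
      moreover have "Ln (\<i> * (of_real t * v t)) = Ln (of_real t * v t) + \<i> * pi / 2"
        using Ln_times_ii[OF nz(2)] pos by simp
      ultimately have e: "Ln (of_real r - g t) = Ln (of_real t) + Ln (u t) - \<i> * pi / 2"
        "Ln (of_real r + g t) = Ln (of_real t) + Ln (v t) + \<i> * pi / 2"
        using elim nz(3,4) unfolding 1 by (simp_all add: Ln_times_of_real algebra_simps)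
      have "A - B - P = C + A - P / 2 - (C + B + P / 2)" for A B C P :: complex
        by (simp add: field_simps)
      then show ?case unfolding add.commute[of "g t"] e .
    qed
  qed
  ultimately show ?thesis using tendsto_cong by force
qed

text \<open>On the strip \<open>\<bar>Re s\<bar> < r\<close>, which contains the contour, \<open>Ln (r - s) - Ln (s + r)\<close> is a holomorphic
  primitive, so the integral is the difference of its limits at the two ends.\<close>

lemma curve_integral_kernel_across:
  assumes r: "r > R"
  shows "curve_integral \<gamma> (\<lambda>s. 1 / (s - of_real r) - 1 / (s + of_real r)) = - (2 * pi * \<i>)"
proof -
  have pos: "Re (of_real r - \<gamma> t) > 0" "Re (\<gamma> t + of_real r) > 0" for t using Re_\<gamma>[of t] r by auto
  have ne: "\<gamma> t \<noteq> of_real r" "\<gamma> t \<noteq> - of_real r" "of_real r + \<gamma> t \<noteq> 0" for t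
    using pos[of t] by (auto simp: complex_eq_iff)
  have "curve_integral \<gamma> (\<lambda>s. 1 / (s - of_real r) - 1 / (s + of_real r)) = - (\<i> * pi) - \<i> * pi"
  proof (rule curve_integral_primitive)
    show "((\<lambda>s. Ln (of_real r - s) - Ln (s + of_real r)) has_field_derivative
       1 / (\<gamma> t - of_real r) - 1 / (\<gamma> t + of_real r)) (at (\<gamma> t))" for t
      using pos[of t] ne[of t]
      by (auto intro!: derivative_eq_intros simp: complex_nonpos_Reals_iff divide_simps) (auto simp: algebra_simps)
    show "integrable lborel (\<lambda>t. (1 / (\<gamma> t - of_real r) - 1 / (\<gamma> t + of_real r)) * velocity t)"
      using integrable_kernel[of "- of_real r" "of_real r"] ne by (auto simp: image_iff dest: sym)
    show "((\<lambda>t. Ln (of_real r - \<gamma> t) - Ln (\<gamma> t + of_real r)) \<longlongrightarrow> - (\<i> * pi)) at_top"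
      by (rule Ln_half_plane_limit[OF near r])
    have "norm (- \<gamma> (- t) - \<i> * of_real t) \<le> R" for t
      using near[of "-t"] by (subst norm_minus_cancel[symmetric]) (simp add: add.commute)
    from tendsto_minus[OF Ln_half_plane_limit[OF this r]]
    show "((\<lambda>t. Ln (of_real r - \<gamma> t) - Ln (\<gamma> t + of_real r)) \<longlongrightarrow> \<i> * pi) at_bot"
      unfolding filterlim_at_bot_mirror by (simp add: add.commute)
  qed
  then show ?thesis by simp
qed

end

section \<open>The residue theorem between a contour and a vertical line\<close>

lemma integral_count_space_support:
  fixes g :: "'a \<Rightarrow> 'b::{banach, second_countable_topology}"
  assumes "finite B" "B \<subseteq> A" "\<And>x. x \<in> A - B \<Longrightarrow> g x = 0"
  shows "(\<integral>x. g x \<partial>count_space A) = sum g B"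
proof -
  have sub: "{a \<in> A. g a \<noteq> 0} \<subseteq> B" using assms(3) by auto
  then have "(\<integral>x. g x \<partial>count_space A) = (\<Sum>a | a \<in> A \<and> g a \<noteq> 0. g a)"
    by (intro lebesgue_integral_count_space_finite_support finite_subset[OF _ assms(1)])
  also have "\<dots> = sum g B" using assms sub by (intro sum.mono_neutral_left) auto
  finally show ?thesis .
qed

context vertical_curve
begin

definition gpath :: "real \<Rightarrow> real \<Rightarrow> real \<Rightarrow> complex" where
  "gpath t1 t2 = (\<lambda>x. \<gamma> ((t2 - t1) * x + t1))"

lemma gpath_ends: "pathstart (gpath t1 t2) = \<gamma> t1" "pathfinish (gpath t1 t2) = \<gamma> t2"
  by (simp_all add: gpath_def pathstart_def pathfinish_def)

lemma gpath_image: "t1 < t2 \<Longrightarrow> path_image (gpath t1 t2) = \<gamma> ` {t1..t2}"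
proof -
  assume t: "t1 < t2"
  have "(\<lambda>x. (t2 - t1) * x + t1) ` {0..1} = {t1..t2}"
    using t image_affinity_atLeastAtMost[of "t2 - t1" t1 0 1] by simp
  moreover have "path_image (gpath t1 t2) = \<gamma> ` ((\<lambda>x. (t2 - t1) * x + t1) ` {0..1})"
    by (auto simp: path_image_def gpath_def image_image)
  ultimately show ?thesis by simp
qed

lemma valid_gpath: assumes t: "t1 < t2" shows "valid_path (gpath t1 t2)"
proof -
  define T where "T = max \<bar>t1\<bar> \<bar>t2\<bar> + 1"
  have T: "T > 0" by (simp add: T_def add_nonneg_pos)
  let ?h = "\<lambda>x. (t2 - t1) * x + t1"
  have sub: "?h ` {0..1} \<subseteq> {-T..T}"
    using image_affinity_atLeastAtMost[of "t2 - t1" t1 0 1] t by (auto simp: T_def)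
  have "?h piecewise_C1_differentiable_on {0..1}"
    by (intro C1_differentiable_imp_piecewise) (auto simp: C1_differentiable_on_def intro!: exI[of _ "\<lambda>_. t2 - t1"] derivative_eq_intros continuous_intros)
  moreover have "\<gamma> piecewise_C1_differentiable_on (?h ` {0..1})"
    using pC1[OF T] sub by (rule piecewise_C1_differentiable_on_subset)
  moreover have "finite ({0..1} \<inter> ?h -` {x})" for x
    by (rule finite_subset[of _ "{(x - t1) / (t2 - t1)}"]) (use t in \<open>auto simp: field_simps\<close>)
  ultimately have "(\<gamma> \<circ> ?h) piecewise_C1_differentiable_on {0..1}"
    by (rule piecewise_C1_differentiable_compose)
  then show ?thesis by (simp add: valid_path_def gpath_def o_def)
qed

lemma has_contour_integral_gpath:
  assumes t: "t1 < t2" and i: "((\<lambda>t. f (\<gamma> t) * velocity t) has_integral i) {t1..t2}"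
  shows "(f has_contour_integral i) (gpath t1 t2)"
proof -
  define T where "T = max \<bar>t1\<bar> \<bar>t2\<bar> + 1"
  have T: "T > 0" by (simp add: T_def add_nonneg_pos)
  obtain S where S: "finite S" "\<And>t. t \<in> {-T..T} - S \<Longrightarrow> (\<gamma> has_vector_derivative velocity t) (at t)"
    using exceptions[OF T] by metis
  define m where "m = t2 - t1"
  have m: "m > 0" using t by (simp add: m_def)
  have "((\<lambda>x. f (\<gamma> (m *\<^sub>R x + t1)) * velocity (m *\<^sub>R x + t1)) has_integral (i /\<^sub>R m ^ DIM(real))) (cbox ((t1 - t1) /\<^sub>R m) ((t2 - t1) /\<^sub>R m))"
    using i m by (intro has_integral_affinity'[where f="\<lambda>t. f (\<gamma> t) * velocity t"]) auto
  then have "((\<lambda>x. f (\<gamma> (m * x + t1)) * velocity (m * x + t1)) has_integral (i /\<^sub>R m)) {0..1}"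
    using m by (simp add: m_def[symmetric])
  from has_integral_cmul[OF this, of m]
  have *: "((\<lambda>x. m *\<^sub>R (f (\<gamma> (m * x + t1)) * velocity (m * x + t1))) has_integral i) {0..1}"
    using m by simp
  have fin: "finite ((\<lambda>s. (s - t1) / m) ` S)" using S(1) by simp
  show ?thesis unfolding has_contour_integral
  proof (rule has_integral_spike_finite[OF fin _ *])
    fix x assume x: "x \<in> {0..1} - (\<lambda>s. (s - t1) / m) ` S"
    define y where "y = m * x + t1"
    have "m * x \<le> m" using x m by (intro mult_left_le) auto
    then have "y \<le> t2" unfolding y_def using m_def by linarith
    moreover have "t1 \<le> y" using x m by (simp add: y_def)
    moreover have "y \<notin> S" using x m by (auto simp: y_def image_iff)
    ultimately have "(\<gamma> has_vector_derivative velocity y) (at y)" by (intro S(2)) (auto simp: T_def)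
    moreover have "((\<lambda>x. m * x + t1) has_real_derivative m) (at x)" by (auto intro!: derivative_eq_intros)
    ultimately have "((\<gamma> \<circ> (\<lambda>x. m * x + t1)) has_vector_derivative m *\<^sub>R velocity y) (at x)"
      unfolding y_def by (intro vector_diff_chain_at) (simp add: has_real_derivative_iff_has_vector_derivative)
    then have "vector_derivative (gpath t1 t2) (at x) = m *\<^sub>R velocity y"
      by (intro vector_derivative_at) (simp add: gpath_def o_def m_def)
    then show "f (gpath t1 t2 x) * vector_derivative (gpath t1 t2) (at x) = m *\<^sub>R (f (\<gamma> (m * x + t1)) * velocity (m * x + t1))"
      by (simp add: gpath_def m_def y_def)
  qed
qed

definition edge :: "real \<Rightarrow> real \<Rightarrow> complex set" where
  "edge c t = closed_segment (\<gamma> t) (Complex c (Im (\<gamma> t)))"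

text \<open>Up along the contour, then by a horizontal edge to the line \<open>Re s = c\<close>, down along the line, and back by an
  edge. If the line is to the right of the contour, the path runs clockwise, hence the factor \<open>- 2 \<pi> \<i>\<close> in the
  residue theorem below.\<close>

definition cpath :: "real \<Rightarrow> real \<Rightarrow> real \<Rightarrow> real \<Rightarrow> complex" where
  "cpath c t1 t2 = gpath t1 t2 +++ linepath (\<gamma> t2) (Complex c (Im (\<gamma> t2))) +++
     linepath (Complex c (Im (\<gamma> t2))) (Complex c (Im (\<gamma> t1))) +++ linepath (Complex c (Im (\<gamma> t1))) (\<gamma> t1)"

lemma cpath_facts:
  assumes "t1 < t2"
  shows "valid_path (cpath c t1 t2)" "pathfinish (cpath c t1 t2) = pathstart (cpath c t1 t2)"
    and "path_image (cpath c t1 t2) \<subseteq> \<gamma> ` {t1..t2} \<union> edge c t2 \<union>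
      {s. Re s = c \<and> Im s \<in> closed_segment (Im (\<gamma> t1)) (Im (\<gamma> t2))} \<union> edge c t1"
  using assms
    by (auto simp: cpath_def gpath_ends gpath_image valid_gpath path_image_join edge_def closed_segment_commute closed_segment_same_Re
      intro!: valid_path_join)

definition I0 :: real where "I0 = (\<integral>t. 1 / (1 + t\<^sup>2) \<partial>lborel)"

text \<open>A bound for the integral over a closed path, for integrands bounded by \<open>1 / (1 + (Im s)\<^sup>2)\<close>. It does not
  depend on the heights of the truncation, so it serves as a majorant in the passage to the limit.\<close>

definition Mbound :: "real \<Rightarrow> real" where "Mbound c = K * B * I0 + I0 + 2 * (\<bar>c\<bar> + R)"

lemma edge_length: "norm (Complex c (Im (\<gamma> t)) - \<gamma> t) \<le> \<bar>c\<bar> + R"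
proof -
  have "Complex c (Im (\<gamma> t)) - \<gamma> t = of_real (c - Re (\<gamma> t))" by (simp add: complex_eq_iff)
  then have "norm (Complex c (Im (\<gamma> t)) - \<gamma> t) = \<bar>c - Re (\<gamma> t)\<bar>" by (simp only: norm_of_real)
  then show ?thesis using Re_\<gamma>[of t] by linarith
qed

lemma Im_edge: "s \<in> edge c t \<Longrightarrow> Im s = Im (\<gamma> t)"
  unfolding edge_def by (subst (asm) closed_segment_same_Im) auto

lemma Re_edge:
  assumes c: "c > R" and s: "s \<in> edge c t"
  shows "Re s \<in> {-R..c}"
proof -
  have *: "Re (\<gamma> t) \<in> {-R..c}" using Re_\<gamma>[of t] c by (auto simp: abs_le_iff)
  have cc: "c \<in> {-R..c}" using c R_nonneg by simp
  obtain u where u: "0 \<le> u" "u \<le> 1" "s = (1 - u) *\<^sub>R \<gamma> t + u *\<^sub>R Complex c (Im (\<gamma> t))"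
    using s unfolding edge_def closed_segment_def by auto
  have "(1 - u) *\<^sub>R Re (\<gamma> t) + u *\<^sub>R c \<in> {-R..c}"
    by (rule convexD[OF convex_real_interval(5) * cc]) (use u in auto)
  then show ?thesis by (simp add: u(3))
qed

lemma Re_closed_contour:
  assumes c: "c > R" and s: "s \<in> range \<gamma> \<union> {s. Re s = c} \<union> (\<Union>n. edge c (t1 n) \<union> edge c (t2 n))"
  shows "Re s \<in> {-R..c}"
proof -
  consider t where "s = \<gamma> t" | "Re s = c" | t where "s \<in> edge c t" using s by blast
  then show ?thesis
  proof cases
    case (1 t)
    then show ?thesis using Re_\<gamma>[of t] c by (auto simp: abs_le_iff)
  next
    case 2
    then show ?thesis using c R_nonneg by simp
  next
    case 3
    then show ?thesis by (rule Re_edge[OF c])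
  qed
qed

text \<open>Closing a long piece of the contour by two horizontal edges and a piece of the vertical line: if the integrand
  decays quadratically, the edges contribute nothing in the limit.\<close>

lemma cpath_integral:
  assumes t: "t1 < t2" and h: "Im (\<gamma> t1) < Im (\<gamma> t2)"
    and cont: "continuous_on (range \<gamma> \<union> {s. Re s = c} \<union> edge c t1 \<union> edge c t2) f"
    and decay: "\<And>s. s \<in> range \<gamma> \<union> {s. Re s = c} \<union> edge c t1 \<union> edge c t2 \<Longrightarrow> norm (f s) \<le> C / (1 + (Im s)\<^sup>2)"
    and C: "C \<ge> 0"
  shows "f contour_integrable_on (cpath c t1 t2)"
    and "norm (contour_integral (cpath c t1 t2) f -
      ((\<integral>t. indicator {t1..t2} t *\<^sub>R (f (\<gamma> t) * velocity t) \<partial>lborel) -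
       (\<integral>y. indicator {Im (\<gamma> t1)..Im (\<gamma> t2)} y *\<^sub>R (f (Complex c y) * \<i>) \<partial>lborel)))
      \<le> (\<bar>c\<bar> + R) * (C / (1 + (Im (\<gamma> t1))\<^sup>2)) + (\<bar>c\<bar> + R) * (C / (1 + (Im (\<gamma> t2))\<^sup>2))"
    and "norm (contour_integral (cpath c t1 t2) f) \<le> C * Mbound c"
    and "integrable lborel (\<lambda>t. f (\<gamma> t) * velocity t)"
    and "integrable lborel (\<lambda>y. f (Complex c y) * \<i>)"
proof -
  define h1 h2 where "h1 = Im (\<gamma> t1)" and "h2 = Im (\<gamma> t2)"
  have "continuous_on UNIV (\<lambda>t. f (\<gamma> t))"
    by (rule continuous_on_compose2[OF cont continuous_\<gamma>]) auto
  then have m1 [measurable]: "(\<lambda>t. f (\<gamma> t)) \<in> borel_measurable borel" by (rule borel_measurable_continuous_onI)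
  have "continuous_on UNIV (\<lambda>y. f (Complex c y))"
    by (rule continuous_on_compose2[OF cont]) (auto intro!: continuous_intros)
  then have m2 [measurable]: "(\<lambda>t. f (Complex c t)) \<in> borel_measurable borel" by (rule borel_measurable_continuous_onI)
  have d1: "norm (f (\<gamma> t)) \<le> C * K / (1 + t\<^sup>2)" for t
    by (rule order_trans[OF decay decay_\<gamma>[OF C]]) auto
  note int1 = integrable_decay[of f "C * K", OF m1 d1]
  show i1: "integrable lborel (\<lambda>t. f (\<gamma> t) * velocity t)" by (rule int1)
  have d2: "norm (f (Complex c y)) \<le> C / (1 + y\<^sup>2)" for y
    using decay[of "Complex c y"] by simp
  show i2: "integrable lborel (\<lambda>y. f (Complex c y) * \<i>)"
  proof (rule Bochner_Integration.integrable_bound[OF integrable_inverse_1_plus_sq[of C]])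
    show "AE t in lborel. norm (f (Complex c t) * \<i>) \<le> norm (C / (1 + t\<^sup>2))"
      using d2 C by (intro always_eventually allI) (auto simp: norm_mult)
  qed measurable
  define A1 where "A1 = (\<integral>t. indicator {t1..t2} t *\<^sub>R (f (\<gamma> t) * velocity t) \<partial>lborel)"
  define A2 where "A2 = (\<integral>y. indicator {h1..h2} y *\<^sub>R (f (Complex c y) * \<i>) \<partial>lborel)"
  have c1: "(f has_contour_integral A1) (gpath t1 t2)"
    unfolding A1_def by (intro has_contour_integral_gpath t segment_integral i1)
  have "((\<lambda>y. f (Complex c y) * \<i>) has_integral A2) {h1..h2}"
    unfolding A2_def by (rule segment_integral[OF i2])
  from has_integral_mult_left[OF this, of "-\<i>"]
  have "((\<lambda>y. f (Complex c y)) has_integral (- \<i> * A2)) {h1..h2}"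
    by (simp add: mult_ac)
  then have "(f has_contour_integral A2) (linepath (Complex c h1) (Complex c h2))"
    using h by (subst has_contour_integral_linepath_same_Re_iff[where c=c and a=h1 and b=h2]) (auto simp: h1_def h2_def)
  then have c2: "(f has_contour_integral (- A2)) (linepath (Complex c h2) (Complex c h1))"
    using has_contour_integral_reversepath[OF valid_path_linepath] by fastforce
  have e: "continuous_on (edge c t1) f" "continuous_on (edge c t2) f"
    by (auto intro: continuous_on_subset[OF cont])
  define E2 where "E2 = contour_integral (linepath (\<gamma> t2) (Complex c h2)) f"
  define E1 where "E1 = contour_integral (linepath (Complex c h1) (\<gamma> t1)) f"
  have ii2: "f contour_integrable_on (linepath (\<gamma> t2) (Complex c h2))"
    using e(2) by (intro contour_integrable_continuous_linepath) (simp add: edge_def h2_def)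
  have ii1: "f contour_integrable_on (linepath (Complex c h1) (\<gamma> t1))"
    using e(1) by (intro contour_integrable_continuous_linepath) (simp add: edge_def h1_def closed_segment_commute)
  have "(f has_contour_integral (A1 + (E2 + (- A2 + E1)))) (cpath c t1 t2)"
    unfolding cpath_def h1_def[symmetric] h2_def[symmetric] E1_def E2_def
    by (intro has_contour_integral_join c1 c2 has_contour_integral_integral ii1 ii2 valid_gpath t valid_path_join valid_path_linepath)
       (auto simp: gpath_ends)
  then have ci: "contour_integral (cpath c t1 t2) f = A1 + (E2 + (- A2 + E1))"
    and "f contour_integrable_on (cpath c t1 t2)"
    by (auto simp: contour_integral_unique contour_integrable_on_def)
  then show "f contour_integrable_on (cpath c t1 t2)" by simp
  have dec1: "norm (f s) \<le> C / (1 + h1\<^sup>2)" if "s \<in> edge c t1" for s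
    using decay[of s] Im_edge[OF that] that by (simp add: h1_def)
  have dec2: "norm (f s) \<le> C / (1 + h2\<^sup>2)" if "s \<in> edge c t2" for s
    using decay[of s] Im_edge[OF that] that by (simp add: h2_def)
  have b2: "norm E2 \<le> (\<bar>c\<bar> + R) * (C / (1 + h2\<^sup>2))"
  proof -
    have "norm E2 \<le> (C / (1 + h2\<^sup>2)) * norm (Complex c h2 - \<gamma> t2)"
      unfolding E2_def using C
      by (intro contour_integral_bound_linepath ii2) (use dec2 in \<open>auto simp: edge_def h2_def closed_segment_commute\<close>)
    also have "\<dots> \<le> (C / (1 + h2\<^sup>2)) * (\<bar>c\<bar> + R)"
      using C edge_length[of c t2] by (intro mult_left_mono) (auto simp: h2_def)
    finally show ?thesis by (simp add: mult.commute)
  qed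
  have b1: "norm E1 \<le> (\<bar>c\<bar> + R) * (C / (1 + h1\<^sup>2))"
  proof -
    have "norm E1 \<le> (C / (1 + h1\<^sup>2)) * norm (\<gamma> t1 - Complex c h1)"
      unfolding E1_def using C
      by (intro contour_integral_bound_linepath ii1) (use dec1 in \<open>auto simp: edge_def h1_def closed_segment_commute\<close>)
    also have "\<dots> \<le> (C / (1 + h1\<^sup>2)) * (\<bar>c\<bar> + R)"
      using C edge_length[of c t1] by (intro mult_left_mono) (auto simp: h1_def norm_minus_commute)
    finally show ?thesis by (simp add: mult.commute)
  qed
  have "norm (contour_integral (cpath c t1 t2) f - (A1 - A2)) \<le> norm E1 + norm E2"
    unfolding ci using norm_triangle_ineq[of E1 E2] by (simp add: algebra_simps)
  with b1 b2 show "norm (contour_integral (cpath c t1 t2) f - (A1 - A2)) \<le> (\<bar>c\<bar> + R) * (C / (1 + (Im (\<gamma> t1))\<^sup>2)) + (\<bar>c\<bar> + R) * (C / (1 + (Im (\<gamma> t2))\<^sup>2))"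
    unfolding h1_def h2_def by simp
  have n1: "norm A1 \<le> C * K * B * I0"
  proof -
    have "norm A1 \<le> (\<integral>t. C * K * B * (1 / (1 + t\<^sup>2)) \<partial>lborel)"
      unfolding A1_def
    proof (rule order_trans[OF integral_norm_bound integral_mono_AE])
      show "integrable lborel (\<lambda>t. C * K * B * (1 / (1 + t\<^sup>2)))"
        using integrable_inverse_1_plus_sq[of "C * K * B"] by simp
      show "integrable lborel (\<lambda>t. norm (indicator {t1..t2} t *\<^sub>R (f (\<gamma> t) * velocity t)))"
        by (intro integrable_norm integrable_mult_indicator i1) simp
    next
      show "AE t in lborel. norm (indicator {t1..t2} t *\<^sub>R (f (\<gamma> t) * velocity t)) \<le> C * K * B * (1 / (1 + t\<^sup>2))"
        using int1(2) by eventually_elim (auto simp: indicator_def C K_pos less_imp_le B_nonneg)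
    qed
    then show ?thesis unfolding I0_def by (simp only: integral_mult_right_zero)
  qed
  have n2: "norm A2 \<le> C * I0"
  proof -
    have "norm A2 \<le> (\<integral>t. C * (1 / (1 + t\<^sup>2)) \<partial>lborel)"
      unfolding A2_def
    proof (rule order_trans[OF integral_norm_bound integral_mono_AE])
      show "integrable lborel (\<lambda>t. C * (1 / (1 + t\<^sup>2)))"
        using integrable_inverse_1_plus_sq[of "C"] by simp
      show "integrable lborel (\<lambda>t. norm (indicator {h1..h2} t *\<^sub>R (f (Complex c t) * \<i>)))"
        by (intro integrable_norm integrable_mult_indicator i2) simp
    next
      show "AE t in lborel. norm (indicator {h1..h2} t *\<^sub>R (f (Complex c t) * \<i>)) \<le> C * (1 / (1 + t\<^sup>2))"
        using d2 by (intro always_eventually allI) (auto simp: indicator_def C norm_mult)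
    qed
    then show ?thesis unfolding I0_def by (simp only: integral_mult_right_zero)
  qed
  have le: "(\<bar>c\<bar> + R) * (C / (1 + h\<^sup>2)) \<le> (\<bar>c\<bar> + R) * C" for h
    using C R_nonneg by (intro mult_left_mono) (auto simp: divide_simps add_pos_nonneg mult_left_le sum_power2_gt_zero_iff mult_le_cancel_left1)
  have "norm (contour_integral (cpath c t1 t2) f) \<le> norm A1 + norm A2 + (norm E1 + norm E2)"
    unfolding ci using norm_triangle_ineq[of "A1 - A2" "E1 + E2"] norm_triangle_ineq[of E1 E2] norm_triangle_ineq4[of A1 A2]
    by (simp add: algebra_simps)
  also have "\<dots> \<le> C * K * B * I0 + C * I0 + ((\<bar>c\<bar> + R) * C + (\<bar>c\<bar> + R) * C)"
    using n1 n2 order_trans[OF b1 le] order_trans[OF b2 le] by linarith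
  also have "\<dots> = C * Mbound c" by (simp add: Mbound_def algebra_simps)
  finally show "norm (contour_integral (cpath c t1 t2) f) \<le> C * Mbound c" .
qed

lemma cpath_integral_LIMSEQ:
  assumes t: "\<And>n. t1 n < t2 n" and h: "\<And>n. Im (\<gamma> (t1 n)) < Im (\<gamma> (t2 n))"
    and lim: "filterlim t1 at_bot sequentially" "filterlim t2 at_top sequentially"
    and cont: "continuous_on (range \<gamma> \<union> {s. Re s = c} \<union> (\<Union>n. edge c (t1 n) \<union> edge c (t2 n))) f"
    and decay: "\<And>s. s \<in> range \<gamma> \<union> {s. Re s = c} \<union> (\<Union>n. edge c (t1 n) \<union> edge c (t2 n)) \<Longrightarrow> norm (f s) \<le> C / (1 + (Im s)\<^sup>2)"
    and C: "C \<ge> 0"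
  shows "(\<lambda>n. contour_integral (cpath c (t1 n) (t2 n)) f) \<longlonglongrightarrow> curve_integral \<gamma> f - (\<integral>y. f (Complex c y) * \<i> \<partial>lborel)"
proof -
  have cont': "continuous_on (range \<gamma> \<union> {s. Re s = c} \<union> edge c (t1 n) \<union> edge c (t2 n)) f" for n
    by (rule continuous_on_subset[OF cont]) auto
  have decay': "norm (f s) \<le> C / (1 + (Im s)\<^sup>2)" if "s \<in> range \<gamma> \<union> {s. Re s = c} \<union> edge c (t1 n) \<union> edge c (t2 n)" for s n
    by (rule decay) (use that in auto)
  note ci = cpath_integral[OF t h cont' decay' C]
  define A where "A n = (\<integral>t. indicator {t1 n..t2 n} t *\<^sub>R (f (\<gamma> t) * velocity t) \<partial>lborel) -
       (\<integral>y. indicator {Im (\<gamma> (t1 n))..Im (\<gamma> (t2 n))} y *\<^sub>R (f (Complex c y) * \<i>) \<partial>lborel)" for n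
  have h2: "filterlim (\<lambda>n. Im (\<gamma> (t2 n))) at_top sequentially"
  proof (rule filterlim_at_top_mono)
    show "filterlim (\<lambda>n. - R + t2 n) at_top sequentially"
      by (rule filterlim_tendsto_add_at_top[OF tendsto_const lim(2)])
    have "- R + t2 n \<le> Im (\<gamma> (t2 n))" for n using Im_\<gamma>[of "t2 n"] by linarith
    then show "\<forall>\<^sub>F n in sequentially. - R + t2 n \<le> Im (\<gamma> (t2 n))" by simp
  qed
  have h1: "filterlim (\<lambda>n. Im (\<gamma> (t1 n))) at_bot sequentially"
    unfolding filterlim_uminus_at_bot
  proof (rule filterlim_at_top_mono)
    show "filterlim (\<lambda>n. - R + - t1 n) at_top sequentially"
      using lim(1) by (intro filterlim_tendsto_add_at_top[OF tendsto_const]) (simp add: filterlim_uminus_at_bot)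
    have "- R + - t1 n \<le> - Im (\<gamma> (t1 n))" for n using Im_\<gamma>[of "t1 n"] by linarith
    then show "\<forall>\<^sub>F n in sequentially. - R + - t1 n \<le> - Im (\<gamma> (t1 n))" by simp
  qed
  have "A \<longlonglongrightarrow> curve_integral \<gamma> f - (\<integral>y. f (Complex c y) * \<i> \<partial>lborel)"
    unfolding A_def curve_integral_def by (intro tendsto_diff filterlim_segments ci(4,5) lim h1 h2)
  moreover have "(\<lambda>n. contour_integral (cpath c (t1 n) (t2 n)) f - A n) \<longlonglongrightarrow> 0"
  proof (rule Lim_null_comparison)
    show "\<forall>\<^sub>F n in sequentially. norm (contour_integral (cpath c (t1 n) (t2 n)) f - A n) \<le>
       (\<bar>c\<bar> + R) * (C / (1 + (Im (\<gamma> (t1 n)))\<^sup>2)) + (\<bar>c\<bar> + R) * (C / (1 + (Im (\<gamma> (t2 n)))\<^sup>2))"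
      unfolding A_def by (intro always_eventually allI ci(2))
    have inv: "((\<lambda>y::real. C / (1 + y\<^sup>2)) \<longlongrightarrow> 0) at_top" "((\<lambda>y::real. C / (1 + y\<^sup>2)) \<longlongrightarrow> 0) at_bot" by real_asymp+
    show "(\<lambda>n. (\<bar>c\<bar> + R) * (C / (1 + (Im (\<gamma> (t1 n)))\<^sup>2)) + (\<bar>c\<bar> + R) * (C / (1 + (Im (\<gamma> (t2 n)))\<^sup>2))) \<longlonglongrightarrow> 0"
      using tendsto_add[OF tendsto_mult_left[OF filterlim_compose[OF inv(2) h1], of "\<bar>c\<bar> + R"]
         tendsto_mult_left[OF filterlim_compose[OF inv(1) h2], of "\<bar>c\<bar> + R"]] by simp
  qed
  ultimately show ?thesis by (rule Lim_transform)
qed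

text \<open>The line is itself a vertical contour, and both points lie in the connected half plane to its left.\<close>

lemma vertical_line_kernel:
  assumes "Re p < c" "Re p' < c"
  shows "(\<integral>y. (1 / (Complex c y - p') - 1 / (Complex c y - p)) * \<i> \<partial>lborel) = 0"
proof -
  have der: "((\<lambda>t. Complex c t) has_vector_derivative \<i>) (at t within A)" for t A
    by (auto intro!: derivative_eq_intros simp: Complex_eq)
  interpret line: vertical_curve "Complex c" "\<bar>c\<bar>" 1
  proof
    show "Complex c piecewise_C1_differentiable_on {-T..T}" for T
      by (intro C1_differentiable_imp_piecewise) (auto simp: C1_differentiable_on_def intro!: exI[of _ "\<lambda>_. \<i>"] der)
    show "1-lipschitz_on UNIV (Complex c)"
      by (auto simp: lipschitz_on_def dist_norm cmod_def)
    show "norm (Complex c t - \<i> * of_real t) \<le> \<bar>c\<bar>" for t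
      by (simp add: cmod_def)
  qed
  have velocity: "vector_derivative (Complex c) (at t) = \<i>" for t by (rule vector_derivative_at[OF der])
  have "curve_integral (Complex c) (\<lambda>s. 1 / (s - p') - 1 / (s - p)) = 0"
    by (rule line.curve_integral_kernel_connected[of "{s. Re s < c}"]) (use assms in \<open>auto simp: convex_connected convex_halfspace_Re_lt\<close>)
  then show ?thesis by (simp add: curve_integral_def velocity)
qed

text \<open>The residue theorem for a vertical contour and a vertical line to its right, by passage to the limit in truncated
  closed paths. A truncated path need not be simple and may have any winding number around a pole. As the
  truncation grows, the winding number around each pole converges to the regularised winding number of the contour,
  and it is bounded by \<^const>\<open>kernel_const\<close> uniformly in the truncation. Therefore rapidly decreasing residues permit
  the limit under the sum over the poles. Here \<open>Q\<close> is the finite set of the poles between the contour and the line.\<close>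

lemma residues_between_contours:
  fixes f :: "complex \<Rightarrow> complex" and c \<delta> C :: real and P Q :: "complex set" and t1 t2 :: "nat \<Rightarrow> real"
  defines "S \<equiv> {s. - R - 2 < Re s \<and> Re s < c + 1/4}"
  defines "D \<equiv> range \<gamma> \<union> {s. Re s = c} \<union> (\<Union>n. edge c (t1 n) \<union> edge c (t2 n))"
  assumes t: "\<And>n. t1 n < t2 n" and h: "\<And>n. Im (\<gamma> (t1 n)) < Im (\<gamma> (t2 n))"
    and lim: "filterlim t1 at_bot sequentially" "filterlim t2 at_top sequentially"
    and c: "c > R"
    and P: "P \<subseteq> S" "\<And>T. finite {p\<in>P. \<bar>Im p\<bar> < T}" "\<And>p. p \<in> P \<Longrightarrow> Re p < c"
    and holo: "f holomorphic_on S - P"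
    and sep: "0 < \<delta>" "\<delta> \<le> 1" "\<And>s p. s \<in> D \<Longrightarrow> p \<in> P \<Longrightarrow> \<delta> \<le> norm (s - p)"
    and decay: "C \<ge> 0" "\<And>s. s \<in> D \<Longrightarrow> norm (f s) \<le> C / (1 + (Im s)\<^sup>2)"
    and summ: "integrable (count_space P) (\<lambda>p. norm (residue f p) * kernel_const \<delta> (of_real (- R - 1)) p)"
    and Q: "finite Q" "Q \<subseteq> P"
    and right: "\<And>p. p \<in> Q \<Longrightarrow> curve_integral \<gamma> (\<lambda>s. 1 / (s - p) - 1 / (s - of_real (- R - 1))) = - (2 * pi * \<i>)"
    and left: "\<And>p. p \<in> P - Q \<Longrightarrow> curve_integral \<gamma> (\<lambda>s. 1 / (s - p) - 1 / (s - of_real (- R - 1))) = 0"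
  shows "curve_integral \<gamma> f - (\<integral>y. f (Complex c y) * \<i> \<partial>lborel) = - (2 * pi * \<i>) * (\<Sum>p\<in>Q. residue f p)"
proof -
  \<comment> \<open>The base point \<open>r\<close> lies to the left of all paths, where their winding numbers vanish. Subtracting its kernel
    costs nothing for the closed paths and makes the integral along the whole contour converge.\<close>
  define r where "r = complex_of_real (- R - 1)"
  define k where "k p s = 1 / (s - p) - 1 / (s - r)" for p s :: complex
  define w where "w n p = contour_integral (cpath c (t1 n) (t2 n)) (k p)" for n p
  have Dr: "Re s \<ge> - R" "Re s \<le> c" if "s \<in> D" for s
    using Re_closed_contour[OF c that[unfolded D_def]] by auto
  have sepr: "\<delta> \<le> norm (s - r)" if "s \<in> D" for s
    using Dr[OF that] sep(2) complex_Re_le_cmod[of "s - r"] by (simp add: r_def)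
  have DS: "D \<subseteq> S" using Dr R_nonneg by (force simp: S_def)
  have DP: "D \<inter> P = {}" using sep by fastforce
  have image: "path_image (cpath c (t1 n) (t2 n)) \<subseteq> D" for n
    using cpath_facts(3)[OF t, of c n] by (auto simp: D_def)
  have lim_f: "(\<lambda>n. contour_integral (cpath c (t1 n) (t2 n)) f) \<longlonglongrightarrow> curve_integral \<gamma> f - (\<integral>y. f (Complex c y) * \<i> \<partial>lborel)"
    using DS DP decay
    by (intro cpath_integral_LIMSEQ t h lim continuous_on_subset[OF holomorphic_on_imp_continuous_on[OF holo]])
       (auto simp: D_def[symmetric])
  have k_cont: "continuous_on D (k p)" if "p \<in> P" for p
    unfolding k_def using sep(3)[OF _ that] sepr sep(1) by (intro continuous_intros) fastforce+
  have k_decay: "norm (k p s) \<le> kernel_const \<delta> r p / (1 + (Im s)\<^sup>2)" if "p \<in> P" "s \<in> D" for p s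
    unfolding k_def by (rule kernel_decay[OF sep(1) sepr[OF that(2)] sep(3)[OF that(2,1)]])
  have lim_w: "(\<lambda>n. w n p) \<longlonglongrightarrow> curve_integral \<gamma> (k p)" if "p \<in> P" for p
  proof -
    have "(\<lambda>n. w n p) \<longlonglongrightarrow> curve_integral \<gamma> (k p) - (\<integral>y. k p (Complex c y) * \<i> \<partial>lborel)"
      unfolding w_def using k_cont[OF that] k_decay[OF that]
      by (intro cpath_integral_LIMSEQ[where C="kernel_const \<delta> r p"] t h lim kernel_const_nonneg sep(1)) (auto simp: D_def[symmetric])
    moreover have "(\<integral>y. k p (Complex c y) * \<i> \<partial>lborel) = 0"
      unfolding k_def by (rule vertical_line_kernel) (use P(3)[OF that] c R_nonneg in \<open>auto simp: r_def\<close>)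
    ultimately show ?thesis by simp
  qed
  have bound_w: "norm (w n p) \<le> kernel_const \<delta> r p * Mbound c" if "p \<in> P" for n p
  proof -
    have sub: "range \<gamma> \<union> {s. Re s = c} \<union> edge c (t1 n) \<union> edge c (t2 n) \<subseteq> D" by (auto simp: D_def)
    show ?thesis unfolding w_def
      by (rule cpath_integral(3)[OF t h continuous_on_subset[OF k_cont[OF that] sub] k_decay[OF that subsetD[OF sub]]
            kernel_const_nonneg[OF sep(1)]])
  qed
  have res: "contour_integral (cpath c (t1 n) (t2 n)) f = (\<integral>p. w n p * residue f p \<partial>count_space P)" for n
  proof -
    define g where "g = cpath c (t1 n) (t2 n)"
    have g: "valid_path g" "pathfinish g = pathstart g" "path_image g \<subseteq> D"
      unfolding g_def using cpath_facts[OF t] image by auto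
    have "bounded (path_image g)" using g(1) by (simp add: valid_path_imp_path bounded_path_image)
    then obtain T where T: "\<And>s. s \<in> path_image g \<Longrightarrow> norm s < T" by (meson bounded_pos_less)
    define box where "box = {s. - R - (1/2) < Re s \<and> Re s < c + 1/4 \<and> \<bar>Im s\<bar> < T}"
    have box_eq: "box = {s. Re s > - R - (1/2)} \<inter> {s. Re s < c + 1/4} \<inter> {s. Im s > - T} \<inter> {s. Im s < T}"
      by (auto simp: box_def abs_less_iff)
    have cbox: "convex box" unfolding box_eq
      by (intro convex_Int convex_halfspace_Re_gt convex_halfspace_Re_lt convex_halfspace_Im_gt convex_halfspace_Im_lt)
    have obox: "open box" unfolding box_eq
      by (intro open_Int open_halfspace_Re_gt open_halfspace_Re_lt open_halfspace_Im_gt open_halfspace_Im_lt)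
    have gbox: "path_image g \<subseteq> box"
    proof
      fix s assume s: "s \<in> path_image g"
      then have "s \<in> D" using g(3) by blast
      from Dr[OF this] show "s \<in> box"
        using T[OF s] abs_Im_le_cmod[of s] by (simp add: box_def)
    qed
    have boxS: "box \<subseteq> S" using R_nonneg by (auto simp: box_def S_def)
    have fin: "finite (P \<inter> box)" by (rule finite_subset[OF _ P(2)[of T]]) (auto simp: box_def)
    have out: "winding_number g z = 0" if "z \<notin> box" for z
      by (rule winding_number_zero_outside[OF valid_path_imp_path[OF g(1)] cbox g(2) that gbox])
    have "contour_integral g f = 2 * pi * \<i> * (\<Sum>p\<in>P \<inter> box. winding_number g p * residue f p)"
    proof (rule Residue_theorem[OF obox convex_connected[OF cbox] fin _ g(1,2)])
      show "f holomorphic_on box - P \<inter> box" by (rule holomorphic_on_subset[OF holo]) (use boxS in auto)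
      show "path_image g \<subseteq> box - P \<inter> box" using gbox g(3) DP by auto
    qed (use out in auto)
    moreover have w_eq: "w n p = 2 * pi * \<i> * winding_number g p" if p: "p \<in> P" for p
    proof -
      have np: "p \<notin> path_image g" using p g(3) DP by auto
      have "r \<notin> D" using Dr(1)[of r] by (auto simp: r_def)
      then have nr: "r \<notin> path_image g" using g(3) by auto
      have "r \<notin> box" by (simp add: r_def box_def)
      have "((\<lambda>s. 1 / (s - p) - 1 / (s - r)) has_contour_integral
        (2 * pi * \<i> * winding_number g p - 2 * pi * \<i> * winding_number g r)) g"
        by (intro has_contour_integral_diff has_contour_integral_winding_number g(1) np nr)
      then show ?thesis using out[OF \<open>r \<notin> box\<close>]
        by (simp add: w_def g_def[symmetric] k_def[abs_def] contour_integral_unique)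
    qed
    moreover have "(\<integral>p. w n p * residue f p \<partial>count_space P) = (\<Sum>p\<in>P \<inter> box. w n p * residue f p)"
    proof (rule integral_count_space_support[OF fin])
      fix p assume "p \<in> P - P \<inter> box"
      then show "w n p * residue f p = 0" using out[of p] w_eq[of p] by auto
    qed simp
    ultimately show ?thesis by (simp add: g_def sum_distrib_left mult_ac)
  qed
  have "(\<lambda>n. \<integral>p. w n p * residue f p \<partial>count_space P) \<longlonglongrightarrow> (\<integral>p. curve_integral \<gamma> (k p) * residue f p \<partial>count_space P)"
  proof (rule integral_dominated_convergence[where w="\<lambda>p. Mbound c * (norm (residue f p) * kernel_const \<delta> r p)"])
    show "integrable (count_space P) (\<lambda>p. Mbound c * (norm (residue f p) * kernel_const \<delta> r p))"
      using summ unfolding r_def by (rule integrable_mult_right)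
    show "AE p in count_space P. (\<lambda>n. w n p * residue f p) \<longlonglongrightarrow> curve_integral \<gamma> (k p) * residue f p"
      by (auto simp: AE_count_space intro!: tendsto_mult_right lim_w)
    have "norm (w n p * residue f p) \<le> Mbound c * (norm (residue f p) * kernel_const \<delta> r p)" if "p \<in> P" for n p
      using mult_right_mono[OF bound_w[OF that, of n] norm_ge_zero[of "residue f p"]] by (simp add: norm_mult mult_ac)
    then show "AE p in count_space P. norm (w n p * residue f p) \<le> Mbound c * (norm (residue f p) * kernel_const \<delta> r p)" for n
      by (auto simp: AE_count_space)
  qed auto
  moreover have "(\<integral>p. curve_integral \<gamma> (k p) * residue f p \<partial>count_space P) = (\<Sum>p\<in>Q. curve_integral \<gamma> (k p) * residue f p)"
    using left by (intro integral_count_space_support Q) (auto simp: k_def[abs_def] r_def)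
  ultimately have "curve_integral \<gamma> f - (\<integral>y. f (Complex c y) * \<i> \<partial>lborel) = (\<Sum>p\<in>Q. curve_integral \<gamma> (k p) * residue f p)"
    using lim_f LIMSEQ_unique unfolding res by auto
  also have "\<dots> = (\<Sum>p\<in>Q. - (2 * pi * \<i>) * residue f p)"
    using right by (intro sum.cong) (auto simp: k_def[abs_def] r_def)
  finally show ?thesis by (simp add: sum_distrib_left)
qed

end

section \<open>The sine function near the integers and far from them\<close>

lemma sin_pi_quotient_limit:
  "((\<lambda>w. sin (of_real pi * w) / (w - of_int k)) \<longlongrightarrow> of_real pi * cos (of_real pi * of_int k)) (at (of_int k :: complex))"
proof -
  have "((\<lambda>w. sin (of_real pi * w)) has_field_derivative (of_real pi * cos (of_real pi * of_int k))) (at (of_int k :: complex))"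
    by (auto intro!: derivative_eq_intros)
  moreover have "sin (of_real pi * of_int k :: complex) = 0" by (subst sin_eq_0) (auto simp: mult.commute)
  ultimately show ?thesis by (simp add: has_field_derivative_iff)
qed

lemma sin_pi_eq_0_iff: "sin (of_real pi * s) = 0 \<longleftrightarrow> (\<exists>k::int. s = of_int k)" for s :: complex
proof -
  have "sin (of_real pi * s) = 0 \<longleftrightarrow> (\<exists>n::int. of_real pi * s = of_real pi * of_int n)"
    by (simp add: sin_eq_0 mult.commute)
  then show ?thesis by simp
qed

lemma cos_pi_int: "cos (of_real pi * of_int k :: complex) \<noteq> 0" "cos (of_real pi * of_nat n :: complex) = (-1) ^ n"
proof -
  have "sin (of_real pi * of_int k :: complex) = 0" using sin_pi_eq_0_iff by blast
  then show "cos (of_real pi * of_int k :: complex) \<noteq> 0"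
    using sin_cos_squared_add[of "of_real pi * of_int k :: complex"] by auto
  have "cos (of_real (pi * real n) :: complex) = of_real (cos (real n * pi))"
    by (simp only: cos_of_real mult.commute)
  then show "cos (of_real pi * of_nat n :: complex) = (-1) ^ n" by (simp add: cos_npi)
qed

lemma norm_sin_ge:
  assumes "1 \<le> \<bar>Im s\<bar>"
  shows "exp (pi * \<bar>Im s\<bar>) / 4 \<le> norm (sin (of_real pi * s))"
proof -
  define y where "y = pi * Im s"
  have "norm (sin (of_real pi * s)) = norm (exp (\<i> * (of_real pi * s)) - exp (- (\<i> * (of_real pi * s)))) / 2"
    by (simp add: sin_exp_eq norm_divide norm_mult)
  moreover have "norm (exp (\<i> * (of_real pi * s)) - exp (- (\<i> * (of_real pi * s)))) \<ge> \<bar>exp (-y) - exp y\<bar>"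
    using norm_triangle_ineq3[of "exp (\<i> * (of_real pi * s))" "exp (- (\<i> * (of_real pi * s)))"]
    by (simp add: y_def)
  moreover have "\<bar>exp (-y) - exp y\<bar> = exp \<bar>y\<bar> - exp (- \<bar>y\<bar>)"
    by (cases "y \<ge> 0") (auto simp: abs_if)
  ultimately have le: "(exp \<bar>y\<bar> - exp (- \<bar>y\<bar>)) / 2 \<le> norm (sin (of_real pi * s))" by simp
  have "1 \<le> \<bar>y\<bar>" using assms pi_ge_two mult_mono[of 1 pi 1 "\<bar>Im s\<bar>"] by (simp add: y_def abs_mult)
  then have "exp (- \<bar>y\<bar>) \<le> exp (-1)" "exp 1 \<le> exp \<bar>y\<bar>" by auto
  moreover have "exp (-1) \<le> (1::real)" "2 \<le> exp (1::real)" using exp_ge_add_one_self[of 1] by auto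
  ultimately have "exp (- \<bar>y\<bar>) \<le> exp \<bar>y\<bar> / 2" by linarith
  then have "exp \<bar>y\<bar> / 4 \<le> (exp \<bar>y\<bar> - exp (- \<bar>y\<bar>)) / 2" by (simp add: field_simps)
  with le show ?thesis by (simp add: y_def abs_mult)
qed

definition qp :: "real \<Rightarrow> complex \<Rightarrow> complex" where "qp q s = of_real q powr s"

lemma ex_int_minus: "(\<exists>n::int. P n) \<longleftrightarrow> (\<exists>n. P (- n))"
  by (metis minus_minus)

section \<open>Poles and decay of the integrand\<close>

locale qab =
  fixes q :: real and a b :: complex
  assumes q0: "0 < q" and q1: "q < 1" and a0: "a \<noteq> 0" and b0: "b \<noteq> 0"
begin

definition "lq = ln q"
definition "per = 2 * pi / (- lq)"

lemma lq_neg: "lq < 0" using q0 q1 by (simp add: lq_def)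
lemma per_pos: "per > 0" using lq_neg by (simp add: per_def divide_pos_neg)

lemma qp_eq: "qp q s = exp (s * of_real lq)"
  using q0 by (simp add: qp_def powr_def lq_def Ln_of_real)

lemma qp_nonzero [simp]: "qp q s \<noteq> 0" by (simp add: qp_eq)
lemma qp_add: "qp q (s + t) = qp q s * qp q t" by (simp add: qp_eq distrib_right exp_add)
lemma qp_nat: "qp q (of_nat n) = of_real q ^ n"
  using q0 by (simp add: qp_def powr_nat)
lemma norm_qp: "norm (qp q s) = q powr Re s"
  using q0 by (simp add: qp_eq lq_def powr_def)
lemma qp_period: "qp q (s + of_int n * (of_real per * \<i>)) = qp q s"
proof -
  have "of_int n * (of_real per * \<i>) * of_real lq = \<i> * (of_int (- n) * (of_real pi * 2) :: complex)"
    using lq_neg by (simp add: per_def field_simps)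
  then have "exp (of_int n * (of_real per * \<i>) * of_real lq) = (1::complex)"
    unfolding exp_eq_1 by (auto intro!: exI[of _ "- n"])
  then show ?thesis by (simp add: qp_eq distrib_right exp_add)
qed

lemma qp_holomorphic [holomorphic_intros]: "f holomorphic_on A \<Longrightarrow> (\<lambda>s. qp q (f s)) holomorphic_on A"
  unfolding qp_eq by (intro holomorphic_intros)
lemma qp_continuous [continuous_intros]: "continuous_on A f \<Longrightarrow> continuous_on A (\<lambda>s. qp q (f s))"
  unfolding qp_eq by (intro continuous_intros)
lemma qp_measurable [measurable]: "qp q \<in> borel_measurable borel"
  by (intro borel_measurable_continuous_onI continuous_intros)

lemma pole_family_iff:
  assumes "c \<noteq> 0"
  shows "qpoch_inf q (c * qp q s) = 0 \<longleftrightarrow> s \<in> pole_family q c"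
proof -
  have "qpoch_inf q (c * qp q s) = 0 \<longleftrightarrow> (\<exists>m::nat. c * qp q s * of_real q ^ m = 1)"
    using qpoch_inf_eq_0_iff[OF q0 q1] .
  also have "\<dots> \<longleftrightarrow> (\<exists>(m::nat) (n::int). s + Ln c / of_real lq = - of_nat m - of_int n * (2 * of_real pi * \<i> / of_real lq))"
  proof (rule ex_cong1)
    fix m :: nat
    have "c * qp q s * of_real q ^ m = exp (Ln c + (s + of_nat m) * of_real lq)"
      using assms unfolding qp_nat[symmetric] by (simp add: qp_eq exp_add distrib_right)
    also have "\<dots> = 1 \<longleftrightarrow> (\<exists>n::int. Ln c + (s + of_nat m) * of_real lq = of_int (2 * n) * of_real pi * \<i>)"
      using exp_eq[of "Ln c + (s + of_nat m) * of_real lq" 0] by simp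
    also have "\<dots> \<longleftrightarrow> (\<exists>n::int. Ln c + (s + of_nat m) * of_real lq = of_int (2 * (- n)) * of_real pi * \<i>)"
      by (rule ex_int_minus)
    also have "\<dots> \<longleftrightarrow> (\<exists>n::int. s + Ln c / of_real lq = - of_nat m - of_int n * (2 * of_real pi * \<i> / of_real lq))"
    proof (rule ex_cong1)
      fix n :: int
      have l: "complex_of_real lq \<noteq> 0" using lq_neg by simp
      show "Ln c + (s + of_nat m) * of_real lq = of_int (2 * (- n)) * of_real pi * \<i> \<longleftrightarrow>
        s + Ln c / of_real lq = - of_nat m - of_int n * (2 * of_real pi * \<i> / of_real lq)"
      proof -
        have "s + Ln c / of_real lq = - of_nat m - of_int n * (2 * of_real pi * \<i> / of_real lq) \<longleftrightarrow>
          (s + Ln c / of_real lq) * of_real lq = (- of_nat m - of_int n * (2 * of_real pi * \<i> / of_real lq)) * of_real lq"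
          using l by simp
        also have "(s + Ln c / of_real lq) * of_real lq = Ln c + s * of_real lq"
          using l by (simp add: distrib_right)
        also have "(- of_nat m - of_int n * (2 * of_real pi * \<i> / of_real lq)) * of_real lq =
          of_int (2 * (- n)) * of_real pi * \<i> - of_nat m * of_real lq"
          using l by (simp add: left_diff_distrib)
        also have "Ln c + s * of_real lq = of_int (2 * (- n)) * of_real pi * \<i> - of_nat m * of_real lq \<longleftrightarrow>
          Ln c + (s + of_nat m) * of_real lq = of_int (2 * (- n)) * of_real pi * \<i>"
          unfolding eq_diff_eq by (simp only: distrib_right add.assoc)
        finally show ?thesis by simp
      qed
    qed
    finally show "c * qp q s * of_real q ^ m = 1 \<longleftrightarrow> (\<exists>n::int. s + Ln c / of_real lq = - of_nat m - of_int n * (2 * of_real pi * \<i> / of_real lq))" .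
  qed
  finally show ?thesis by (simp add: pole_family_def lq_def)
qed

definition left_poles :: "complex set" where "left_poles = pole_family q a \<union> pole_family q b"
definition nat_poles :: "complex set" where "nat_poles = range of_nat"

definition den :: "complex \<Rightarrow> complex" where
  "den s = qpoch_inf q (a * qp q s) * qpoch_inf q (b * qp q s)"

lemma den_eq_0_iff: "den s = 0 \<longleftrightarrow> s \<in> left_poles"
  using pole_family_iff[OF a0] pole_family_iff[OF b0] by (simp add: den_def left_poles_def)

lemma den_holomorphic [holomorphic_intros]: "f holomorphic_on A \<Longrightarrow> (\<lambda>s. den (f s)) holomorphic_on A"
  unfolding den_def by (intro holomorphic_intros q0 q1)
lemma den_continuous: "continuous_on A den"
  unfolding den_def[abs_def] by (intro continuous_intros q0 q1)
lemma den_period: "den (s + of_int n * (of_real per * \<i>)) = den s"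
  by (simp add: den_def qp_period)

lemma left_poles_period: "s + of_int n * (of_real per * \<i>) \<in> left_poles \<longleftrightarrow> s \<in> left_poles"
  unfolding den_eq_0_iff[symmetric] den_period ..

lemma reduce_period:
  obtains n where "0 \<le> Im (s + of_int n * (of_real per * \<i>))" "Im (s + of_int n * (of_real per * \<i>)) \<le> per"
proof -
  define n where "n = - \<lfloor>Im s / per\<rfloor>"
  have "of_int \<lfloor>Im s / per\<rfloor> \<le> Im s / per" "Im s / per \<le> of_int \<lfloor>Im s / per\<rfloor> + 1" by linarith+
  then have "of_int \<lfloor>Im s / per\<rfloor> * per \<le> Im s" "Im s \<le> (of_int \<lfloor>Im s / per\<rfloor> + 1) * per"
    using per_pos by (simp_all only: pos_le_divide_eq pos_divide_le_eq)
  then show ?thesis using that[of n] by (simp add: n_def algebra_simps)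
qed

text \<open>By periodicity it suffices to consider one period, where the admissible points form a compact set without zeros
  of the denominator.\<close>

lemma den_lower_bound:
  assumes "\<eta> > 0"
  obtains C where "C > 0" "\<And>s. l \<le> Re s \<Longrightarrow> Re s \<le> u \<Longrightarrow> (\<And>p. p \<in> left_poles \<Longrightarrow> \<eta> \<le> norm (s - p)) \<Longrightarrow> norm (1 / den s) \<le> C"
proof -
  define Z where "Z = cbox (Complex l 0) (Complex u per) \<inter> (\<Inter>p\<in>left_poles. {s. \<eta> \<le> norm (s - p)})"
  have "compact Z" unfolding Z_def
    by (intro compact_Int_closed compact_cbox closed_INT ballI closed_Collect_le continuous_intros)
  moreover have "continuous_on Z (\<lambda>s. 1 / den s)"
    using assms by (intro continuous_intros den_continuous) (force simp: Z_def den_eq_0_iff)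
  ultimately have "bounded ((\<lambda>s. 1 / den s) ` Z)" by (intro compact_imp_bounded compact_continuous_image)
  then obtain C where C: "C > 0" "\<And>s. s \<in> Z \<Longrightarrow> norm (1 / den s) \<le> C"
    unfolding bounded_pos by auto
  have "norm (1 / den s) \<le> C" if s: "l \<le> Re s" "Re s \<le> u" "\<And>p. p \<in> left_poles \<Longrightarrow> \<eta> \<le> norm (s - p)" for s
  proof -
    obtain n where n: "0 \<le> Im (s + of_int n * (of_real per * \<i>))" "Im (s + of_int n * (of_real per * \<i>)) \<le> per"
      using reduce_period by blast
    have "s + of_int n * (of_real per * \<i>) \<in> Z"
    proof -
      have "\<eta> \<le> norm (s + of_int n * (of_real per * \<i>) - p)" if "p \<in> left_poles" for p
        using s(3)[of "p + of_int (-n) * (of_real per * \<i>)"] that unfolding left_poles_period by (simp add: algebra_simps)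
      then show ?thesis using s n by (auto simp: Z_def in_cbox_complex_iff)
    qed
    from C(2)[OF this] show ?thesis by (simp only: den_period)
  qed
  with C(1) show ?thesis using that by blast
qed

definition raw_numer :: "complex \<Rightarrow> complex" where
  "raw_numer s = of_real pi * qpoch_inf q (qp q (1 + s)) / sin (of_real pi * s)"

text \<open>The zeros of \<open>(q powr (1 + s); q)\<^sub>\<infinity>\<close> cancel the poles at the negative integers. A contour may pass through these
  points, where the formula divides by \<open>0\<close>, so the removable singularities are filled in.\<close>

definition numer :: "complex \<Rightarrow> complex" where "numer = remove_sings raw_numer"

lemma numer_zero: "qpoch_inf q (qp q (1 - of_nat (Suc m))) = 0"
proof -
  have "qp q (1 - of_nat (Suc m)) * of_real q ^ m = 1"
    unfolding qp_nat[symmetric] qp_add[symmetric] by (simp add: qp_eq)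
  then show ?thesis using qpoch_inf_eq_0_iff[OF q0 q1] by blast
qed

lemma raw_numer_analytic: "(\<And>k::int. s \<noteq> of_int k) \<Longrightarrow> raw_numer analytic_on {s}"
proof -
  assume s: "\<And>k::int. s \<noteq> of_int k"
  have "(\<lambda>s. qpoch_inf q (qp q (1 + s))) holomorphic_on UNIV" by (intro holomorphic_intros q0 q1)
  then have "(\<lambda>s. qpoch_inf q (qp q (1 + s))) analytic_on {s}"
    using analytic_on_holomorphic by blast
  then show ?thesis unfolding raw_numer_def[abs_def]
    using s by (intro analytic_intros) (auto simp: sin_pi_eq_0_iff)
qed

lemma numer_eq: "(\<And>k::int. s \<noteq> of_int k) \<Longrightarrow> numer s = raw_numer s"
  unfolding numer_def using raw_numer_analytic by simp

lemma raw_numer_eventually_analytic: "eventually (\<lambda>s. raw_numer analytic_on {s}) (at s0)"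
proof -
  have "eventually (\<lambda>s. \<forall>k::int. s \<noteq> of_int k) (at s0)"
  proof -
    have "closed (\<int> - {s0} :: complex set)" by (rule closed_subset_Ints) auto
    then have "open (- (\<int> - {s0}))" by (rule open_Compl)
    then have "eventually (\<lambda>s. s \<in> - (\<int> - {s0})) (at s0)"
      by (intro eventually_at_in_open'[THEN eventually_mono]) auto
    moreover have "eventually (\<lambda>s. s \<noteq> s0) (at s0)" by (simp add: eventually_at_filter)
    ultimately show ?thesis by eventually_elim auto
  qed
  then show ?thesis by eventually_elim (use raw_numer_analytic in auto)
qed

lemma numer_analytic:
  assumes "s \<notin> nat_poles"
  shows "numer analytic_on {s}"
proof (cases "\<exists>k::int. s = of_int k")
  case False
  then show ?thesis unfolding numer_def using raw_numer_analytic[of s] remove_sings_analytic_on by blast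
next
  case True
  then obtain k :: int where k: "s = of_int k" by blast
  have "k < 0"
  proof (rule ccontr)
    assume "\<not> k < 0"
    then have "s = of_nat (nat k)" using k by simp
    then show False using assms by (auto simp: nat_poles_def)
  qed
  then obtain m where m: "k = - int (Suc m)" by (metis negD minus_minus of_nat_Suc)
  have sm: "s = - of_nat (Suc m)" by (simp add: k m)
  have "(\<lambda>s. qpoch_inf q (qp q (1 + s))) holomorphic_on UNIV" by (intro holomorphic_intros q0 q1)
  then obtain A' where "((\<lambda>s. qpoch_inf q (qp q (1 + s))) has_field_derivative A') (at s)"
    by (metis UNIV_I holomorphic_on_imp_differentiable_at open_UNIV field_differentiable_def)
  moreover have "qpoch_inf q (qp q (1 + s)) = 0" using numer_zero[of m] by (simp add: sm)
  ultimately have 1: "((\<lambda>w. qpoch_inf q (qp q (1 + w)) / (w - s)) \<longlongrightarrow> A') (at s)"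
    by (simp add: has_field_derivative_iff)
  have 2: "((\<lambda>w. sin (of_real pi * w) / (w - s)) \<longlongrightarrow> of_real pi * cos (of_real pi * s)) (at s)"
    using sin_pi_quotient_limit[of k] by (simp add: k)
  have "((\<lambda>w. of_real pi * (qpoch_inf q (qp q (1 + w)) / (w - s)) / (sin (of_real pi * w) / (w - s))) \<longlongrightarrow>
     of_real pi * A' / (of_real pi * cos (of_real pi * s))) (at s)"
    using cos_pi_int(1)[of k] by (intro tendsto_intros 1 2) (simp add: k)
  moreover have "eventually (\<lambda>w. of_real pi * (qpoch_inf q (qp q (1 + w)) / (w - s)) / (sin (of_real pi * w) / (w - s)) = raw_numer w) (at s)"
    by (auto simp: eventually_at_filter raw_numer_def)
  ultimately have "(raw_numer \<longlongrightarrow> of_real pi * A' / (of_real pi * cos (of_real pi * s))) (at s)"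
    using tendsto_cong by fast
  moreover have "isolated_singularity_at raw_numer s"
    using raw_numer_eventually_analytic[of s]
    by (simp add: isolated_singularity_at_altdef analytic_at_imp_isCont)
  ultimately show ?thesis unfolding numer_def by (rule remove_sings_analytic_at[rotated])
qed

lemma numer_holomorphic: "A \<inter> nat_poles = {} \<Longrightarrow> numer holomorphic_on A"
  using numer_analytic by (meson analytic_imp_holomorphic analytic_on_analytic_at disjoint_iff)

text \<open>Near the real axis this is compactness. Away from it the infinite product is bounded and the sine grows like
  \<open>exp (\<pi> \<bar>Im s\<bar>)\<close>.\<close>

lemma numer_bound:
  assumes "\<eta> > 0"
  obtains C where "C > 0" "\<And>s. l \<le> Re s \<Longrightarrow> Re s \<le> u \<Longrightarrow> (\<And>p. p \<in> nat_poles \<Longrightarrow> \<eta> \<le> norm (s - p)) \<Longrightarrow> norm (numer s) \<le> C * exp (- pi * \<bar>Im s\<bar>)"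
proof -
  define Z where "Z = cbox (Complex l (-1)) (Complex u 1) \<inter> (\<Inter>p\<in>nat_poles. {s. \<eta> \<le> norm (s - p)})"
  have "compact Z" unfolding Z_def
    by (intro compact_Int_closed compact_cbox closed_INT ballI closed_Collect_le continuous_intros)
  moreover have "continuous_on Z numer"
    using assms by (intro holomorphic_on_imp_continuous_on numer_holomorphic) (force simp: Z_def)
  ultimately have "bounded (numer ` Z)" by (intro compact_imp_bounded compact_continuous_image)
  then obtain C1 where C1: "C1 > 0" "\<And>s. s \<in> Z \<Longrightarrow> norm (numer s) \<le> C1"
    unfolding bounded_pos by auto
  have "bounded (qpoch_inf q ` cball 0 (q powr (1 + l)))"
    by (intro compact_imp_bounded compact_continuous_image continuous_intros q0 q1) auto
  then obtain C2 where C2: "C2 > 0" "\<And>w. norm w \<le> q powr (1 + l) \<Longrightarrow> norm (qpoch_inf q w) \<le> C2"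
    unfolding bounded_pos by auto
  define C where "C = max (C1 * exp pi) (pi * C2 * 4)"
  have C: "C > 0" using C1 by (simp add: C_def less_max_iff_disj)
  have "norm (numer s) \<le> C * exp (- pi * \<bar>Im s\<bar>)"
    if s: "l \<le> Re s" "Re s \<le> u" "\<And>p. p \<in> nat_poles \<Longrightarrow> \<eta> \<le> norm (s - p)" for s
  proof (cases "\<bar>Im s\<bar> \<le> 1")
    case True
    then have "s \<in> Z" using s by (auto simp: Z_def in_cbox_complex_iff)
    then have "norm (numer s) \<le> C1 * exp pi * exp (- pi)" using C1(2) by (simp add: mult.assoc exp_add[symmetric])
    also have "\<dots> \<le> C * exp (- pi * \<bar>Im s\<bar>)"
      using True C C1(1) by (intro mult_mono) (auto simp: C_def mult_left_le)
    finally show ?thesis .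
  next
    case False
    then have "s \<noteq> of_int k" for k :: int by auto
    then have "norm (numer s) = pi * norm (qpoch_inf q (qp q (1 + s))) / norm (sin (of_real pi * s))"
      by (simp add: numer_eq raw_numer_def norm_divide norm_mult)
    also have "\<dots> \<le> pi * C2 / (exp (pi * \<bar>Im s\<bar>) / 4)"
    proof (intro frac_le mult_left_mono C2(2) norm_sin_ge)
      show "norm (qp q (1 + s)) \<le> q powr (1 + l)"
        unfolding norm_qp using s q0 q1 by (intro powr_mono') auto
    qed (use False C2 in auto)
    also have "\<dots> = pi * C2 * 4 * exp (- pi * \<bar>Im s\<bar>)" by (simp add: exp_minus field_simps)
    also have "\<dots> \<le> C * exp (- pi * \<bar>Im s\<bar>)" by (intro mult_right_mono) (auto simp: C_def)
    finally show ?thesis .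
  qed
  with C show ?thesis using that by blast
qed

text \<open>The common factor of the three integrands; the kernel only contributes a further factor, its moment.\<close>

definition Q :: "complex \<Rightarrow> complex" where "Q s = numer s / den s"

lemma Q_holomorphic: "A \<inter> (left_poles \<union> nat_poles) = {} \<Longrightarrow> Q holomorphic_on A"
  unfolding Q_def[abs_def] by (intro holomorphic_intros numer_holomorphic) (auto simp: den_eq_0_iff)

lemma Q_bound:
  assumes "\<eta> > 0"
  obtains C where "C > 0" "\<And>s. l \<le> Re s \<Longrightarrow> Re s \<le> u \<Longrightarrow> (\<And>p. p \<in> left_poles \<union> nat_poles \<Longrightarrow> \<eta> \<le> norm (s - p)) \<Longrightarrow>
     norm (Q s) \<le> C * exp (- pi * \<bar>Im s\<bar>)"
proof -
  obtain C1 where C1: "C1 > 0" "\<And>s. l \<le> Re s \<Longrightarrow> Re s \<le> u \<Longrightarrow> (\<And>p. p \<in> left_poles \<Longrightarrow> \<eta> \<le> norm (s - p)) \<Longrightarrow> norm (1 / den s) \<le> C1"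
    using den_lower_bound[OF assms, of l u] by blast
  obtain C2 where C2: "C2 > 0" "\<And>s. l \<le> Re s \<Longrightarrow> Re s \<le> u \<Longrightarrow> (\<And>p. p \<in> nat_poles \<Longrightarrow> \<eta> \<le> norm (s - p)) \<Longrightarrow> norm (numer s) \<le> C2 * exp (- pi * \<bar>Im s\<bar>)"
    using numer_bound[OF assms, of l u] by blast
  have "norm (Q s) \<le> (C2 * C1) * exp (- pi * \<bar>Im s\<bar>)"
    if s: "l \<le> Re s" "Re s \<le> u" "\<And>p. p \<in> left_poles \<union> nat_poles \<Longrightarrow> \<eta> \<le> norm (s - p)" for s
  proof -
    have "norm (Q s) = norm (numer s) * norm (1 / den s)" by (simp add: Q_def norm_divide)
    also have "\<dots> \<le> (C2 * exp (- pi * \<bar>Im s\<bar>)) * C1"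
      using s C1 C2 by (intro mult_mono) auto
    finally show ?thesis by (simp add: mult_ac)
  qed
  with C1(1) C2(1) show ?thesis using that[of "C2 * C1"] by simp
qed

end

section \<open>The lattices of poles\<close>

lemma summable_on_finite_UN:
  fixes g :: "'a \<Rightarrow> real"
  assumes "finite I" "\<And>i. i \<in> I \<Longrightarrow> g summable_on A i"
  shows "g summable_on (\<Union>i\<in>I. A i)"
  using assms
proof (induction rule: finite_induct)
  case (insert i I)
  have "g summable_on (\<Union>i\<in>I. A i)" by (rule insert.IH) (simp add: insert.prems)
  then have "g summable_on ((\<Union>i\<in>I. A i) - A i)" by (rule summable_on_subset_banach) blast
  then have "g summable_on A i \<union> ((\<Union>i\<in>I. A i) - A i)"
    by (intro summable_on_Un_disjoint insert.prems) auto
  then show ?case by (simp only: Un_Diff_cancel UN_insert)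
qed simp

lemma quarter_dist:
  fixes x :: real and j :: int
  assumes "1/4 \<le> \<bar>x\<bar>" "\<bar>x\<bar> \<le> 3/4"
  shows "1/4 \<le> \<bar>of_int j + x\<bar>"
proof -
  consider "j = 0" | "j \<ge> 1" | "j \<le> -1" by linarith
  then show ?thesis
  proof cases
    case 2
    then have "real_of_int j \<ge> 1" by simp
    then show ?thesis using assms by linarith
  next
    case 3
    then have "real_of_int j \<le> -1" by simp
    then show ?thesis using assms by linarith
  qed (use assms in simp)
qed

context qab
begin

definition lat :: "complex \<Rightarrow> int \<Rightarrow> int \<Rightarrow> complex" where
  "lat z m n = z + of_int m + of_int n * (of_real per * \<i>)"

lemma Re_lat [simp]: "Re (lat z m n) = Re z + of_int m" and Im_lat [simp]: "Im (lat z m n) = Im z + of_int n * per"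
  by (simp_all add: lat_def)

lemma pole_family_lat:
  assumes "p \<in> pole_family q c"
  shows "\<exists>m n. m \<le> 0 \<and> p = lat (- (Ln c / of_real lq)) m n"
proof -
  obtain m :: nat and n :: int where h: "p + Ln c / of_real lq = - of_nat m - of_int n * (2 * of_real pi * \<i> / of_real lq)"
    using assms by (auto simp: pole_family_def lq_def)
  have "of_int n * (2 * of_real pi * \<i> / of_real lq) = - (of_int n * (of_real per * \<i>))"
    using lq_neg by (simp add: per_def)
  moreover have "p = - of_nat m - of_int n * (2 * of_real pi * \<i> / of_real lq) - Ln c / of_real lq"
    using h by (metis add_diff_cancel_right')
  ultimately have "p = lat (- (Ln c / of_real lq)) (- int m) n" by (simp only: lat_def) simp
  then show ?thesis by (intro exI[of _ "- int m"] exI[of _ n]) auto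
qed

definition "za = - (Ln a / of_real lq)"
definition "zb = - (Ln b / of_real lq)"

lemma left_poles_lat: "p \<in> left_poles \<Longrightarrow> \<exists>z\<in>{za, zb}. \<exists>m n. m \<le> 0 \<and> p = lat z m n"
  unfolding left_poles_def za_def zb_def using pole_family_lat by blast

lemma Re_left_poles: "p \<in> left_poles \<Longrightarrow> Re p \<le> max (Re za) (Re zb)"
  using left_poles_lat by fastforce

lemma finite_lat: "finite {p. (\<exists>m n. p = lat z m n) \<and> norm p < T}"
proof -
  define M where "M = \<lceil>T + \<bar>Re z\<bar> + (T + \<bar>Im z\<bar>) / per\<rceil>"
  have "{p. (\<exists>m n. p = lat z m n) \<and> norm p < T} \<subseteq> (\<lambda>(m,n). lat z m n) ` ({-M..M} \<times> {-M..M})"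
  proof clarify
    fix m n assume T: "norm (lat z m n) < T"
    then have "T > 0" using norm_ge_zero le_less_trans by blast
    have "\<bar>Re z + of_int m\<bar> < T" "\<bar>Im z + of_int n * per\<bar> < T"
      using T abs_Re_le_cmod[of "lat z m n"] abs_Im_le_cmod[of "lat z m n"] by auto
    then have m: "\<bar>of_int m\<bar> \<le> T + \<bar>Re z\<bar>" and "\<bar>of_int n * per\<bar> \<le> T + \<bar>Im z\<bar>" by linarith+
    then have n: "\<bar>of_int n\<bar> \<le> (T + \<bar>Im z\<bar>) / per"
      using per_pos by (simp add: abs_mult pos_le_divide_eq)
    have "0 \<le> (T + \<bar>Im z\<bar>) / per" "0 \<le> T + \<bar>Re z\<bar>" using \<open>T > 0\<close> per_pos by auto
    then have "\<bar>real_of_int m\<bar> \<le> of_int M" "\<bar>real_of_int n\<bar> \<le> of_int M" unfolding M_def using m n by linarith+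
    then have "m \<in> {-M..M}" "n \<in> {-M..M}" by (auto simp: abs_le_iff simp flip: of_int_abs)
    then show "lat z m n \<in> (\<lambda>(m,n). lat z m n) ` ({-M..M} \<times> {-M..M})" by auto
  qed
  then show ?thesis by (rule finite_subset) auto
qed

lemma finite_poles: "finite {p \<in> left_poles \<union> nat_poles. norm p < T}"
proof -
  have "{p \<in> left_poles \<union> nat_poles. norm p < T} \<subseteq> {p. (\<exists>m n. p = lat za m n) \<and> norm p < T} \<union>
    {p. (\<exists>m n. p = lat zb m n) \<and> norm p < T} \<union> of_nat ` {..nat \<lceil>T\<rceil>}"
  proof
    fix p assume p: "p \<in> {p \<in> left_poles \<union> nat_poles. norm p < T}"
    then consider "p \<in> left_poles" | k where "p = of_nat k" by (auto simp: nat_poles_def)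
    then show "p \<in> {p. (\<exists>m n. p = lat za m n) \<and> norm p < T} \<union>
      {p. (\<exists>m n. p = lat zb m n) \<and> norm p < T} \<union> of_nat ` {..nat \<lceil>T\<rceil>}"
    proof cases
      case 1
      then show ?thesis using left_poles_lat[OF 1] p by auto
    next
      case 2
      then have "real k < T" using p by simp
      then have "k \<le> nat \<lceil>T\<rceil>" by linarith
      then show ?thesis using 2 by auto
    qed
  qed
  then show ?thesis by (rule finite_subset) (intro finite_UnI finite_lat finite_imageI; simp)
qed

text \<open>The differences of poles lie in three translates of one lattice, which together have finitely many points in the
  unit disc.\<close>

lemma poles_separated:
  obtains \<epsilon> where "\<epsilon> > 0" "\<And>p p'. p \<in> left_poles \<Longrightarrow> p' \<in> left_poles \<Longrightarrow> p \<noteq> p' \<Longrightarrow> \<epsilon> \<le> norm (p - p')"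
proof -
  define V where "V = (\<Union>z\<in>{0, za - zb, zb - za}. {p. (\<exists>m n. p = lat z m n) \<and> norm p < 1}) - {0}"
  have V: "finite V" unfolding V_def by (intro finite_Diff finite_UN_I finite_lat) auto
  define \<epsilon> where "\<epsilon> = Min (insert 1 (norm ` V))"
  have "\<epsilon> > 0" unfolding \<epsilon>_def using V by (subst Min_gr_iff) (auto simp: V_def)
  moreover have "\<epsilon> \<le> norm (p - p')" if p: "p \<in> left_poles" "p' \<in> left_poles" "p \<noteq> p'" for p p'
  proof (cases "norm (p - p') < 1")
    case True
    obtain z m n where z: "z \<in> {za, zb}" "p = lat z m n" using left_poles_lat[OF p(1)] by blast
    obtain z' m' n' where z': "z' \<in> {za, zb}" "p' = lat z' m' n'" using left_poles_lat[OF p(2)] by blast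
    have "p - p' = lat (z - z') (m - m') (n - n')" by (simp add: z z' lat_def algebra_simps)
    moreover have "z - z' \<in> {0, za - zb, zb - za}" using z z' by auto
    ultimately have "p - p' \<in> (\<Union>z\<in>{0, za - zb, zb - za}. {p. (\<exists>m n. p = lat z m n) \<and> norm p < 1})"
      using True by (intro UN_I[of "z - z'"]) blast+
    then have "p - p' \<in> V" using p(3) unfolding V_def by simp
    then show ?thesis unfolding \<epsilon>_def using V by (intro Min_le) auto
  next
    case False
    have "\<epsilon> \<le> 1" unfolding \<epsilon>_def using V by (intro Min_le) auto
    then show ?thesis using False by simp
  qed
  ultimately show ?thesis using that by blast
qed

text \<open>Modulo the period the poles have at most two heights, those of \<open>za\<close> and \<open>zb\<close>. Of the two heights at \<open>1/4\<close> and \<open>3/4\<close>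
  of a period above \<open>za\<close>, the one chosen is at least a quarter of a period away from \<open>zb\<close> as well.\<close>

lemma free_height:
  obtains h0 where "\<And>p n. p \<in> left_poles \<Longrightarrow> per / 4 \<le> \<bar>Im p - (h0 + of_int n * per)\<bar>"
proof -
  define D where "D = (Im zb - Im za) / per"
  define e :: real where "e = (if frac D \<le> 1/2 then 3/4 else 1/4)"
  define h0 where "h0 = Im za + per * e"
  have "per / 4 \<le> \<bar>Im p - (h0 + of_int n * per)\<bar>" if pL: "p \<in> left_poles" for p n
  proof -
    have *: "per / 4 \<le> \<bar>y\<bar>" if "y = per * (of_int j + x)" "1/4 \<le> \<bar>x\<bar>" "\<bar>x\<bar> \<le> 3/4" for y x j
      using mult_left_mono[OF quarter_dist[OF that(2,3), of j], of per] per_pos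
      by (simp add: that(1) abs_mult)
    obtain z m k where z: "z \<in> {za, zb}" "p = lat z m k" using left_poles_lat[OF pL] by blast
    then consider "z = za" | "z = zb" by auto
    then show ?thesis
    proof cases
      case 1
      then have "Im p - (h0 + of_int n * per) = per * (of_int (k - n) + (- e))"
        by (simp add: z(2) h0_def algebra_simps)
      then show ?thesis by (rule *) (auto simp: e_def)
    next
      case 2
      have "per * D = Im zb - Im za" using per_pos by (simp add: D_def)
      then have "Im zb = Im za + per * (frac D + of_int \<lfloor>D\<rfloor>)" by (simp add: frac_def)
      then have "Im p - (h0 + of_int n * per) = per * (of_int (k - n + \<lfloor>D\<rfloor>) + (frac D - e))"
        using 2 by (simp add: z(2) h0_def algebra_simps)
      from *[OF this] show ?thesis using frac_ge_0[of D] frac_lt_1[of D]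
        by (auto simp: e_def split: if_splits)
    qed
  qed
  then show ?thesis using that by blast
qed

text \<open>A vertical strip meets finitely many columns of poles, and each column gives a two-sided geometric series.\<close>

lemma summable_poles:
  assumes \<beta>: "\<beta> > 0"
  shows "(\<lambda>p. exp (- \<beta> * \<bar>Im p\<bar>)) summable_on {p \<in> left_poles. l < Re p \<and> Re p < u}"
proof -
  define Mz where "Mz z = {\<lceil>l - Re z\<rceil>..\<lfloor>u - Re z\<rfloor>}" for z
  have col: "(\<lambda>p. exp (- \<beta> * \<bar>Im p\<bar>)) summable_on range (\<lambda>n. lat z m n)" for z m
  proof -
    define C where "C = exp (\<beta> * \<bar>Im z\<bar>)"
    define x where "x = exp (- (\<beta> * per))"
    have x: "0 < x" "x < 1" using \<beta> per_pos by (auto simp: x_def)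
    have "(\<lambda>n::int. C * x ^ nat \<bar>n\<bar>) summable_on UNIV"
    proof (rule summable_on_int_split)
      show "summable (\<lambda>n. norm (C * x ^ nat \<bar>int n\<bar>))"
        using x by (simp add: C_def abs_mult summable_mult summable_geometric)
      have "norm (C * x ^ nat \<bar>- int (Suc n)\<bar>) = C * x * x ^ n" for n
        using x by (simp add: C_def abs_mult nat_add_distrib)
      then show "summable (\<lambda>n. norm (C * x ^ nat \<bar>- int (Suc n)\<bar>))"
        using x by (simp only: summable_mult summable_geometric real_norm_def abs_of_pos)
    qed
    moreover have "exp (- \<beta> * \<bar>Im (lat z m n)\<bar>) \<le> C * x ^ nat \<bar>n\<bar>" for n
    proof -
      have "x ^ nat \<bar>n\<bar> = exp (- (\<beta> * (\<bar>of_int n\<bar> * per)))"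
        unfolding x_def exp_of_nat_mult[symmetric] by (simp add: algebra_simps)
      then have e: "C * x ^ nat \<bar>n\<bar> = exp (\<beta> * (\<bar>Im z\<bar> - \<bar>of_int n\<bar> * per))"
        by (simp add: C_def exp_add[symmetric] algebra_simps)
      have "\<bar>of_int n * per\<bar> \<le> \<bar>Im z + of_int n * per\<bar> + \<bar>Im z\<bar>" by linarith
      then have "- \<bar>Im z + of_int n * per\<bar> \<le> \<bar>Im z\<bar> - \<bar>of_int n\<bar> * per" using per_pos by (simp add: abs_mult)
      from mult_left_mono[OF this, of \<beta>] \<beta> show ?thesis unfolding e by simp
    qed
    ultimately have "(\<lambda>n. exp (- \<beta> * \<bar>Im (lat z m n)\<bar>)) summable_on UNIV"
      by (rule summable_on_comparison_test) simp
    moreover have "inj (\<lambda>n. lat z m n)" using per_pos by (auto simp: inj_on_def lat_def)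
    ultimately show ?thesis by (subst summable_on_reindex) (auto simp: o_def)
  qed
  have "(\<lambda>p. exp (- \<beta> * \<bar>Im p\<bar>)) summable_on (\<Union>z\<in>{za, zb}. \<Union>m\<in>Mz z. range (\<lambda>n. lat z m n))"
    by (intro summable_on_finite_UN col) (auto simp: Mz_def)
  moreover have "{p \<in> left_poles. l < Re p \<and> Re p < u} \<subseteq> (\<Union>z\<in>{za, zb}. \<Union>m\<in>Mz z. range (\<lambda>n. lat z m n))"
  proof
    fix p assume p: "p \<in> {p \<in> left_poles. l < Re p \<and> Re p < u}"
    then obtain z m n where z: "z \<in> {za, zb}" "p = lat z m n" using left_poles_lat[of p] by blast
    then have "l - Re z < of_int m" "of_int m < u - Re z" using p by auto
    then have "m \<in> Mz z" unfolding Mz_def by (simp add: ceiling_le_iff le_floor_iff)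
    then show "p \<in> (\<Union>z\<in>{za, zb}. \<Union>m\<in>Mz z. range (\<lambda>n. lat z m n))" using z by blast
  qed
  ultimately show ?thesis by (rule summable_on_subset_banach)
qed

end

locale mb = vertical_curve \<gamma> R B + qab q a b
  for \<gamma> :: "real \<Rightarrow> complex" and R B q :: real and a b :: complex +
  fixes \<delta>0 :: real
  assumes left: "\<And>p. p \<in> left_poles \<Longrightarrow> left_of \<gamma> p" and right: "\<And>p. p \<in> nat_poles \<Longrightarrow> right_of \<gamma> p"
    and gap0: "\<delta>0 > 0" "\<And>p t. p \<in> left_poles \<union> nat_poles \<Longrightarrow> \<delta>0 \<le> norm (\<gamma> t - p)"
begin

lemma poles_off_curve: "p \<in> left_poles \<union> nat_poles \<Longrightarrow> p \<notin> range \<gamma>"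
proof
  assume p: "p \<in> left_poles \<union> nat_poles" "p \<in> range \<gamma>"
  then obtain t where "\<gamma> t = p" by auto
  then show False using gap0(1) gap0(2)[OF p(1), of t] by simp
qed

lemma half_planes_off_curve: "Re s < - R \<Longrightarrow> s \<notin> range \<gamma>" "Re s > R \<Longrightarrow> s \<notin> range \<gamma>"
proof -
  have *: "\<not> (Re s < - R \<or> Re s > R)" if "s \<in> range \<gamma>"
  proof -
    obtain t where "s = \<gamma> t" using \<open>s \<in> range \<gamma>\<close> by auto
    then show ?thesis using Re_\<gamma>[of t] by (simp add: abs_le_iff)
  qed
  show "Re s < - R \<Longrightarrow> s \<notin> range \<gamma>" "Re s > R \<Longrightarrow> s \<notin> range \<gamma>" using * by blast+
qed

text \<open>The pole is joined off the contour to a point far to the left, and this point to the base point inside a half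
  plane.\<close>

lemma curve_integral_left:
  assumes "p \<in> left_poles"
  shows "curve_integral \<gamma> (\<lambda>s. 1 / (s - p) - 1 / (s - of_real (- R - 1))) = 0"
proof -
  have "\<forall>\<^sub>F r in at_top. connected_component (- range \<gamma>) p (of_real (- r))"
    using left[OF assms] by (simp add: left_of_def)
  then have "\<forall>\<^sub>F r in at_top. connected_component (- range \<gamma>) p (of_real (- r)) \<and> r > R"
    using eventually_gt_at_top[of R] by eventually_elim auto
  then obtain r where r: "connected_component (- range \<gamma>) p (of_real (- r))" "r > R"
    using eventually_happens' by (metis (mono_tags, lifting) trivial_limit_at_top_linorder)
  obtain S where S: "connected S" "S \<subseteq> - range \<gamma>" "p \<in> S" "complex_of_real (- r) \<in> S"
    using r(1) unfolding connected_component_def by blast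
  have 1: "curve_integral \<gamma> (\<lambda>s. 1 / (s - p) - 1 / (s - of_real (- r))) = 0"
    using S by (intro curve_integral_kernel_connected[of S]) auto
  have half: "{s. Re s < - R} \<inter> range \<gamma> = {}" using half_planes_off_curve(1) by blast
  have 2: "curve_integral \<gamma> (\<lambda>s. 1 / (s - of_real (- R - 1)) - 1 / (s - of_real (- r))) = 0"
    using half r(2) by (intro curve_integral_kernel_connected[of "{s. Re s < - R}"] convex_connected convex_halfspace_Re_lt) auto
  have off: "p \<notin> range \<gamma>" "complex_of_real (- r) \<notin> range \<gamma>" "complex_of_real (- R - 1) \<notin> range \<gamma>"
    using poles_off_curve[of p] assms r(2) by (auto intro!: half_planes_off_curve(1))
  show ?thesis
    using curve_integral_kernel_diff[OF off(3,1,2)] 1 2 by simp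
qed

text \<open>The pole is joined off the contour to a point far to the right; from there to the base point the winding number
  changes by the crossing of the contour.\<close>

lemma curve_integral_right:
  assumes "p \<in> nat_poles"
  shows "curve_integral \<gamma> (\<lambda>s. 1 / (s - p) - 1 / (s - of_real (- R - 1))) = - (2 * pi * \<i>)"
proof -
  have "\<forall>\<^sub>F r in at_top. connected_component (- range \<gamma>) p (of_real r)"
    using right[OF assms] by (simp add: right_of_def)
  then have "\<forall>\<^sub>F r in at_top. connected_component (- range \<gamma>) p (of_real r) \<and> r > R"
    using eventually_gt_at_top[of R] by eventually_elim auto
  then obtain r where r: "connected_component (- range \<gamma>) p (of_real r)" "r > R"
    using eventually_happens' by (metis (mono_tags, lifting) trivial_limit_at_top_linorder)
  obtain S where S: "connected S" "S \<subseteq> - range \<gamma>" "p \<in> S" "complex_of_real r \<in> S"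
    using r(1) unfolding connected_component_def by blast
  have half: "{s. Re s > R} \<inter> range \<gamma> = {}" using half_planes_off_curve(2) by blast
  have half': "- of_real (R + 1) \<notin> range \<gamma>" by (rule half_planes_off_curve(1)) simp
  have 1: "curve_integral \<gamma> (\<lambda>s. 1 / (s - p) - 1 / (s - of_real r)) = 0"
    using S by (intro curve_integral_kernel_connected[of S]) auto
  have 2: "curve_integral \<gamma> (\<lambda>s. 1 / (s - of_real (R + 1)) - 1 / (s - of_real r)) = 0"
    using half r(2) by (intro curve_integral_kernel_connected[of "{s. Re s > R}"] convex_connected convex_halfspace_Re_gt) auto
  have off: "p \<notin> range \<gamma>" "of_real r \<notin> range \<gamma>" "of_real (R + 1) \<notin> range \<gamma>"
    using poles_off_curve[of p] assms r(2) by (auto intro!: half_planes_off_curve(2))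
  have 3: "curve_integral \<gamma> (\<lambda>s. 1 / (s - p) - 1 / (s - of_real (R + 1))) = 0"
    using curve_integral_kernel_diff[of "of_real (R + 1)" p "of_real r"] 1 2 off by simp
  have 4: "curve_integral \<gamma> (\<lambda>s. 1 / (s - of_real (R + 1)) - 1 / (s - (- of_real (R + 1)))) = - (2 * pi * \<i>)"
    using curve_integral_kernel_across[of "R + 1"] unfolding diff_minus_eq_add by simp
  show ?thesis
    using curve_integral_kernel_diff[of "of_real (R + 1)" p "- of_real (R + 1)"] 3 4 off half' by (simp add: algebra_simps)
qed

text \<open>The two families lie on opposite sides of the contour, where the regularised winding numbers differ.\<close>

lemma poles_disjoint: "left_poles \<inter> nat_poles = {}"
proof -
  have False if "p \<in> left_poles" "p \<in> nat_poles" for p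
    using curve_integral_left[OF that(1)] curve_integral_right[OF that(2)] by simp
  then show ?thesis by blast
qed

lemma height_reached: "\<exists>t. Im (\<gamma> t) = h \<and> \<bar>t - h\<bar> \<le> R"
proof -
  have "Im (\<gamma> (h - R)) \<le> h" "h \<le> Im (\<gamma> (h + R))" using Im_\<gamma>[of "h - R"] Im_\<gamma>[of "h + R"] by linarith+
  moreover have "continuous_on {h - R..h + R} (\<lambda>t. Im (\<gamma> t))" by (intro continuous_intros continuous_\<gamma>)
  ultimately have "\<exists>t\<ge>h - R. t \<le> h + R \<and> Im (\<gamma> t) = h"
    using R_nonneg by (intro IVT') auto
  then show ?thesis by (auto simp: abs_le_iff)
qed

end

section \<open>The basic hypergeometric series as a contour integral\<close>

lemma exp_decay_quadratic:
  fixes \<beta> y :: real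
  assumes "\<beta> > 0"
  shows "exp (- \<beta> * \<bar>y\<bar>) \<le> (1 + 2 / \<beta>\<^sup>2) / (1 + y\<^sup>2)"
proof -
  have "1 + \<beta> * \<bar>y\<bar> + (\<beta> * \<bar>y\<bar>)\<^sup>2 / 2 \<le> exp (\<beta> * \<bar>y\<bar>)"
    using assms by (intro exp_lower_Taylor_quadratic) simp
  then have "1 + \<beta>\<^sup>2 * y\<^sup>2 / 2 \<le> exp (\<beta> * \<bar>y\<bar>)"
    using assms mult_nonneg_nonneg[of \<beta> "\<bar>y\<bar>"] unfolding power_mult_distrib power2_abs by linarith
  from mult_left_mono[OF this, of "1 + 2 / \<beta>\<^sup>2"]
  have "(1 + 2 / \<beta>\<^sup>2) * (1 + \<beta>\<^sup>2 * y\<^sup>2 / 2) \<le> (1 + 2 / \<beta>\<^sup>2) * exp (\<beta> * \<bar>y\<bar>)" by simp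
  moreover have "(1 + 2 / \<beta>\<^sup>2) * (1 + \<beta>\<^sup>2 * y\<^sup>2 / 2) = 1 + y\<^sup>2 + (2 / \<beta>\<^sup>2 + \<beta>\<^sup>2 * y\<^sup>2 / 2)"
    using assms by (simp add: field_simps)
  moreover have "0 \<le> 2 / \<beta>\<^sup>2 + \<beta>\<^sup>2 * y\<^sup>2 / 2" by simp
  ultimately have "1 + y\<^sup>2 \<le> (1 + 2 / \<beta>\<^sup>2) * exp (\<beta> * \<bar>y\<bar>)" by linarith
  then show ?thesis
    by (simp add: exp_minus pos_le_divide_eq add_pos_nonneg) (simp add: field_simps)
qed

text \<open>The constant is at most cubic in \<open>p\<close>, and in a vertical strip \<open>\<bar>p\<bar>\<close> is at most a multiple of \<open>exp (\<kappa> \<bar>Im p\<bar>)\<close>.\<close>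

lemma kernel_const_growth:
  assumes \<kappa>: "\<kappa> > 0" and \<delta>: "\<delta> > 0"
  obtains C where "C > 0" "\<And>p. \<bar>Re p\<bar> \<le> M \<Longrightarrow> kernel_const \<delta> r p \<le> C * exp (3 * \<kappa> * \<bar>Im p\<bar>)"
proof -
  define A where "A = \<bar>M\<bar> + 1 / \<kappa>"
  define C where "C = (A + norm r) * (4 + (2 + 2 * (norm r)\<^sup>2 + 2 * A\<^sup>2) / \<delta>\<^sup>2)"
  have A: "A > 0" using \<kappa> by (simp add: A_def add_nonneg_pos)
  have C: "C > 0" unfolding C_def using A by (intro mult_pos_pos add_pos_nonneg) auto
  have "kernel_const \<delta> r p \<le> C * exp (3 * \<kappa> * \<bar>Im p\<bar>)" if M: "\<bar>Re p\<bar> \<le> M" for p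
  proof -
    define E where "E = exp (\<kappa> * \<bar>Im p\<bar>)"
    have E: "E \<ge> 1" using \<kappa> by (simp add: E_def)
    have "\<kappa> * \<bar>Im p\<bar> \<le> E" using exp_ge_add_one_self[of "\<kappa> * \<bar>Im p\<bar>"] unfolding E_def by linarith
    then have "\<bar>Im p\<bar> \<le> 1 / \<kappa> * E" using \<kappa> by (simp add: field_simps)
    moreover have "M \<le> \<bar>M\<bar> * E" using mult_left_mono[OF E, of "\<bar>M\<bar>"] by simp
    ultimately have p: "norm p \<le> A * E"
      using cmod_le[of p] M by (simp add: A_def distrib_right)
    have "norm r \<le> norm r * E" using E by (simp add: mult_le_cancel_left1)
    then have 1: "norm (p - r) \<le> (A + norm r) * E"
      using norm_triangle_ineq4[of p r] p by (simp add: distrib_right)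
    have E2: "1 \<le> E\<^sup>2" using E by simp
    have "(norm p)\<^sup>2 \<le> A\<^sup>2 * E\<^sup>2"
      using power_mono[OF p, of 2] by (simp add: power_mult_distrib)
    moreover have "2 + 2 * (norm r)\<^sup>2 \<le> (2 + 2 * (norm r)\<^sup>2) * E\<^sup>2"
      using mult_left_mono[OF E2, of "2 + 2 * (norm r)\<^sup>2"] by simp
    ultimately have "2 + 2 * (norm r)\<^sup>2 + 2 * (norm p)\<^sup>2 \<le> (2 + 2 * (norm r)\<^sup>2 + 2 * A\<^sup>2) * E\<^sup>2"
      by (simp add: distrib_right)
    then have "(2 + 2 * (norm r)\<^sup>2 + 2 * (norm p)\<^sup>2) / \<delta>\<^sup>2 \<le> (2 + 2 * (norm r)\<^sup>2 + 2 * A\<^sup>2) / \<delta>\<^sup>2 * E\<^sup>2"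
      by (simp add: divide_right_mono)
    then have 2: "4 + (2 + 2 * (norm r)\<^sup>2 + 2 * (norm p)\<^sup>2) / \<delta>\<^sup>2 \<le> (4 + (2 + 2 * (norm r)\<^sup>2 + 2 * A\<^sup>2) / \<delta>\<^sup>2) * E\<^sup>2"
      using E2 by (simp add: distrib_right)
    have "kernel_const \<delta> r p \<le> ((A + norm r) * E) * ((4 + (2 + 2 * (norm r)\<^sup>2 + 2 * A\<^sup>2) / \<delta>\<^sup>2) * E\<^sup>2)"
      unfolding kernel_const_def using A E by (intro mult_mono 1 2) (auto intro!: mult_nonneg_nonneg add_nonneg_nonneg)
    also have "\<dots> = C * E ^ 3" by (simp add: C_def power2_eq_square power3_eq_cube mult_ac)
    also have "E ^ 3 = exp (3 * \<kappa> * \<bar>Im p\<bar>)" by (simp add: E_def exp_of_nat_mult[symmetric] mult_ac)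
    finally show ?thesis .
  qed
  with C show ?thesis using that by blast
qed

context qab
begin

text \<open>The integrand of the representation of the series at \<open>- \<tau>\<close>.\<close>

definition F :: "complex \<Rightarrow> complex \<Rightarrow> complex" where "F \<tau> s = Q s * \<tau> powr s"

lemma F_holomorphic: "\<tau> \<noteq> 0 \<Longrightarrow> A \<inter> (left_poles \<union> nat_poles) = {} \<Longrightarrow> F \<tau> holomorphic_on A"
  unfolding F_def[abs_def] by (intro holomorphic_intros Q_holomorphic) auto

lemma norm_powr_le:
  assumes "\<tau> \<noteq> 0" "\<bar>Re s\<bar> \<le> M"
  shows "norm (\<tau> powr s) \<le> (norm \<tau> powr M + norm \<tau> powr (- M)) * exp (\<bar>Arg \<tau>\<bar> * \<bar>Im s\<bar>)"
proof -
  have "norm (\<tau> powr s) = norm \<tau> powr Re s * exp (- Im s * Arg \<tau>)" by (rule norm_powr_complex)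
  also have "\<dots> \<le> (norm \<tau> powr M + norm \<tau> powr (- M)) * exp (\<bar>Arg \<tau>\<bar> * \<bar>Im s\<bar>)"
  proof (intro mult_mono)
    show "norm \<tau> powr Re s \<le> norm \<tau> powr M + norm \<tau> powr (- M)"
    proof (cases "norm \<tau> \<ge> 1")
      case True
      then have "norm \<tau> powr Re s \<le> norm \<tau> powr M" using assms by (intro powr_mono) auto
      then show ?thesis by (simp add: add_increasing2)
    next
      case False
      then have "norm \<tau> powr Re s \<le> norm \<tau> powr (- M)" using assms by (intro powr_mono') auto
      then show ?thesis by (simp add: add_increasing)
    qed
    have "- Im s * Arg \<tau> \<le> \<bar>Im s * Arg \<tau>\<bar>" by linarith
    then show "exp (- Im s * Arg \<tau>) \<le> exp (\<bar>Arg \<tau>\<bar> * \<bar>Im s\<bar>)" by (simp add: abs_mult mult.commute)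
  qed auto
  finally show ?thesis .
qed

lemma F_bound:
  assumes "\<eta> > 0" "\<tau> \<noteq> 0"
  obtains C where "C > 0" "\<And>s. l \<le> Re s \<Longrightarrow> Re s \<le> u \<Longrightarrow> (\<And>p. p \<in> left_poles \<union> nat_poles \<Longrightarrow> \<eta> \<le> norm (s - p)) \<Longrightarrow>
     norm (F \<tau> s) \<le> C * exp (- (pi - \<bar>Arg \<tau>\<bar>) * \<bar>Im s\<bar>)"
proof -
  obtain C where C: "C > 0" "\<And>s. l \<le> Re s \<Longrightarrow> Re s \<le> u \<Longrightarrow> (\<And>p. p \<in> left_poles \<union> nat_poles \<Longrightarrow> \<eta> \<le> norm (s - p)) \<Longrightarrow>
     norm (Q s) \<le> C * exp (- pi * \<bar>Im s\<bar>)" using Q_bound[OF assms(1), of l u] by blast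
  define M where "M = max \<bar>l\<bar> \<bar>u\<bar>"
  define W where "W = norm \<tau> powr M + norm \<tau> powr (- M)"
  have W: "W > 0" unfolding W_def using assms(2) by (intro add_pos_pos) auto
  have "norm (F \<tau> s) \<le> (C * W) * exp (- (pi - \<bar>Arg \<tau>\<bar>) * \<bar>Im s\<bar>)"
    if s: "l \<le> Re s" "Re s \<le> u" "\<And>p. p \<in> left_poles \<union> nat_poles \<Longrightarrow> \<eta> \<le> norm (s - p)" for s
  proof -
    have "norm (F \<tau> s) = norm (Q s) * norm (\<tau> powr s)" by (simp add: F_def norm_mult)
    also have "\<dots> \<le> (C * exp (- pi * \<bar>Im s\<bar>)) * (W * exp (\<bar>Arg \<tau>\<bar> * \<bar>Im s\<bar>))"
      unfolding W_def using s C by (intro mult_mono norm_powr_le assms(2)) (auto simp: M_def)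
    also have "\<dots> = (C * W) * exp (- (pi - \<bar>Arg \<tau>\<bar>) * \<bar>Im s\<bar>)"
      by (simp add: exp_add[symmetric] algebra_simps)
    finally show ?thesis .
  qed
  with C(1) W show ?thesis using that[of "C * W"] by simp
qed

text \<open>A circle around the pole whose radius is independent of the pole keeps a fixed distance to all poles. Hence the
  bound of the integrand on the circle is a bound of the residue. The condition on \<open>Im p\<close> keeps the circle
  away from the poles at the natural numbers.\<close>

lemma residue_F_decay:
  assumes "\<tau> \<noteq> 0"
  obtains C where "C > 0" "\<And>p. p \<in> left_poles \<Longrightarrow> l \<le> Re p \<Longrightarrow> Re p \<le> u \<Longrightarrow> 2 \<le> \<bar>Im p\<bar> \<Longrightarrow>
     norm (residue (F \<tau>) p) \<le> C * exp (- (pi - \<bar>Arg \<tau>\<bar>) * \<bar>Im p\<bar>)"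
proof -
  define \<beta> where "\<beta> = pi - \<bar>Arg \<tau>\<bar>"
  have \<beta>: "\<beta> \<ge> 0" using Arg_bounded[of \<tau>] by (simp add: \<beta>_def abs_le_iff)
  obtain e where e: "e > 0" "\<And>p p'. p \<in> left_poles \<Longrightarrow> p' \<in> left_poles \<Longrightarrow> p \<noteq> p' \<Longrightarrow> e \<le> norm (p - p')"
    using poles_separated by blast
  define \<epsilon> where "\<epsilon> = min (e / 2) (1 / 2)"
  have \<epsilon>: "\<epsilon> > 0" "\<epsilon> \<le> 1/2" "2 * \<epsilon> \<le> e" using e(1) by (auto simp: \<epsilon>_def)
  obtain C where C: "C > 0" "\<And>s. l - 1 \<le> Re s \<Longrightarrow> Re s \<le> u + 1 \<Longrightarrow> (\<And>p. p \<in> left_poles \<union> nat_poles \<Longrightarrow> \<epsilon> \<le> norm (s - p)) \<Longrightarrow>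
     norm (F \<tau> s) \<le> C * exp (- \<beta> * \<bar>Im s\<bar>)"
    unfolding \<beta>_def using F_bound[OF \<epsilon>(1) assms, of "l - 1" "u + 1"] by blast
  have "norm (residue (F \<tau>) p) \<le> (C * exp \<beta>) * exp (- \<beta> * \<bar>Im p\<bar>)"
    if p: "p \<in> left_poles" "l \<le> Re p" "Re p \<le> u" "2 \<le> \<bar>Im p\<bar>" for p
  proof -
    have far: "\<epsilon> \<le> norm (s - p')" if s: "norm (s - p) \<le> \<epsilon>" and p': "p' \<in> left_poles \<union> nat_poles" "p' \<noteq> p" for s p'
    proof (cases "p' \<in> left_poles")
      case True
      have "e \<le> norm (p - p')" using e(2) p(1) p' True by auto
      also have "\<dots> \<le> norm (s - p') + norm (s - p)"
        using norm_triangle_ineq4[of "s - p'" "s - p"] by simp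
      finally show ?thesis using s \<epsilon> by simp
    next
      case False
      then obtain k where "p' = of_nat k" using p' by (auto simp: nat_poles_def)
      then have "\<bar>Im s\<bar> \<le> norm (s - p')" using abs_Im_le_cmod[of "s - p'"] by simp
      moreover have "\<bar>Im p\<bar> - \<bar>Im s\<bar> \<le> norm (s - p)" using abs_Im_le_cmod[of "s - p"] by simp
      ultimately show ?thesis using s \<epsilon> p by simp
    qed
    have holo: "F \<tau> holomorphic_on ball p (2 * \<epsilon>) - {p}"
    proof (rule F_holomorphic[OF assms])
      show "(ball p (2 * \<epsilon>) - {p}) \<inter> (left_poles \<union> nat_poles) = {}"
      proof (rule ccontr)
        assume "(ball p (2 * \<epsilon>) - {p}) \<inter> (left_poles \<union> nat_poles) \<noteq> {}"
        then obtain p' where p': "p' \<in> left_poles \<union> nat_poles" "p' \<noteq> p" "p' \<in> ball p (2 * \<epsilon>)" by blast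
        then have "norm (p' - p) < 2 * \<epsilon>" by (simp add: dist_norm norm_minus_commute)
        define s where "s = (p + p') / 2"
        have "s - p = (p' - p) / 2" "s - p' = - ((p' - p) / 2)" by (simp_all add: s_def field_simps)
        then have "norm (s - p) < \<epsilon>" "norm (s - p') < \<epsilon>"
          using \<open>norm (p' - p) < 2 * \<epsilon>\<close> by (simp_all only: norm_minus_cancel norm_divide) simp_all
        with far[OF _ p'(1,2), of s] show False by simp
      qed
    qed
    have "(F \<tau> has_contour_integral 2 * pi * \<i> * residue (F \<tau>) p) (circlepath p \<epsilon>)"
      using \<epsilon> holo by (intro base_residue[of "ball p (2 * \<epsilon>)"]) auto
    then have "norm (2 * pi * \<i> * residue (F \<tau>) p) \<le> (C * exp \<beta> * exp (- \<beta> * \<bar>Im p\<bar>)) * (2 * pi * \<epsilon>)"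
    proof (rule has_contour_integral_bound_circlepath)
      show "0 \<le> C * exp \<beta> * exp (- \<beta> * \<bar>Im p\<bar>)" using C(1) by simp
      fix s assume s: "norm (s - p) = \<epsilon>"
      have "\<bar>Re s - Re p\<bar> \<le> \<epsilon>" "\<bar>Im s - Im p\<bar> \<le> \<epsilon>"
        using abs_Re_le_cmod[of "s - p"] abs_Im_le_cmod[of "s - p"] s by auto
      then have "norm (F \<tau> s) \<le> C * exp (- \<beta> * \<bar>Im s\<bar>)"
      proof (intro C(2))
        show "l - 1 \<le> Re s" "Re s \<le> u + 1" using \<open>\<bar>Re s - Re p\<bar> \<le> \<epsilon>\<close> p \<epsilon> by linarith+
        show "\<epsilon> \<le> norm (s - p')" if "p' \<in> left_poles \<union> nat_poles" for p'
          using far[OF _ that] s by (cases "p' = p") auto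
      qed
      also have "\<dots> \<le> C * exp (\<beta> + - \<beta> * \<bar>Im p\<bar>)"
      proof -
        have "\<bar>Im p\<bar> \<le> 1 + \<bar>Im s\<bar>" using \<open>\<bar>Im s - Im p\<bar> \<le> \<epsilon>\<close> \<epsilon> by linarith
        from mult_left_mono[OF this \<beta>] show ?thesis using C(1) by (simp add: algebra_simps)
      qed
      finally show "norm (F \<tau> s) \<le> C * exp \<beta> * exp (- \<beta> * \<bar>Im p\<bar>)" unfolding exp_add by (simp only: mult.assoc)
    qed (use \<epsilon> in auto)
    then have "(2 * pi) * norm (residue (F \<tau>) p) \<le> (2 * pi) * (C * exp \<beta> * exp (- \<beta> * \<bar>Im p\<bar>) * \<epsilon>)"
      by (simp add: norm_mult mult_ac)
    then have "norm (residue (F \<tau>) p) \<le> C * exp \<beta> * exp (- \<beta> * \<bar>Im p\<bar>) * \<epsilon>"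
      by (simp only: mult_le_cancel_left_pos pi_gt_zero zero_less_mult_iff zero_less_numeral simp_thms)
    also have "\<dots> \<le> C * exp \<beta> * exp (- \<beta> * \<bar>Im p\<bar>) * 1" using \<epsilon> C(1) by (intro mult_left_mono) auto
    finally show ?thesis by simp
  qed
  with C(1) show ?thesis using that[of "C * exp \<beta>"] unfolding \<beta>_def by simp
qed

lemma residue_F_nat:
  assumes \<tau>: "\<tau> \<noteq> 0" and dis: "left_poles \<inter> nat_poles = {}"
  shows "residue (F \<tau>) (of_nat k) = qpoch_inf q (qp q (1 + of_nat k)) / den (of_nat k) * (- \<tau>) ^ k"
proof -
  define z :: complex where "z = of_nat k"
  have zN: "z \<in> nat_poles" by (simp add: z_def nat_poles_def)
  then have zL: "z \<notin> left_poles" using dis by auto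
  have "open (- left_poles)" 
  proof -
    have "- left_poles = {s. den s \<noteq> 0}" using den_eq_0_iff by auto
    moreover have "open {s. den s \<noteq> 0}" by (intro open_Collect_neq den_continuous continuous_intros)
    ultimately show ?thesis by simp
  qed
  define S where "S = ball z 1 \<inter> - left_poles"
  have S: "open S" "z \<in> S" using \<open>open (- left_poles)\<close> zL by (auto simp: S_def)
  have noint: "s \<noteq> of_int j" if "s \<in> ball z 1 - {z}" for s and j :: int
  proof
    assume "s = of_int j"
    then have "norm (of_int (int k - j) :: complex) < 1" "int k - j \<noteq> 0"
      using that by (auto simp: dist_norm z_def)
    then show False by (simp only: norm_of_int)
  qed
  have holo: "F \<tau> holomorphic_on S - {z}"
  proof (rule F_holomorphic[OF \<tau>])
    have "s \<notin> nat_poles" if "s \<in> ball z 1 - {z}" for s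
      using noint[OF that, of "int _"] by (auto simp: nat_poles_def)
    then show "(S - {z}) \<inter> (left_poles \<union> nat_poles) = {}" unfolding S_def by blast
  qed
  have ev: "\<forall>\<^sub>F s in at z. F \<tau> s * (s - z) = of_real pi * qpoch_inf q (qp q (1 + s)) / den s * \<tau> powr s / (sin (of_real pi * s) / (s - z))"
  proof -
    have "\<forall>\<^sub>F s in at z. s \<in> ball z 1 - {z}" by (rule eventually_at_in_open) auto
    then show ?thesis
    proof eventually_elim
      case (elim s)
      then have "numer s = raw_numer s" using noint by (intro numer_eq) auto
      then show ?case using elim by (simp add: F_def Q_def raw_numer_def)
    qed
  qed
  have c: "isCont (\<lambda>s. of_real pi * qpoch_inf q (qp q (1 + s)) / den s * \<tau> powr s) z"
  proof -
    have "(\<lambda>s. of_real pi * qpoch_inf q (qp q (1 + s)) / den s * \<tau> powr s) holomorphic_on S"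
      using \<tau> by (intro holomorphic_intros q0 q1) (auto simp: S_def den_eq_0_iff)
    from holomorphic_on_imp_continuous_on[OF this] show ?thesis
      using S(2) unfolding continuous_on_eq_continuous_at[OF S(1)] by (rule bspec)
  qed
  have lim: "((\<lambda>s. of_real pi * qpoch_inf q (qp q (1 + s)) / den s * \<tau> powr s / (sin (of_real pi * s) / (s - z))) \<longlongrightarrow>
     of_real pi * qpoch_inf q (qp q (1 + z)) / den z * \<tau> powr z / (of_real pi * cos (of_real pi * z))) (at z)"
    using sin_pi_quotient_limit[of "int k"] cos_pi_int(1)[of "int k"]
    by (intro tendsto_divide isContD[OF c]) (auto simp: z_def)
  have "residue (F \<tau>) z = of_real pi * qpoch_inf q (qp q (1 + z)) / den z * \<tau> powr z / (of_real pi * cos (of_real pi * z))"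
    by (rule residue_simple'[OF S holo]) (subst tendsto_cong[OF ev], rule lim)
  also have "\<dots> = qpoch_inf q (qp q (1 + z)) / den z * (\<tau> ^ k / (-1) ^ k)"
    using \<tau> by (simp add: z_def cos_pi_int(2) powr_nat)
  also have "\<tau> ^ k / (-1) ^ k = (- \<tau>) ^ k" by (simp add: power_divide[symmetric])
  finally show ?thesis by (simp add: z_def)
qed

end

lemma half_int_dist: "1/2 \<le> \<bar>real N + 1/2 - real k\<bar>"
proof -
  have "real k \<le> real N \<or> real k \<ge> real N + 1" by (metis of_nat_Suc of_nat_le_iff not_less_eq_eq add.commute)
  then show ?thesis by linarith
qed

context mb
begin

text \<open>The line at \<open>N + 1/2\<close> lies between the poles \<open>N\<close> and \<open>N + 1\<close> and to the right of both lattices. The path is truncated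
  at the heights \<open>h0 \<plusminus> (n + M0) per\<close>, at a fixed distance from the lattices.\<close>

lemma shift_to_line:
  assumes \<tau>: "\<tau> \<noteq> 0" "\<bar>Arg \<tau>\<bar> < pi"
    and N: "real N \<ge> R + 1" "real N \<ge> max (Re za) (Re zb) + 1"
  shows "curve_integral \<gamma> (F \<tau>) - (\<integral>y. F \<tau> (Complex (real N + 1/2) y) * \<i> \<partial>lborel)
    = - (2 * pi * \<i>) * (\<Sum>k\<le>N. residue (F \<tau>) (of_nat k))"
proof -
  define \<beta> where "\<beta> = pi - \<bar>Arg \<tau>\<bar>"
  have \<beta>: "\<beta> > 0" using \<tau>(2) by (simp add: \<beta>_def)
  define c where "c = real N + 1/2"
  have c: "c > R" using N by (simp add: c_def)
  obtain h0 where h0: "\<And>p n. p \<in> left_poles \<Longrightarrow> per / 4 \<le> \<bar>Im p - (h0 + of_int n * per)\<bar>"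
    using free_height by blast
  \<comment> \<open>\<open>M0\<close> periods lift the edges so far that they avoid the real axis and that the upper edge starts after the
    lower one, in height and in the parameter of the contour.\<close>
  define M0 where "M0 = nat \<lceil>(R + \<bar>h0\<bar> + 2) / per\<rceil>"
  have "(R + \<bar>h0\<bar> + 2) / per \<le> real M0" unfolding M0_def by linarith
  then have M0: "R + \<bar>h0\<bar> + 2 \<le> real M0 * per" using per_pos by (simp add: pos_divide_le_eq)
  have big: "R + \<bar>h0\<bar> + 2 \<le> real (n + M0) * per" for n
  proof -
    have "real M0 * per \<le> real (n + M0) * per" using per_pos by (intro mult_right_mono) auto
    with M0 show ?thesis by linarith
  qed
  have "\<exists>t. Im (\<gamma> t) = h0 + real (n + M0) * per \<and> \<bar>t - (h0 + real (n + M0) * per)\<bar> \<le> R" for n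
    by (rule height_reached)
  then obtain t2 where t2: "\<And>n. Im (\<gamma> (t2 n)) = h0 + real (n + M0) * per" "\<And>n. \<bar>t2 n - (h0 + real (n + M0) * per)\<bar> \<le> R"
    by metis
  have "\<exists>t. Im (\<gamma> t) = h0 - real (n + M0) * per \<and> \<bar>t - (h0 - real (n + M0) * per)\<bar> \<le> R" for n
    by (rule height_reached)
  then obtain t1 where t1: "\<And>n. Im (\<gamma> (t1 n)) = h0 - real (n + M0) * per" "\<And>n. \<bar>t1 n - (h0 - real (n + M0) * per)\<bar> \<le> R"
    by metis
  define \<delta> where "\<delta> = min (min \<delta>0 (1/2)) (per / 4)"
  have \<delta>: "0 < \<delta>" "\<delta> \<le> 1" "\<delta> \<le> \<delta>0" "\<delta> \<le> 1/2" "\<delta> \<le> per / 4" using gap0(1) per_pos by (auto simp: \<delta>_def)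
  define D where "D = range \<gamma> \<union> {s. Re s = c} \<union> (\<Union>n. edge c (t1 n) \<union> edge c (t2 n))"
  have far: "\<delta> \<le> norm (s - p)" if s: "s \<in> D" and p: "p \<in> left_poles \<union> nat_poles" for s p
  proof -
    have height: "\<delta> \<le> norm (s - p)"
      if "Im s = h0 + of_int j * per" "2 \<le> \<bar>Im s\<bar>" for j :: int
    proof (cases "p \<in> left_poles")
      case True
      have "per / 4 \<le> \<bar>Im (s - p)\<bar>" using h0[OF True, of j] that(1) by (simp add: abs_minus_commute)
      then show ?thesis using \<delta>(5) abs_Im_le_cmod[of "s - p"] by linarith
    next
      case False
      then have "Im p = 0" using p by (auto simp: nat_poles_def)
      then have "2 \<le> \<bar>Im (s - p)\<bar>" using that(2) by simp
      then show ?thesis using \<delta>(2) abs_Im_le_cmod[of "s - p"] by linarith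
    qed
    consider t where "s = \<gamma> t" | "Re s = c" | n where "s \<in> edge c (t1 n)" | n where "s \<in> edge c (t2 n)"
      using s unfolding D_def by blast
    then show ?thesis
    proof cases
      case 1
      then show ?thesis using gap0(2)[OF p, of t] \<delta>(3) by simp
    next
      case 2
      have "1/2 \<le> \<bar>Re (s - p)\<bar>"
      proof (cases "p \<in> left_poles")
        case True
        then show ?thesis using Re_left_poles[OF True] N(2) 2 by (simp add: c_def)
      next
        case False
        then obtain k where "p = of_nat k" using p by (auto simp: nat_poles_def)
        then show ?thesis using half_int_dist[of N k] 2 by (simp add: c_def)
      qed
      then show ?thesis using \<delta>(4) abs_Re_le_cmod[of "s - p"] by linarith
    next
      case (3 n)
      then have e: "Im s = h0 - real (n + M0) * per" using Im_edge t1(1) by simp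
      have "2 \<le> \<bar>Im s\<bar>" unfolding e using big[of n] R_nonneg by linarith
      then show ?thesis by (intro height[of "- int (n + M0)"]) (simp_all add: e algebra_simps)
    next
      case (4 n)
      then have e: "Im s = h0 + real (n + M0) * per" using Im_edge t2(1) by simp
      have "2 \<le> \<bar>Im s\<bar>" unfolding e using big[of n] R_nonneg by linarith
      then show ?thesis by (intro height[of "int (n + M0)"]) (simp_all add: e)
    qed
  qed
  have ReD: "- R \<le> Re s \<and> Re s \<le> c" if "s \<in> D" for s
    using Re_closed_contour[OF c that[unfolded D_def]] by simp
  obtain C where C: "C > 0" "\<And>s. - R \<le> Re s \<Longrightarrow> Re s \<le> c \<Longrightarrow> (\<And>p. p \<in> left_poles \<union> nat_poles \<Longrightarrow> \<delta> \<le> norm (s - p)) \<Longrightarrow>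
     norm (F \<tau> s) \<le> C * exp (- \<beta> * \<bar>Im s\<bar>)"
    unfolding \<beta>_def using F_bound[OF \<delta>(1) \<tau>(1), of "- R" c] by blast
  define C' where "C' = C * (1 + 2 / \<beta>\<^sup>2)"
  have decay: "norm (F \<tau> s) \<le> C' / (1 + (Im s)\<^sup>2)" if "s \<in> D" for s
  proof -
    have "norm (F \<tau> s) \<le> C * exp (- \<beta> * \<bar>Im s\<bar>)" using ReD[OF that] far[OF that] by (intro C(2)) auto
    also have "\<dots> \<le> C * ((1 + 2 / \<beta>\<^sup>2) / (1 + (Im s)\<^sup>2))"
      using C(1) exp_decay_quadratic[OF \<beta>] by (intro mult_left_mono) auto
    finally show ?thesis by (simp add: C'_def)
  qed
  define S where "S = {s. - R - 2 < Re s \<and> Re s < c + 1/4}"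
  define P where "P = (left_poles \<union> nat_poles) \<inter> S"
  have Pc: "Re p < c" if pP: "p \<in> P" for p
  proof (cases "p \<in> left_poles")
    case True
    then show ?thesis using Re_left_poles[OF True] N(2) by (simp add: c_def)
  next
    case False
    then obtain k where k: "p = of_nat k" using pP by (auto simp: P_def nat_poles_def)
    then have "real k < real N + 3/4" using pP by (simp add: P_def S_def c_def)
    then have "k \<le> N" by linarith
    then show ?thesis by (simp add: k c_def)
  qed
  define M where "M = R + 2 + \<bar>c\<bar> + 1"
  have ReP: "\<bar>Re p\<bar> \<le> M" if "p \<in> P" for p using that R_nonneg by (auto simp: P_def S_def M_def)
  have finP: "finite {p \<in> P. \<bar>Im p\<bar> < T}" for T
  proof (rule finite_subset[OF _ finite_poles[of "M + T"]])
    show "{p \<in> P. \<bar>Im p\<bar> < T} \<subseteq> {p \<in> left_poles \<union> nat_poles. norm p < M + T}"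
    proof
      fix p assume p: "p \<in> {p \<in> P. \<bar>Im p\<bar> < T}"
      then have "norm p < M + T" using ReP[of p] cmod_le[of p] by auto
      then show "p \<in> {p \<in> left_poles \<union> nat_poles. norm p < M + T}" using p by (auto simp: P_def)
    qed
  qed
  have summ: "integrable (count_space P) (\<lambda>p. norm (residue (F \<tau>) p) * kernel_const \<delta> (of_real (- R - 1)) p)"
  proof -
    define f where "f p = norm (residue (F \<tau>) p) * kernel_const \<delta> (of_real (- R - 1)) p" for p
    have f0: "f p \<ge> 0" for p using kernel_const_nonneg[OF \<delta>(1)] by (simp add: f_def)
    define P1 where "P1 = {p \<in> P. p \<in> left_poles \<and> 2 \<le> \<bar>Im p\<bar>}"
    obtain C1 where C1: "C1 > 0" "\<And>p. p \<in> left_poles \<Longrightarrow> - M \<le> Re p \<Longrightarrow> Re p \<le> M \<Longrightarrow> 2 \<le> \<bar>Im p\<bar> \<Longrightarrow>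
      norm (residue (F \<tau>) p) \<le> C1 * exp (- \<beta> * \<bar>Im p\<bar>)"
      unfolding \<beta>_def using residue_F_decay[OF \<tau>(1), of "- M" M] by blast
    \<comment> \<open>The growth of the constant uses up half of the exponential decay \<open>\<beta>\<close> of the residues: \<open>3 (\<beta> / 6) = \<beta> / 2\<close>.\<close>
    obtain C2 where C2: "C2 > 0" "\<And>p. \<bar>Re p\<bar> \<le> M \<Longrightarrow> kernel_const \<delta> (of_real (- R - 1)) p \<le> C2 * exp (3 * (\<beta> / 6) * \<bar>Im p\<bar>)"
      using kernel_const_growth[of "\<beta> / 6" \<delta> M "of_real (- R - 1)"] \<beta> \<delta>(1) by (metis divide_pos_pos zero_less_numeral)
    have "f summable_on P1"
    proof (rule summable_on_comparison_test)
      have "(\<lambda>p. exp (- (\<beta> / 2) * \<bar>Im p\<bar>)) summable_on P1"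
        by (rule summable_on_subset_banach[OF summable_poles[of "\<beta> / 2" "- R - 2" "c + 1/4"]])
           (use \<beta> in \<open>auto simp: P1_def P_def S_def\<close>)
      then show "(\<lambda>p. (C1 * C2) * exp (- (\<beta> / 2) * \<bar>Im p\<bar>)) summable_on P1"
        by (rule summable_on_cmult_right)
      fix p assume p: "p \<in> P1"
      then have "\<bar>Re p\<bar> \<le> M" using ReP by (auto simp: P1_def)
      then have "f p \<le> (C1 * exp (- \<beta> * \<bar>Im p\<bar>)) * (C2 * exp (3 * (\<beta> / 6) * \<bar>Im p\<bar>))"
        unfolding f_def using p C1 C2 kernel_const_nonneg[OF \<delta>(1)]
        by (intro mult_mono) (auto simp: P1_def abs_le_iff)
      also have "\<dots> = (C1 * C2) * exp (- \<beta> * \<bar>Im p\<bar> + 3 * (\<beta> / 6) * \<bar>Im p\<bar>)" by (simp only: exp_add mult_ac)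
      also have "- \<beta> * \<bar>Im p\<bar> + 3 * (\<beta> / 6) * \<bar>Im p\<bar> = - (\<beta> / 2) * \<bar>Im p\<bar>" by (simp add: field_simps)
      finally show "f p \<le> (C1 * C2) * exp (- (\<beta> / 2) * \<bar>Im p\<bar>)" .
    qed (rule f0)
    moreover have "finite (P - P1)"
    proof (rule finite_subset[OF _ finP[of 2]])
      show "P - P1 \<subseteq> {p \<in> P. \<bar>Im p\<bar> < 2}" by (auto simp: P1_def P_def nat_poles_def)
    qed
    then have "f summable_on (P - P1)" by (rule summable_on_finite)
    ultimately have "f summable_on (P1 \<union> (P - P1))" by (intro summable_on_Un_disjoint) auto
    moreover have "P1 \<union> (P - P1) = P" by (auto simp: P1_def)
    ultimately have "f summable_on P" by simp
    then have "(\<lambda>p. norm (f p)) summable_on P" using f0 by simp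
    then have "Infinite_Set_Sum.abs_summable_on f P" by (simp only: abs_summable_equivalent)
    then show ?thesis unfolding Infinite_Set_Sum.abs_summable_on_def f_def[abs_def] .
  qed
  have Rc: "real k < c + 1/4 \<longleftrightarrow> k \<le> N" for k
  proof -
    have "real k < real N + 3/4 \<longleftrightarrow> k \<le> N" by linarith
    then show ?thesis by (simp add: c_def add.commute)
  qed
  have QP: "of_nat ` {..N} \<subseteq> P" "P - of_nat ` {..N} \<subseteq> left_poles"
    using Rc R_nonneg by (auto simp: P_def S_def nat_poles_def)
  have lims: "filterlim t1 at_bot sequentially" "filterlim t2 at_top sequentially"
  proof -
    have *: "filterlim (\<lambda>n. K' + real n * per) at_top sequentially" for K'
      using per_pos by real_asymp
    show "filterlim t2 at_top sequentially"
    proof (rule filterlim_at_top_mono[OF *])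
      have "(h0 + real M0 * per - R) + real n * per \<le> t2 n" for n
        using t2(2)[of n] by (simp add: algebra_simps abs_le_iff)
      then show "\<forall>\<^sub>F n in sequentially. (h0 + real M0 * per - R) + real n * per \<le> t2 n" by simp
    qed
    show "filterlim t1 at_bot sequentially"
      unfolding filterlim_uminus_at_bot
    proof (rule filterlim_at_top_mono[OF *])
      have "(- h0 + real M0 * per - R) + real n * per \<le> - t1 n" for n
        using t1(2)[of n] by (simp add: algebra_simps abs_le_iff)
      then show "\<forall>\<^sub>F n in sequentially. (- h0 + real M0 * per - R) + real n * per \<le> - t1 n" by simp
    qed
  qed
  have "curve_integral \<gamma> (F \<tau>) - (\<integral>y. F \<tau> (Complex c y) * \<i> \<partial>lborel)
    = - (2 * pi * \<i>) * (\<Sum>p\<in>of_nat ` {..N}. residue (F \<tau>) p)"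
  proof (rule residues_between_contours[where ?t1.0=t1 and ?t2.0=t2 and c=c and P=P and \<delta>=\<delta> and f="F \<tau>" and C=C' and Q="of_nat ` {..N}", folded S_def D_def])
    show "t1 n < t2 n" for n
      using t1(2)[of n] t2(2)[of n] big[of n] R_nonneg by (simp only: abs_le_iff) linarith
    show "Im (\<gamma> (t1 n)) < Im (\<gamma> (t2 n))" for n
      using big[of n] R_nonneg unfolding t1(1) t2(1) by linarith
    show "F \<tau> holomorphic_on S - P" by (rule F_holomorphic[OF \<tau>(1)]) (auto simp: P_def)
    show "\<delta> \<le> norm (s - p)" if "s \<in> D" "p \<in> P" for s p using far[OF that(1)] that(2) by (auto simp: P_def)
    show "C' \<ge> 0" using C(1) by (simp add: C'_def)
    show "curve_integral \<gamma> (\<lambda>s. 1 / (s - p) - 1 / (s - of_real (- R - 1))) = - (2 * pi * \<i>)" if "p \<in> of_nat ` {..N}" for p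
      by (rule curve_integral_right) (use that in \<open>auto simp: nat_poles_def\<close>)
    show "curve_integral \<gamma> (\<lambda>s. 1 / (s - p) - 1 / (s - of_real (- R - 1))) = 0" if "p \<in> P - of_nat ` {..N}" for p
      by (rule curve_integral_left) (use that QP in blast)
  qed (use lims c finP Pc \<delta> decay summ QP in \<open>auto simp: P_def\<close>)
  also have "(\<Sum>p\<in>of_nat ` {..N}. residue (F \<tau>) p) = (\<Sum>k\<le>N. residue (F \<tau>) (of_nat k))"
    by (subst sum.reindex) (auto simp: inj_on_def)
  finally show ?thesis by (simp only: c_def)
qed

text \<open>On the line \<open>Re s = N + 1/2\<close> the sine is a hyperbolic cosine up to sign, the numerator and the
  reciprocals of the two products in the denominator are bounded uniformly in large \<open>N\<close>, and \<open>\<tau> powr s\<close> contributes the factor \<open>\<bar>\<tau>\<bar> powr (N + 1/2)\<close>.\<close>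

lemma line_integral_tendsto_0:
  assumes \<tau>: "\<tau> \<noteq> 0" "\<bar>Arg \<tau>\<bar> < pi" "norm \<tau> < 1"
  shows "(\<lambda>N. \<integral>y. F \<tau> (Complex (real N + 1/2) y) * \<i> \<partial>lborel) \<longlonglongrightarrow> 0"
proof -
  define \<beta> where "\<beta> = pi - \<bar>Arg \<tau>\<bar>"
  have \<beta>: "\<beta> > 0" using \<tau>(2) by (simp add: \<beta>_def)
  have bdd: "\<exists>C>0. \<forall>w. norm w \<le> 1/2 \<longrightarrow> norm (1 / qpoch_inf q w) \<le> C"
  proof -
    have "qpoch_inf q w \<noteq> 0" if "norm w \<le> 1/2" for w
    proof
      assume "qpoch_inf q w = 0"
      then obtain k where "norm (w * of_real q ^ k) = 1" using qpoch_inf_eq_0_iff[OF q0 q1] by (metis norm_one)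
      moreover have "norm (w * of_real q ^ k) \<le> norm w * 1"
        unfolding norm_mult using q0 q1 by (intro mult_left_mono) (auto simp: norm_power power_le_one)
      ultimately show False using that by simp
    qed
    then have "bounded ((\<lambda>w. 1 / qpoch_inf q w) ` cball 0 (1/2))"
      by (intro compact_imp_bounded compact_continuous_image continuous_intros q0 q1) auto
    then show ?thesis unfolding bounded_pos by auto
  qed
  then obtain C1 where C1: "C1 > 0" "\<And>w. norm w \<le> 1/2 \<Longrightarrow> norm (1 / qpoch_inf q w) \<le> C1" by blast
  have "bounded (qpoch_inf q ` cball 0 1)"
    by (intro compact_imp_bounded compact_continuous_image continuous_intros q0 q1) auto
  then obtain C2 where C2: "C2 > 0" "\<And>w. norm w \<le> 1 \<Longrightarrow> norm (qpoch_inf q w) \<le> C2"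
    unfolding bounded_pos by auto
  define C3 where "C3 = pi * C2 * 2 * C1 * C1"
  have qlim: "(\<lambda>N. (norm a + norm b) * q ^ N) \<longlonglongrightarrow> (norm a + norm b) * 0"
    using q0 q1 by (intro tendsto_intros LIMSEQ_realpow_zero) auto
  then have "\<forall>\<^sub>F N in sequentially. (norm a + norm b) * q ^ N < 1/2" by (intro order_tendstoD(2)) auto
  then have ev: "\<forall>\<^sub>F N in sequentially. norm (\<integral>y. F \<tau> (Complex (real N + 1/2) y) * \<i> \<partial>lborel) \<le>
     norm \<tau> powr (real N + 1/2) * (C3 * (1 + 2 / \<beta>\<^sup>2) * I0)"
  proof eventually_elim
    case (elim N)
    define s where "s y = Complex (real N + 1/2) y" for y
    have bnd: "norm (F \<tau> (s y) * \<i>) \<le> norm \<tau> powr (real N + 1/2) * (C3 * (1 + 2 / \<beta>\<^sup>2)) * (1 / (1 + y\<^sup>2))" for y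
    proof -
      have noint: "s y \<noteq> of_int k" for k :: int
      proof
        assume "s y = of_int k"
        then have "real_of_int k = real N + 1/2" by (simp add: s_def complex_eq_iff)
        then have "real_of_int (2 * k) = real_of_int (2 * int N + 1)" by simp
        then have "2 * k = 2 * int N + 1" using of_int_eq_iff by blast
        then show False by presburger
      qed
      have qN: "q powr (real N + 1/2) \<le> q ^ N"
        using q0 q1 powr_mono'[of "real N" "real N + 1/2" q] by (simp add: powr_realpow)
      have small: "norm (x * qp q (s y)) \<le> 1/2" if "norm x \<le> norm a + norm b" for x
      proof -
        have "norm (x * qp q (s y)) \<le> (norm a + norm b) * q ^ N"
          unfolding norm_mult norm_qp using that qN by (intro mult_mono) (auto simp: s_def)
        with elim show ?thesis by simp
      qed
      have d: "norm (1 / den (s y)) \<le> C1 * C1"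
      proof -
        have "norm (1 / den (s y)) = norm (1 / qpoch_inf q (a * qp q (s y))) * norm (1 / qpoch_inf q (b * qp q (s y)))"
          by (simp add: den_def norm_mult norm_divide)
        also have "\<dots> \<le> C1 * C1" using C1 by (intro mult_mono C1(2) small) auto
        finally show ?thesis .
      qed
      have sin: "exp (pi * \<bar>y\<bar>) / 2 \<le> norm (sin (of_real pi * s y))"
      proof -
        have e: "of_real pi * s y = of_nat N * of_real pi + (of_real pi / 2 + \<i> * of_real (pi * y))"
          by (simp add: s_def Complex_eq algebra_simps)
        have "sin (of_nat N * of_real pi :: complex) = 0"
          using sin_pi_eq_0_iff[of "of_nat N"] by (auto simp: mult.commute intro: exI[of _ "int N"])
        moreover have "norm (cos (of_nat N * of_real pi :: complex)) = 1"
          using cos_pi_int(2)[of N] by (simp add: mult.commute norm_power)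
        ultimately have "norm (sin (of_real pi * s y)) = norm (sin (of_real pi / 2 + \<i> * of_real (pi * y)))"
          unfolding e sin_add[of "of_nat N * of_real pi"] by (simp add: norm_mult)
        also have "sin (of_real pi / 2 + \<i> * of_real (pi * y)) = cos (\<i> * of_real (pi * y))"
          by (metis add.commute add_diff_cancel_right' cos_sin_eq diff_minus_eq_add cos_minus)
        also have "\<dots> = of_real ((exp (pi * y) + exp (- (pi * y))) / 2)"
          by (simp add: cos_exp_eq exp_of_real[symmetric] mult.assoc[symmetric] add.commute)
        also have "norm (of_real ((exp (pi * y) + exp (- (pi * y))) / 2) :: complex) = (exp (pi * y) + exp (- (pi * y))) / 2"
          unfolding norm_of_real by (simp add: add_nonneg_nonneg)
        also have "\<dots> \<ge> exp (pi * \<bar>y\<bar>) / 2" by (cases "y \<ge> 0") auto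
        finally show ?thesis .
      qed
      have "norm (qp q (1 + s y)) \<le> 1"
        unfolding norm_qp using q0 q1 by (intro powr_le1) (auto simp: s_def)
      then have "norm (numer (s y)) \<le> pi * C2 / (exp (pi * \<bar>y\<bar>) / 2)"
        unfolding numer_eq[OF noint] raw_numer_def norm_divide norm_mult
        using C2 sin by (intro frac_le mult_mono) auto
      also have "\<dots> = pi * C2 * 2 * exp (- pi * \<bar>y\<bar>)" by (simp add: exp_minus field_simps)
      finally have "norm (Q (s y)) \<le> (pi * C2 * 2 * exp (- pi * \<bar>y\<bar>)) * (C1 * C1)"
        using d C2 unfolding Q_def divide_inverse norm_mult by (intro mult_mono) (auto simp: divide_inverse)
      moreover have "norm (\<tau> powr s y) \<le> norm \<tau> powr (real N + 1/2) * exp (\<bar>Arg \<tau>\<bar> * \<bar>y\<bar>)"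
      proof -
        have "- y * Arg \<tau> \<le> \<bar>y * Arg \<tau>\<bar>" by linarith
        then show ?thesis unfolding norm_powr_complex
          by (intro mult_mono) (auto simp: s_def abs_mult mult.commute)
      qed
      ultimately have "norm (F \<tau> (s y)) \<le> ((pi * C2 * 2 * exp (- pi * \<bar>y\<bar>)) * (C1 * C1)) * (norm \<tau> powr (real N + 1/2) * exp (\<bar>Arg \<tau>\<bar> * \<bar>y\<bar>))"
        using C1 C2 unfolding F_def norm_mult by (intro mult_mono) auto
      also have "\<dots> = norm \<tau> powr (real N + 1/2) * C3 * exp (- pi * \<bar>y\<bar> + \<bar>Arg \<tau>\<bar> * \<bar>y\<bar>)"
        by (simp only: exp_add C3_def mult_ac)
      also have "- pi * \<bar>y\<bar> + \<bar>Arg \<tau>\<bar> * \<bar>y\<bar> = - \<beta> * \<bar>y\<bar>" by (simp add: \<beta>_def algebra_simps)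
      also have "norm \<tau> powr (real N + 1/2) * C3 * exp (- \<beta> * \<bar>y\<bar>) \<le> norm \<tau> powr (real N + 1/2) * C3 * ((1 + 2 / \<beta>\<^sup>2) / (1 + y\<^sup>2))"
        using C1 C2 by (intro mult_left_mono exp_decay_quadratic \<beta>) (auto simp: C3_def)
      finally show ?thesis by (simp add: norm_mult)
    qed
    have "norm (\<integral>y. F \<tau> (s y) * \<i> \<partial>lborel) \<le> (\<integral>y. norm \<tau> powr (real N + 1/2) * (C3 * (1 + 2 / \<beta>\<^sup>2)) * (1 / (1 + y\<^sup>2)) \<partial>lborel)"
    proof (cases "integrable lborel (\<lambda>y. F \<tau> (s y) * \<i>)")
      case True
      show ?thesis
      proof (rule order_trans[OF integral_norm_bound integral_mono])
        show "integrable lborel (\<lambda>y. norm (F \<tau> (s y) * \<i>))" using True by (rule integrable_norm)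
        show "integrable lborel (\<lambda>y. norm \<tau> powr (real N + 1/2) * (C3 * (1 + 2 / \<beta>\<^sup>2)) * (1 / (1 + y\<^sup>2)))"
          using integrable_mult_right[OF integrable_inverse_1_plus_sq[of 1]] by simp
      qed (rule bnd)
    next
      case False
      have "0 \<le> (\<integral>y. norm \<tau> powr (real N + 1/2) * (C3 * (1 + 2 / \<beta>\<^sup>2)) * (1 / (1 + y\<^sup>2)) \<partial>lborel)"
        using C1 C2 by (intro integral_nonneg_AE always_eventually allI mult_nonneg_nonneg) (auto simp: C3_def)
      then show ?thesis by (simp only: not_integrable_integral_eq[OF False] norm_zero)
    qed
    also have "\<dots> = norm \<tau> powr (real N + 1/2) * (C3 * (1 + 2 / \<beta>\<^sup>2)) * I0"
      unfolding I0_def by (simp only: integral_mult_right_zero)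
    finally show ?case by (simp add: s_def mult.assoc)
  qed
  have "((\<lambda>N. norm \<tau> powr (real N + 1/2)) \<longlonglongrightarrow> 0)"
    using \<tau> by real_asymp
  then have "(\<lambda>N. norm \<tau> powr (real N + 1/2) * (C3 * (1 + 2 / \<beta>\<^sup>2) * I0)) \<longlonglongrightarrow> 0"
    by (rule tendsto_mult_left_zero)
  from Lim_null_comparison[OF ev this] show ?thesis .
qed

text \<open>The terms of the series are the residues at the natural numbers.\<close>

theorem MB_series:
  assumes \<tau>: "\<tau> \<noteq> 0" "\<bar>Arg \<tau>\<bar> < pi" "norm \<tau> < 1"
  shows "(\<lambda>k. qpoch q a k * qpoch q b k / qpoch q (of_real q) k * (- \<tau>) ^ k) sums
    (- K0 q a b / (2 * of_real pi * \<i>) * curve_integral \<gamma> (F \<tau>))"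
proof -
  have "\<forall>\<^sub>F N in sequentially. real N \<ge> max (R + 1) (max (Re za) (Re zb) + 1)"
    using filterlim_real_sequentially unfolding filterlim_at_top by (rule spec)
  then have "\<forall>\<^sub>F N in sequentially. curve_integral \<gamma> (F \<tau>) - (\<integral>y. F \<tau> (Complex (real N + 1/2) y) * \<i> \<partial>lborel)
    = - (2 * pi * \<i>) * (\<Sum>k\<le>N. residue (F \<tau>) (of_nat k))"
    by eventually_elim (intro shift_to_line \<tau>; simp)
  moreover have "(\<lambda>N. curve_integral \<gamma> (F \<tau>) - (\<integral>y. F \<tau> (Complex (real N + 1/2) y) * \<i> \<partial>lborel)) \<longlonglongrightarrow> curve_integral \<gamma> (F \<tau>) - 0"
    by (intro tendsto_intros line_integral_tendsto_0 \<tau>)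
  ultimately have "(\<lambda>N. - (2 * pi * \<i>) * (\<Sum>k\<le>N. residue (F \<tau>) (of_nat k))) \<longlonglongrightarrow> curve_integral \<gamma> (F \<tau>)"
    using tendsto_cong by force
  then have "(\<lambda>N. - K0 q a b / (2 * of_real pi * \<i>) * (- (2 * pi * \<i>) * (\<Sum>k\<le>N. residue (F \<tau>) (of_nat k)))) \<longlonglongrightarrow>
     - K0 q a b / (2 * of_real pi * \<i>) * curve_integral \<gamma> (F \<tau>)" by (rule tendsto_mult_left)
  then have "(\<lambda>N. \<Sum>k\<le>N. K0 q a b * residue (F \<tau>) (of_nat k)) \<longlonglongrightarrow> - K0 q a b / (2 * of_real pi * \<i>) * curve_integral \<gamma> (F \<tau>)"
  proof -
    have "- K0 q a b / (2 * of_real pi * \<i>) * (- (2 * pi * \<i>) * S) = K0 q a b * S" for S by (simp add: mult.left_commute)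
    then show ?thesis using \<open>(\<lambda>N. - K0 q a b / (2 * of_real pi * \<i>) * (- (2 * pi * \<i>) * (\<Sum>k\<le>N. residue (F \<tau>) (of_nat k)))) \<longlonglongrightarrow>
      - K0 q a b / (2 * of_real pi * \<i>) * curve_integral \<gamma> (F \<tau>)\<close> unfolding sum_distrib_left[symmetric] by (simp only:)
  qed
  moreover have "K0 q a b * residue (F \<tau>) (of_nat k) = qpoch q a k * qpoch q b k / qpoch q (of_real q) k * (- \<tau>) ^ k" for k
  proof -
    have qn: "qp q (of_nat k) = of_real q ^ k" "qp q (1 + of_nat k) = of_real q * of_real q ^ k"
      using qp_nat[of k] qp_nat[of "Suc k"] by simp_all
    show ?thesis
      unfolding residue_F_nat[OF \<tau>(1) poles_disjoint] den_def qpoch_def K0_def qn by (simp add: mult_ac)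
  qed
  ultimately show ?thesis by (simp add: sums_def_le)
qed

end

section \<open>Analytic continuation of the series\<close>

lemma norm_exp_minus_1_le: "norm (exp w - 1) \<le> norm w * exp (norm w)" for w :: complex
proof -
  have "norm (exp w - exp 0) \<le> exp (norm w) * norm (w - 0)"
  proof (rule field_differentiable_bound[of "cball 0 (norm w)" exp exp])
    show "(exp has_field_derivative exp z) (at z within cball 0 (norm w))" for z :: complex
      by (rule DERIV_exp[THEN has_field_derivative_at_within])
    fix z :: complex assume "z \<in> cball 0 (norm w)"
    then show "norm (exp z) \<le> exp (norm w)"
      using order_trans[OF complex_Re_le_cmod[of z]] by simp
  qed auto
  then show ?thesis by (simp add: mult.commute)
qed

context mb
begin

lemma Q_curve_bound:
  obtains C where "C > 0" "\<And>t. norm (Q (\<gamma> t)) \<le> C * exp (- pi * \<bar>Im (\<gamma> t)\<bar>)"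
proof -
  obtain C where C: "C > 0" "\<And>s. - R \<le> Re s \<Longrightarrow> Re s \<le> R \<Longrightarrow> (\<And>p. p \<in> left_poles \<union> nat_poles \<Longrightarrow> \<delta>0 \<le> norm (s - p)) \<Longrightarrow>
     norm (Q s) \<le> C * exp (- pi * \<bar>Im s\<bar>)" using Q_bound[OF gap0(1), of "-R" R] by blast
  have "norm (Q (\<gamma> t)) \<le> C * exp (- pi * \<bar>Im (\<gamma> t)\<bar>)" for t
    using Re_\<gamma>[of t] gap0(2) by (intro C(2)) (auto simp: abs_le_iff)
  with C(1) show ?thesis using that by blast
qed

lemma measurable_Q_curve [measurable]: "(\<lambda>t. Q (\<gamma> t)) \<in> borel_measurable borel"
proof (intro borel_measurable_continuous_onI)
  have "continuous_on (range \<gamma>) Q"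
    using poles_off_curve by (intro holomorphic_on_imp_continuous_on Q_holomorphic) blast
  then show "continuous_on UNIV (\<lambda>t. Q (\<gamma> t))"
    by (rule continuous_on_compose2[OF _ continuous_\<gamma>]) auto
qed

text \<open>The part of the contour integrand, including \<open>ds\<close>, that does not depend on \<open>\<tau>\<close>.\<close>

definition weight :: "real \<Rightarrow> complex" where "weight t = Q (\<gamma> t) * velocity t"

lemma measurable_weight [measurable]: "weight \<in> borel_measurable borel"
  unfolding weight_def[abs_def] by measurable

lemma weight_bound:
  obtains C where "C > 0" "AE t in lborel. norm (weight t) \<le> C * exp (- pi * \<bar>Im (\<gamma> t)\<bar>)"
proof -
  obtain C where C: "C > 0" "\<And>t. norm (Q (\<gamma> t)) \<le> C * exp (- pi * \<bar>Im (\<gamma> t)\<bar>)" using Q_curve_bound by blast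
  have "AE t in lborel. norm (weight t) \<le> (C * (B + 1)) * exp (- pi * \<bar>Im (\<gamma> t)\<bar>)"
    using AE_velocity
  proof eventually_elim
    case (elim t)
    then have "norm (weight t) \<le> (C * exp (- pi * \<bar>Im (\<gamma> t)\<bar>)) * (B + 1)"
      unfolding weight_def norm_mult using C by (intro mult_mono) auto
    then show ?case by (simp add: mult_ac)
  qed
  with C(1) B_nonneg show ?thesis using that[of "C * (B + 1)"] by simp
qed

lemma integrable_exp_decay:
  assumes "\<epsilon> > 0"
  shows "integrable lborel (\<lambda>t. C * exp (- \<epsilon> * \<bar>Im (\<gamma> t)\<bar>))"
proof -
  have "integrable lborel (\<lambda>t. exp (- \<epsilon> * \<bar>Im (\<gamma> t)\<bar>))"
  proof (rule Bochner_Integration.integrable_bound[OF integrable_inverse_1_plus_sq[of "(1 + 2 / \<epsilon>\<^sup>2) * K"]])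
    have "exp (- \<epsilon> * \<bar>Im (\<gamma> t)\<bar>) \<le> (1 + 2 / \<epsilon>\<^sup>2) * K / (1 + t\<^sup>2)" for t
      by (rule order_trans[OF exp_decay_quadratic[OF assms] decay_\<gamma>]) simp
    then have "exp (- \<epsilon> * \<bar>Im (\<gamma> t)\<bar>) \<le> \<bar>(1 + 2 / \<epsilon>\<^sup>2) * K / (1 + t\<^sup>2)\<bar>" for t
      by (rule order_trans[OF _ abs_ge_self])
    then show "AE t in lborel. norm (exp (- \<epsilon> * \<bar>Im (\<gamma> t)\<bar>)) \<le> norm ((1 + 2 / \<epsilon>\<^sup>2) * K / (1 + t\<^sup>2))"
      by (intro always_eventually allI) (simp only: real_norm_def abs_exp_cancel)
  qed measurable
  then show ?thesis by (rule integrable_mult_right)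
qed

lemma norm_exp_curve: "norm (exp (\<gamma> t * z)) \<le> exp (R * \<bar>Re z\<bar>) * exp (\<bar>Im z\<bar> * \<bar>Im (\<gamma> t)\<bar>)"
proof -
  have "Re (\<gamma> t * z) \<le> \<bar>Re (\<gamma> t)\<bar> * \<bar>Re z\<bar> + \<bar>Im (\<gamma> t)\<bar> * \<bar>Im z\<bar>"
    using abs_ge_self[of "Re (\<gamma> t) * Re z"] abs_ge_minus_self[of "Im (\<gamma> t) * Im z"] by (simp add: abs_mult)
  also have "\<dots> \<le> R * \<bar>Re z\<bar> + \<bar>Im z\<bar> * \<bar>Im (\<gamma> t)\<bar>"
    using mult_right_mono[OF Re_\<gamma>[of t] abs_ge_zero[of "Re z"]] by (simp add: mult.commute)
  finally show ?thesis by (simp add: exp_add[symmetric])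
qed

text \<open>The contour integral in the variable \<open>z = Ln \<tau>\<close>, in which the integrand is entire.\<close>

definition G :: "complex \<Rightarrow> complex" where "G z = (\<integral>t. weight t * exp (\<gamma> t * z) \<partial>lborel)"

lemma integrable_G:
  assumes "\<bar>Im z\<bar> < pi"
  shows "integrable lborel (\<lambda>t. weight t * exp (\<gamma> t * z))"
proof -
  obtain C where C: "C > 0" "AE t in lborel. norm (weight t) \<le> C * exp (- pi * \<bar>Im (\<gamma> t)\<bar>)" using weight_bound by blast
  show ?thesis
  proof (rule Bochner_Integration.integrable_bound[OF integrable_exp_decay[of "pi - \<bar>Im z\<bar>" "C * exp (R * \<bar>Re z\<bar>)"]])
    show "AE t in lborel. norm (weight t * exp (\<gamma> t * z)) \<le> norm (C * exp (R * \<bar>Re z\<bar>) * exp (- (pi - \<bar>Im z\<bar>) * \<bar>Im (\<gamma> t)\<bar>))"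
      using C(2)
    proof eventually_elim
      case (elim t)
      have "norm (weight t * exp (\<gamma> t * z)) \<le> (C * exp (- pi * \<bar>Im (\<gamma> t)\<bar>)) * (exp (R * \<bar>Re z\<bar>) * exp (\<bar>Im z\<bar> * \<bar>Im (\<gamma> t)\<bar>))"
        unfolding norm_mult using elim C(1) by (intro mult_mono norm_exp_curve) auto
      also have "\<dots> = C * exp (R * \<bar>Re z\<bar>) * exp (- pi * \<bar>Im (\<gamma> t)\<bar> + \<bar>Im z\<bar> * \<bar>Im (\<gamma> t)\<bar>)"
        by (simp only: exp_add mult_ac)
      also have "- pi * \<bar>Im (\<gamma> t)\<bar> + \<bar>Im z\<bar> * \<bar>Im (\<gamma> t)\<bar> = - (pi - \<bar>Im z\<bar>) * \<bar>Im (\<gamma> t)\<bar>" by (simp add: algebra_simps)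
      finally show ?case using C(1) by simp
    qed
  qed (use assms in auto)
qed

text \<open>Differentiation under the integral. The distance of \<open>\<bar>Im z\<bar>\<close> to \<open>\<pi>\<close> is spent in three equal parts \<open>\<epsilon>\<close>: for moving \<open>z\<close>,
  for the factor \<open>\<gamma> t\<close> from the derivative, and for the decay that is left for the majorant.\<close>

lemma G_derivative:
  assumes z: "\<bar>Im z\<bar> < pi"
  shows "(G has_field_derivative (\<integral>t. weight t * exp (\<gamma> t * z) * \<gamma> t \<partial>lborel)) (at z)"
  unfolding has_field_derivative_iff tendsto_at_iff_sequentially
proof (intro allI impI)
  fix Y :: "nat \<Rightarrow> complex"
  assume Y: "\<forall>i. Y i \<in> UNIV - {z}" "Y \<longlonglongrightarrow> z"
  define \<epsilon> where "\<epsilon> = (pi - \<bar>Im z\<bar>) / 3"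
  have \<epsilon>: "\<epsilon> > 0" using z by (simp add: \<epsilon>_def)
  have "\<forall>\<^sub>F i in sequentially. dist (Y i) z < \<epsilon>" using tendstoD[OF Y(2) \<epsilon>] .
  then obtain N where N: "\<And>i. i \<ge> N \<Longrightarrow> dist (Y i) z < \<epsilon>" by (auto simp: eventually_sequentially)
  define h where "h i = Y (i + N) - z" for i
  have h: "h i \<noteq> 0" "norm (h i) \<le> \<epsilon>" for i
    using Y(1) N[of "i + N"] by (auto simp: h_def dist_norm)
  have h0: "h \<longlonglongrightarrow> 0"
    unfolding h_def using LIMSEQ_ignore_initial_segment[OF Y(2), of N] by (simp add: LIM_zero)
  have Yh: "Y (i + N) = z + h i" for i by (simp add: h_def)
  have Im_h: "\<bar>Im (z + h i)\<bar> < pi" for i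
  proof -
    have "\<bar>Im (z + h i)\<bar> \<le> \<bar>Im z\<bar> + \<epsilon>" using h(2)[of i] abs_Im_le_cmod[of "h i"] by simp
    then show ?thesis using z by (simp add: \<epsilon>_def field_simps)
  qed
  obtain C where C: "C > 0" "AE t in lborel. norm (weight t) \<le> C * exp (- pi * \<bar>Im (\<gamma> t)\<bar>)" using weight_bound by blast
  define W where "W = C * exp (R * \<bar>Re z\<bar>) * ((R + 1 / \<epsilon>) * exp (\<epsilon> * R))"
  have R\<epsilon>: "R + 1 / \<epsilon> \<ge> 0" using \<epsilon> R_nonneg by simp
  have "(\<lambda>i. \<integral>t. weight t * exp (\<gamma> t * z) * ((exp (\<gamma> t * h i) - 1) / h i) \<partial>lborel) \<longlonglongrightarrow> (\<integral>t. weight t * exp (\<gamma> t * z) * \<gamma> t \<partial>lborel)"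
  proof (rule integral_dominated_convergence[where w="\<lambda>t. W * exp (- \<epsilon> * \<bar>Im (\<gamma> t)\<bar>)"])
    show "integrable lborel (\<lambda>t. W * exp (- \<epsilon> * \<bar>Im (\<gamma> t)\<bar>))" by (rule integrable_exp_decay[OF \<epsilon>])
    show "AE t in lborel. (\<lambda>i. weight t * exp (\<gamma> t * z) * ((exp (\<gamma> t * h i) - 1) / h i)) \<longlonglongrightarrow> weight t * exp (\<gamma> t * z) * \<gamma> t"
    proof (intro always_eventually allI tendsto_mult_left)
      fix t
      have "((\<lambda>h. exp (\<gamma> t * h)) has_field_derivative \<gamma> t) (at 0)" by (auto intro!: derivative_eq_intros)
      then have "((\<lambda>h. (exp (\<gamma> t * h) - 1) / h) \<longlongrightarrow> \<gamma> t) (at 0)" by (simp add: has_field_derivative_iff)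
      then show "(\<lambda>i. (exp (\<gamma> t * h i) - 1) / h i) \<longlonglongrightarrow> \<gamma> t"
        by (rule filterlim_compose) (use h h0 in \<open>auto simp: filterlim_at\<close>)
    qed
    show "AE t in lborel. norm (weight t * exp (\<gamma> t * z) * ((exp (\<gamma> t * h i) - 1) / h i)) \<le> W * exp (- \<epsilon> * \<bar>Im (\<gamma> t)\<bar>)" for i
      using C(2)
    proof eventually_elim
      case (elim t)
      define y where "y = \<bar>Im (\<gamma> t)\<bar>"
      have g: "norm (\<gamma> t) \<le> R + y" using cmod_le[of "\<gamma> t"] Re_\<gamma>[of t] by (simp add: y_def)
      have "\<epsilon> * y \<le> exp (\<epsilon> * y)" using exp_ge_add_one_self[of "\<epsilon> * y"] by linarith
      then have "y \<le> 1 / \<epsilon> * exp (\<epsilon> * y)" using \<epsilon> by (simp add: field_simps)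
      moreover have "R * 1 \<le> R * exp (\<epsilon> * y)" using R_nonneg \<epsilon> by (intro mult_left_mono) (auto simp: y_def)
      ultimately have g2: "norm (\<gamma> t) \<le> (R + 1 / \<epsilon>) * exp (\<epsilon> * y)" using g by (simp add: distrib_right)
      have "norm ((exp (\<gamma> t * h i) - 1) / h i) \<le> norm (\<gamma> t) * exp (norm (\<gamma> t * h i))"
        using norm_exp_minus_1_le[of "\<gamma> t * h i"] h(1)[of i] by (simp add: norm_divide norm_mult field_simps)
      also have "\<dots> \<le> ((R + 1 / \<epsilon>) * exp (\<epsilon> * y)) * exp ((R + y) * \<epsilon>)"
      proof (intro mult_mono g2)
        have "norm (\<gamma> t * h i) \<le> (R + y) * \<epsilon>" unfolding norm_mult
          by (rule mult_mono) (use g h(2)[of i] R_nonneg in \<open>auto simp: y_def\<close>)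
        then show "exp (norm (\<gamma> t * h i)) \<le> exp ((R + y) * \<epsilon>)" by simp
      qed (use R\<epsilon> in auto)
      finally have q: "norm ((exp (\<gamma> t * h i) - 1) / h i) \<le> ((R + 1 / \<epsilon>) * exp (\<epsilon> * y)) * exp ((R + y) * \<epsilon>)" .
      have "norm (weight t * exp (\<gamma> t * z) * ((exp (\<gamma> t * h i) - 1) / h i)) \<le>
        (C * exp (- pi * y)) * (exp (R * \<bar>Re z\<bar>) * exp (\<bar>Im z\<bar> * y)) * (((R + 1 / \<epsilon>) * exp (\<epsilon> * y)) * exp ((R + y) * \<epsilon>))"
        unfolding norm_mult[of "_ * _"] norm_mult[of "weight t"] y_def
        by (intro mult_mono elim norm_exp_curve q[unfolded y_def]) (use C(1) R\<epsilon> in auto)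
      also have "\<dots> = C * exp (R * \<bar>Re z\<bar>) * (R + 1 / \<epsilon>) * exp (- pi * y + \<bar>Im z\<bar> * y + \<epsilon> * y + (R + y) * \<epsilon>)"
        by (simp only: exp_add mult_ac)
      also have "- pi * y + \<bar>Im z\<bar> * y + \<epsilon> * y + (R + y) * \<epsilon> = \<epsilon> * R + - \<epsilon> * y"
        by (simp add: \<epsilon>_def field_simps)
      also have "C * exp (R * \<bar>Re z\<bar>) * (R + 1 / \<epsilon>) * exp (\<epsilon> * R + - \<epsilon> * y) = W * exp (- \<epsilon> * y)"
        by (simp only: W_def exp_add mult_ac)
      finally show ?case by (simp only: y_def)
    qed
  qed measurable
  moreover have "(\<integral>t. weight t * exp (\<gamma> t * z) * ((exp (\<gamma> t * h i) - 1) / h i) \<partial>lborel) = (G (Y (i + N)) - G z) / (Y (i + N) - z)" for i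
  proof -
    have *: "weight t * exp (\<gamma> t * z) * ((exp (\<gamma> t * h i) - 1) / h i) = (weight t * exp (\<gamma> t * (z + h i)) - weight t * exp (\<gamma> t * z)) / h i" for t
      by (simp add: distrib_left exp_add algebra_simps diff_divide_distrib)
    then show ?thesis
      using Bochner_Integration.integral_diff[OF integrable_G[OF Im_h[of i]] integrable_G[OF z]]
      unfolding * by (simp add: G_def Yh)
  qed
  ultimately have "(\<lambda>i. (G (Y (i + N)) - G z) / (Y (i + N) - z)) \<longlonglongrightarrow> (\<integral>t. weight t * exp (\<gamma> t * z) * \<gamma> t \<partial>lborel)"
    by simp
  then show "((\<lambda>w. (G w - G z) / (w - z)) \<circ> Y) \<longlonglongrightarrow> (\<integral>t. weight t * exp (\<gamma> t * z) * \<gamma> t \<partial>lborel)"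
    unfolding o_def by (rule LIMSEQ_offset[where k=N])
qed

lemma curve_integral_F_eq_G: "\<tau> \<noteq> 0 \<Longrightarrow> curve_integral \<gamma> (F \<tau>) = G (Ln \<tau>)"
  unfolding curve_integral_def G_def by (intro Bochner_Integration.integral_cong) (auto simp: F_def weight_def powr_def mult_ac)

lemma curve_integral_F_holomorphic: "(\<lambda>\<tau>. curve_integral \<gamma> (F \<tau>)) holomorphic_on - \<real>\<^sub>\<le>\<^sub>0"
proof -
  have "(\<lambda>\<tau>. G (Ln \<tau>)) field_differentiable at \<tau>" if "\<tau> \<notin> \<real>\<^sub>\<le>\<^sub>0" for \<tau>
  proof -
    have "\<tau> \<noteq> 0" using that by auto
    moreover have "Im (Ln \<tau>) \<noteq> pi" using that by (metis Im_Ln_eq_pi calculation complex_nonpos_Reals_iff less_imp_le)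
    ultimately have "\<bar>Im (Ln \<tau>)\<bar> < pi" using Im_Ln_le_pi[of \<tau>] mpi_less_Im_Ln[of \<tau>] by (simp add: abs_less_iff less_le) linarith
    then have "(G has_field_derivative (\<integral>t. weight t * exp (\<gamma> t * Ln \<tau>) * \<gamma> t \<partial>lborel)) (at (Ln \<tau>))" by (rule G_derivative)
    from DERIV_chain2[OF this has_field_derivative_Ln[OF that]]
    show ?thesis by (auto simp: field_differentiable_def)
  qed
  then have "(\<lambda>\<tau>. G (Ln \<tau>)) holomorphic_on - \<real>\<^sub>\<le>\<^sub>0"
    by (auto simp: holomorphic_on_def intro: field_differentiable_at_within)
  then show ?thesis by (rule holomorphic_transform) (rule curve_integral_F_eq_G[symmetric], auto)
qed

text \<open>The series in the unit disc and the contour integral off the ray \<open>[0, \<infinity>)\<close> agree where both are defined. Glued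
  together they are the continuation to the slit plane, so the choice in \<^const>\<open>phi21\<close> has a witness.\<close>

lemma phi21_spec:
  "phi21 q a b holomorphic_on - (of_real ` {1::real..}) \<and> (\<forall>x\<in>ball 0 1. phi21 q a b x = phi21_series q a b x)"
  and phi21_MB_exists: "\<exists>f. f holomorphic_on - (of_real ` {1::real..}) \<and> (\<forall>x\<in>ball 0 1. f x = phi21_series q a b x) \<and>
    (\<forall>\<tau>. \<tau> \<notin> \<real>\<^sub>\<le>\<^sub>0 \<longrightarrow> f (- \<tau>) = - K0 q a b / (2 * of_real pi * \<i>) * curve_integral \<gamma> (F \<tau>))"
proof -
  define m where "m x = - K0 q a b / (2 * of_real pi * \<i>) * curve_integral \<gamma> (F (- x))" for x
  define S where "S = - (of_real ` {1::real..} :: complex set)"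
  define U where "U = {x :: complex. - x \<notin> \<real>\<^sub>\<le>\<^sub>0}"
  have Uopen: "open U"
  proof -
    have "U = uminus -` (- \<real>\<^sub>\<le>\<^sub>0)" by (auto simp: U_def)
    then show ?thesis by (simp only:) (intro open_vimage continuous_intros open_Compl closed_nonpos_Reals_complex)
  qed
  have arg: "\<tau> \<noteq> 0 \<and> \<bar>Arg \<tau>\<bar> < pi" if "\<tau> \<notin> \<real>\<^sub>\<le>\<^sub>0" for \<tau>
  proof -
    have "\<tau> \<noteq> 0" using that by auto
    moreover have "Arg \<tau> \<noteq> pi" using that Arg_eq_pi[of \<tau>] by (auto simp: complex_nonpos_Reals_iff)
    ultimately show ?thesis using Arg_bounded[of \<tau>] by (auto simp: abs_less_iff less_le)
  qed
  have mholo: "m holomorphic_on U"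
  proof -
    have "((\<lambda>\<tau>. curve_integral \<gamma> (F \<tau>)) \<circ> uminus) holomorphic_on U"
      by (rule holomorphic_on_compose_gen[OF _ curve_integral_F_holomorphic]) (auto simp: U_def intro!: holomorphic_intros)
    then show ?thesis unfolding m_def[abs_def] by (intro holomorphic_intros) (simp add: o_def)
  qed
  have ser: "(\<lambda>k. qpoch q a k * qpoch q b k / qpoch q (of_real q) k * x ^ k) sums m x" if "norm x < 1" "x \<in> U" for x
    using MB_series[of "-x"] arg[of "-x"] that by (auto simp: m_def U_def)
  have sm: "(\<lambda>k. qpoch q a k * qpoch q b k / qpoch q (of_real q) k * x ^ k) sums phi21_series q a b x" if "norm x < 1" for x
  proof -
    define r where "r = (norm x + 1) / 2"
    have r: "norm x < r" "r < 1" "0 < r" using that norm_ge_zero[of x] by (simp_all add: r_def add_nonneg_pos)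
    have "summable (\<lambda>k. qpoch q a k * qpoch q b k / qpoch q (of_real q) k * (- of_real r) ^ k)"
      using ser[of "- of_real r"] r by (auto simp: U_def complex_nonpos_Reals_iff sums_iff)
    then have "summable (\<lambda>k. qpoch q a k * qpoch q b k / qpoch q (of_real q) k * x ^ k)"
      by (rule powser_inside) (use r in simp)
    then show ?thesis unfolding phi21_series_def by (rule summable_sums)
  qed
  have sholo: "phi21_series q a b holomorphic_on ball 0 1"
    by (rule power_series_holomorphic[of 0 1 "\<lambda>k. qpoch q a k * qpoch q b k / qpoch q (of_real q) k"])
       (use sm in \<open>simp add: dist_norm\<close>)
  have agree: "phi21_series q a b x = m x" if "norm x < 1" "x \<in> U" for x
    using sums_unique2[OF sm[OF that(1)] ser[OF that]] .
  define f where "f x = (if norm x < 1 then phi21_series q a b x else m x)" for x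
  have fU: "f x = m x" if "x \<in> U" for x using agree that by (simp add: f_def)
  have "f holomorphic_on ball 0 1"
    by (rule holomorphic_transform[OF sholo]) (auto simp: f_def)
  moreover have "f holomorphic_on U"
    by (rule holomorphic_transform[OF mholo]) (auto simp: fU)
  ultimately have "f holomorphic_on ball 0 1 \<union> U"
    using Uopen by (intro holomorphic_on_Un) auto
  moreover have "S \<subseteq> ball 0 1 \<union> U"
  proof
    fix x assume "x \<in> S"
    then have x: "\<not> (Im x = 0 \<and> 1 \<le> Re x)" by (auto simp: S_def complex_eq_iff image_iff)
    show "x \<in> ball 0 1 \<union> U"
    proof (cases "Im x = 0 \<and> 0 \<le> Re x")
      case True
      then have "norm x < 1" using x by (simp add: cmod_eq_Re)
      then show ?thesis by simp
    next
      case False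
      then show ?thesis by (auto simp: U_def complex_nonpos_Reals_iff)
    qed
  qed
  ultimately have fS: "f holomorphic_on S" by (rule holomorphic_on_subset)
  have fb: "\<forall>x\<in>ball 0 1. f x = phi21_series q a b x" by (simp add: f_def)
  have "\<forall>\<tau>. \<tau> \<notin> \<real>\<^sub>\<le>\<^sub>0 \<longrightarrow> f (- \<tau>) = - K0 q a b / (2 * of_real pi * \<i>) * curve_integral \<gamma> (F \<tau>)"
    using fU by (simp add: U_def m_def)
  with fS fb show "\<exists>f. f holomorphic_on - (of_real ` {1::real..}) \<and> (\<forall>x\<in>ball 0 1. f x = phi21_series q a b x) \<and>
    (\<forall>\<tau>. \<tau> \<notin> \<real>\<^sub>\<le>\<^sub>0 \<longrightarrow> f (- \<tau>) = - K0 q a b / (2 * of_real pi * \<i>) * curve_integral \<gamma> (F \<tau>))"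
    unfolding S_def by blast
  have "\<exists>f. f holomorphic_on - (of_real ` {1::real..}) \<and> (\<forall>x\<in>ball 0 1. f x = phi21_series q a b x)"
    using fS fb unfolding S_def by blast
  then show "phi21 q a b holomorphic_on - (of_real ` {1::real..}) \<and> (\<forall>x\<in>ball 0 1. phi21 q a b x = phi21_series q a b x)"
    unfolding phi21_def by (rule someI_ex)
qed

lemma connected_slit_plane: "connected (- (of_real ` {1::real..}) :: complex set)"
proof (rule starlike_imp_connected)
  have "closed_segment 0 x \<subseteq> - (of_real ` {1::real..})" if x: "x \<in> - (of_real ` {1::real..} :: complex set)" for x
  proof
    fix y assume "y \<in> closed_segment 0 x"
    then obtain u where u: "0 \<le> u" "u \<le> 1" "y = of_real u * x" by (auto simp: closed_segment_def scaleR_conv_of_real)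
    show "y \<in> - (of_real ` {1::real..})"
    proof
      assume "y \<in> of_real ` {1::real..}"
      then obtain r where r: "1 \<le> r" "of_real u * x = of_real r" using u by auto
      then have u0: "u > 0" using u(1) by (cases "u = 0") auto
      have "x = of_real (r / u)" using r u0 by (simp add: field_simps)
      moreover have "1 \<le> r / u" using r u0 u(2) by (simp add: field_simps)
      ultimately have "x \<in> of_real ` {1::real..}" by (intro image_eqI[of _ _ "r / u"]) auto
      then show False using x by blast
    qed
  qed
  then show "starlike (- (of_real ` {1::real..}) :: complex set)"
    unfolding starlike_def by (intro bexI[of _ 0]) auto
qed

text \<open>The slit plane is connected, so the chosen continuation is the one constructed from the contour integral.\<close>

lemma phi21_MB:
  assumes "\<tau> \<noteq> 0" "\<bar>Arg \<tau>\<bar> < pi"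
  shows "phi21 q a b (- \<tau>) = - K0 q a b / (2 * of_real pi * \<i>) * curve_integral \<gamma> (F \<tau>)"
proof -
  have \<tau>: "\<tau> \<notin> \<real>\<^sub>\<le>\<^sub>0" using assms Arg_eq_pi[of \<tau>] by (auto simp: complex_nonpos_Reals_iff complex_eq_iff less_le)
  obtain f where f: "f holomorphic_on - (of_real ` {1::real..})" "\<forall>x\<in>ball 0 1. f x = phi21_series q a b x"
    "\<forall>\<tau>. \<tau> \<notin> \<real>\<^sub>\<le>\<^sub>0 \<longrightarrow> f (- \<tau>) = - K0 q a b / (2 * of_real pi * \<i>) * curve_integral \<gamma> (F \<tau>)"
    using phi21_MB_exists by blast
  have "closed (of_real ` {1::real..} :: complex set)"
    by (intro closed_injective_linear_image) (auto simp: inj_def intro: bounded_linear.linear bounded_linear_of_real)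
  then have op: "open (- (of_real ` {1::real..}) :: complex set)" by (rule open_Compl)
  have "phi21 q a b (- \<tau>) = f (- \<tau>)"
  proof (rule analytic_continuation_open[where f="phi21 q a b" and g=f and z="- \<tau>" and s="ball 0 1" and s'="- (of_real ` {1::real..})"])
    show "ball 0 1 \<subseteq> (- (of_real ` {1::real..}) :: complex set)" by auto
    show "- \<tau> \<in> - (of_real ` {1::real..})" using \<tau> by (auto simp: complex_nonpos_Reals_iff complex_eq_iff)
    show "phi21 q a b z = f z" if "z \<in> ball 0 1" for z using phi21_spec f(2) that by simp
  qed (use phi21_spec f op connected_slit_plane in auto)
  then show ?thesis using f(3) \<tau> by simp
qed

text \<open>The Mellin--Barnes representation is integrated against a kernel by Fubini's theorem. Since \<open>\<bar>Re (\<gamma> t)\<bar> \<le> R\<close> and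
  the arguments of the points \<open>\<psi> x\<close> stay away from \<open>\<plusminus> \<pi>\<close>, the integrand is bounded by a product of a function of
  \<open>x\<close> and an exponentially decreasing function of \<open>t\<close>. The three functions of the theorem are the cases of a Gaussian
  kernel, of a reciprocal theta function, and of a discrete measure.\<close>

lemma MB_superposition:
  fixes M :: "'x measure" and \<kappa> \<psi> :: "'x \<Rightarrow> complex"
  assumes "sigma_finite_measure M"
    and [measurable]: "\<kappa> \<in> borel_measurable M" "\<psi> \<in> borel_measurable M"
    and \<psi>: "\<And>x. x \<in> space M \<Longrightarrow> \<psi> x \<noteq> 0" "\<And>x. x \<in> space M \<Longrightarrow> \<bar>Arg (\<psi> x)\<bar> \<le> \<theta>" and \<theta>: "\<theta> < pi"
    and int: "integrable M (\<lambda>x. norm (\<kappa> x) * (norm (\<psi> x) powr R + norm (\<psi> x) powr (- R)))"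
  shows "integrable M (\<lambda>x. \<kappa> x * phi21 q a b (- \<psi> x))"
    and "integrable lborel (\<lambda>t. weight t * (\<integral>x. \<kappa> x * \<psi> x powr \<gamma> t \<partial>M))"
    and "(\<integral>x. \<kappa> x * phi21 q a b (- \<psi> x) \<partial>M) =
      - K0 q a b / (2 * of_real pi * \<i>) * (\<integral>t. weight t * (\<integral>x. \<kappa> x * \<psi> x powr \<gamma> t \<partial>M) \<partial>lborel)"
proof -
  interpret M: sigma_finite_measure M by fact
  interpret pair_sigma_finite M lborel ..
  define w where "w x = norm (\<kappa> x) * (norm (\<psi> x) powr R + norm (\<psi> x) powr (- R))" for x
  define f where "f x t = \<kappa> x * (weight t * \<psi> x powr \<gamma> t)" for x t
  have [measurable]: "case_prod f \<in> borel_measurable (M \<Otimes>\<^sub>M lborel)"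
    unfolding f_def[abs_def] by measurable
  obtain C where C: "C > 0" "AE t in lborel. norm (weight t) \<le> C * exp (- pi * \<bar>Im (\<gamma> t)\<bar>)" using weight_bound by blast
  define v where "v t = C * exp (- (pi - \<theta>) * \<bar>Im (\<gamma> t)\<bar>)" for t
  have v: "integrable lborel v" unfolding v_def[abs_def] using \<theta> by (intro integrable_exp_decay) simp
  have le: "AE t in lborel. norm (f x t) \<le> w x * v t" if x: "x \<in> space M" for x
    using C(2)
  proof eventually_elim
    case (elim t)
    have "norm (\<psi> x powr \<gamma> t) \<le> (norm (\<psi> x) powr R + norm (\<psi> x) powr (- R)) * exp (\<bar>Arg (\<psi> x)\<bar> * \<bar>Im (\<gamma> t)\<bar>)"
      by (rule norm_powr_le[OF \<psi>(1)[OF x] Re_\<gamma>])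
    also have "\<dots> \<le> (norm (\<psi> x) powr R + norm (\<psi> x) powr (- R)) * exp (\<theta> * \<bar>Im (\<gamma> t)\<bar>)"
      using \<psi>(2)[OF x] by (intro mult_left_mono) (auto intro: mult_right_mono)
    finally have p: "norm (\<psi> x powr \<gamma> t) \<le> (norm (\<psi> x) powr R + norm (\<psi> x) powr (- R)) * exp (\<theta> * \<bar>Im (\<gamma> t)\<bar>)" .
    have "norm (f x t) \<le> norm (\<kappa> x) * ((C * exp (- pi * \<bar>Im (\<gamma> t)\<bar>)) * ((norm (\<psi> x) powr R + norm (\<psi> x) powr (- R)) * exp (\<theta> * \<bar>Im (\<gamma> t)\<bar>)))"
      unfolding f_def norm_mult using elim p C(1) by (intro mult_left_mono mult_mono) auto
    also have "\<dots> = w x * (C * exp (- pi * \<bar>Im (\<gamma> t)\<bar> + \<theta> * \<bar>Im (\<gamma> t)\<bar>))"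
      by (simp only: w_def exp_add mult_ac)
    also have "- pi * \<bar>Im (\<gamma> t)\<bar> + \<theta> * \<bar>Im (\<gamma> t)\<bar> = - (pi - \<theta>) * \<bar>Im (\<gamma> t)\<bar>" by (simp add: algebra_simps)
    finally show ?case by (simp only: v_def)
  qed
  have w0: "w x \<ge> 0" for x by (simp add: w_def)
  have v0: "v t \<ge> 0" for t using C(1) by (simp add: v_def)
  have it: "integrable lborel (f x)" if x: "x \<in> space M" for x
  proof (rule Bochner_Integration.integrable_bound[OF integrable_mult_right[OF v, of "w x"]])
    show "f x \<in> borel_measurable lborel" unfolding f_def[abs_def] by measurable
    show "AE t in lborel. norm (f x t) \<le> norm (w x * v t)"
      using le[OF x] by eventually_elim (simp add: w0 v0)
  qed
  have fi: "integrable (M \<Otimes>\<^sub>M lborel) (case_prod f)"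
  proof (rule Fubini_integrable)
    show "AE x in M. integrable lborel (\<lambda>t. case_prod f (x, t))" using it by (intro AE_I2) simp
    show "integrable M (\<lambda>x. \<integral>t. norm (case_prod f (x, t)) \<partial>lborel)"
    proof (rule Bochner_Integration.integrable_bound[OF integrable_mult_left[OF int[folded w_def], of "integral\<^sup>L lborel v"]])
      show "AE x in M. norm (\<integral>t. norm (case_prod f (x, t)) \<partial>lborel) \<le> norm (w x * integral\<^sup>L lborel v)"
      proof (rule AE_I2)
        fix x assume x: "x \<in> space M"
        have "(\<integral>t. norm (f x t) \<partial>lborel) \<le> (\<integral>t. w x * v t \<partial>lborel)"
          by (intro integral_mono_AE integrable_norm it x integrable_mult_right v le)
        then show "norm (\<integral>t. norm (case_prod f (x, t)) \<partial>lborel) \<le> norm (w x * integral\<^sup>L lborel v)"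
          using w0[of x] v0 by (simp add: integral_nonneg_AE abs_mult)
      qed
    qed measurable
  qed measurable
  define c0 where "c0 = - K0 q a b / (2 * of_real pi * \<i>)"
  have inner: "(\<integral>t. f x t \<partial>lborel) = \<kappa> x * curve_integral \<gamma> (F (\<psi> x))" for x
  proof -
    have "(\<integral>t. f x t \<partial>lborel) = \<kappa> x * (\<integral>t. weight t * \<psi> x powr \<gamma> t \<partial>lborel)" by (simp add: f_def)
    also have "(\<integral>t. weight t * \<psi> x powr \<gamma> t \<partial>lborel) = curve_integral \<gamma> (F (\<psi> x))"
      unfolding curve_integral_def by (intro Bochner_Integration.integral_cong) (auto simp: F_def weight_def mult_ac)
    finally show ?thesis .
  qed
  have eq: "\<kappa> x * phi21 q a b (- \<psi> x) = c0 * (\<integral>t. f x t \<partial>lborel)" if "x \<in> space M" for x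
    using phi21_MB[of "\<psi> x"] \<psi>[OF that] \<theta> unfolding inner c0_def by simp
  have "integrable M (\<lambda>x. c0 * (\<integral>t. f x t \<partial>lborel))"
    by (intro integrable_mult_right integrable_fst[OF fi])
  then show "integrable M (\<lambda>x. \<kappa> x * phi21 q a b (- \<psi> x))"
    by (rule Bochner_Integration.integrable_cong[THEN iffD1, rotated -1]) (auto simp: eq)
  have outer: "(\<integral>x. f x t \<partial>M) = weight t * (\<integral>x. \<kappa> x * \<psi> x powr \<gamma> t \<partial>M)" for t
  proof -
    have "f x t = weight t * (\<kappa> x * \<psi> x powr \<gamma> t)" for x by (simp add: f_def mult_ac)
    then show ?thesis by simp
  qed
  show "integrable lborel (\<lambda>t. weight t * (\<integral>x. \<kappa> x * \<psi> x powr \<gamma> t \<partial>M))"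
    using integrable_snd[OF fi] by (simp add: outer)
  have "(\<integral>x. \<kappa> x * phi21 q a b (- \<psi> x) \<partial>M) = (\<integral>x. c0 * (\<integral>t. f x t \<partial>lborel) \<partial>M)"
    by (intro Bochner_Integration.integral_cong) (auto simp: eq)
  also have "\<dots> = c0 * (\<integral>t. (\<integral>x. f x t \<partial>M) \<partial>lborel)"
    using Fubini_integral[OF fi] by simp
  finally show "(\<integral>x. \<kappa> x * phi21 q a b (- \<psi> x) \<partial>M) =
      - K0 q a b / (2 * of_real pi * \<i>) * (\<integral>t. weight t * (\<integral>x. \<kappa> x * \<psi> x powr \<gamma> t \<partial>M) \<partial>lborel)"
    by (simp add: outer c0_def)
qed

end

section \<open>Moments of the three kernels\<close>

lemma exp_substitution:
  fixes g :: "real \<Rightarrow> complex"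
  assumes "integrable lborel (\<lambda>u. of_real (exp u) * g (exp u))"
  shows "g absolutely_integrable_on {0<..}"
    and "integral {0<..} g = (\<integral>u. of_real (exp u) * g (exp u) \<partial>lborel)"
proof -
  define h where "h u = of_real (exp u) * g (exp u)" for u :: real
  have S: "(UNIV :: real set) \<in> sets lebesgue" by simp
  have der: "(exp has_field_derivative exp x) (at x within UNIV)" for x :: real by (rule DERIV_exp)
  have inj: "inj_on exp (UNIV :: real set)" by (auto simp: inj_on_def)
  have ran: "exp ` (UNIV :: real set) = {0<..}"
  proof -
    have "x \<in> range exp" if "x > 0" for x :: real using that by (intro image_eqI[of _ _ "ln x"]) auto
    then show ?thesis by auto
  qed
  have main: "f absolutely_integrable_on {0<..} \<and> integral {0<..} f = (\<integral>u. exp u * f (exp u) \<partial>lborel)"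
    if i: "integrable lborel (\<lambda>u. exp u * f (exp u))" for f :: "real \<Rightarrow> real"
  proof -
    have "(\<lambda>u. exp u * f (exp u)) absolutely_integrable_on UNIV"
      using integrable_completion[of "\<lambda>u. exp u * f (exp u)" lborel] i borel_measurable_integrable[OF i]
      by (simp add: set_integrable_def)
    moreover have "integral UNIV (\<lambda>u. exp u * f (exp u)) = (\<integral>u. exp u * f (exp u) \<partial>lborel)"
      using has_integral_integral_lborel[OF i] by (rule integral_unique)
    ultimately show ?thesis
      using has_absolute_integral_change_of_variables_1'[OF S der inj, of f "\<integral>u. exp u * f (exp u) \<partial>lborel"]
      unfolding ran by simp
  qed
  have h: "integrable lborel h" unfolding h_def by fact
  have Re: "(\<lambda>x. Re (g x)) absolutely_integrable_on {0<..} \<and> integral {0<..} (\<lambda>x. Re (g x)) = Re (\<integral>u. h u \<partial>lborel)"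
    using main[of "\<lambda>x. Re (g x)"] integrable_Re[OF h] integral_Re[OF h] by (simp add: h_def[abs_def])
  have Im: "(\<lambda>x. Im (g x)) absolutely_integrable_on {0<..} \<and> integral {0<..} (\<lambda>x. Im (g x)) = Im (\<integral>u. h u \<partial>lborel)"
    using main[of "\<lambda>x. Im (g x)"] integrable_Im[OF h] integral_Im[OF h] by (simp add: h_def[abs_def])
  have "(\<lambda>x. complex_of_real (Re (g x))) absolutely_integrable_on {0<..}"
    "(\<lambda>x. \<i> * complex_of_real (Im (g x))) absolutely_integrable_on {0<..}"
    using absolutely_integrable_linear[OF conjunct1[OF Re] bounded_linear_of_real]
      absolutely_integrable_linear[OF conjunct1[OF Im] bounded_linear_compose[OF bounded_linear_mult_right[of \<i>] bounded_linear_of_real]]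
    by (simp_all add: o_def)
  from set_integral_add(1)[OF this]
  show ai: "g absolutely_integrable_on {0<..}" by (simp add: complex_eq[symmetric])
  have gi: "g integrable_on {0<..}" using ai by (rule set_lebesgue_integral_eq_integral(1))
  have "Re (integral {0<..} g) = Re (\<integral>u. h u \<partial>lborel)" "Im (integral {0<..} g) = Im (\<integral>u. h u \<partial>lborel)"
    using integral_linear[OF gi bounded_linear_Re] integral_linear[OF gi bounded_linear_Im] Re Im by (simp_all add: o_def)
  then show "integral {0<..} g = (\<integral>u. of_real (exp u) * g (exp u) \<partial>lborel)"
    by (simp add: complex_eq_iff h_def[abs_def])
qed

text \<open>The real part of \<open>b\<close> is removed by a translation of \<open>u\<close>. Its imaginary part is then the frequency at which the
  characteristic function of the normal distribution is evaluated.\<close>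

lemma gaussian_integral:
  fixes b :: complex and c :: real
  assumes c: "c > 0"
  shows "integrable lborel (\<lambda>u. exp (- (of_real u)\<^sup>2 / (2 * of_real c) + b * of_real u))"
    and "(\<integral>u. exp (- (of_real u)\<^sup>2 / (2 * of_real c) + b * of_real u) \<partial>lborel) = of_real (sqrt (2 * pi * c)) * exp (of_real c * b\<^sup>2 / 2)"
proof -
  define f where "f u = exp (- (complex_of_real u)\<^sup>2 / (2 * of_real c) + b * of_real u)" for u :: real
  define b1 b2 where "b1 = Re b" and "b2 = Im b"
  have b: "b = of_real b1 + \<i> * of_real b2" by (simp add: b1_def b2_def complex_eq)
  define r where "r = sqrt c"
  have r: "r > 0" "r * r = c" using c by (simp_all add: r_def)
  define A where "A = exp (of_real (c * b1\<^sup>2 / 2) + \<i> * of_real (c * b1 * b2))"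
  define D where "D x = complex_of_real (std_normal_density x) * exp (\<i> * of_real (b2 * r * x))" for x
  have fD: "f (c * b1 + r * x) = of_real (sqrt (2 * pi)) * A * D x" for x
  proof -
    have e: "- (complex_of_real (c * b1 + r * x))\<^sup>2 / (2 * of_real c) + b * of_real (c * b1 + r * x) =
      of_real (- x\<^sup>2 / 2) + (of_real (c * b1\<^sup>2 / 2) + \<i> * of_real (c * b1 * b2)) + \<i> * of_real (b2 * r * x)"
    proof -
      have "(complex_of_real (c * b1 + r * x))\<^sup>2 = of_real c * (of_real c * (of_real b1)\<^sup>2 + 2 * of_real b1 * of_real r * of_real x + (of_real x)\<^sup>2)"
        unfolding r(2)[symmetric] by (simp add: power2_eq_square algebra_simps)
      then have "(complex_of_real (c * b1 + r * x))\<^sup>2 / (2 * of_real c) = (of_real c * (of_real b1)\<^sup>2 + 2 * of_real b1 * of_real r * of_real x + (of_real x)\<^sup>2) / 2"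
        using c by simp
      then have "- (complex_of_real (c * b1 + r * x))\<^sup>2 / (2 * of_real c) = - ((of_real c * (of_real b1)\<^sup>2 + 2 * of_real b1 * of_real r * of_real x + (of_real x)\<^sup>2) / 2)"
        by (simp only: minus_divide_left[symmetric])
      then show ?thesis unfolding b by (simp only:) (simp add: power2_eq_square field_simps)
    qed
    have "f (c * b1 + r * x) = of_real (exp (- x\<^sup>2 / 2)) * A * exp (\<i> * of_real (b2 * r * x))"
      unfolding f_def e by (simp only: exp_add A_def exp_of_real)
    then show ?thesis by (simp add: D_def std_normal_density_def)
  qed
  have D: "integrable lborel D" "integral\<^sup>L lborel D = exp (of_real (- (b2 * r)\<^sup>2 / 2))"
  proof -
    show "integrable lborel D"
    proof (rule Bochner_Integration.integrable_bound[OF integrable_std_normal_moment[of 0]])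
      show "AE x in lborel. norm (D x) \<le> norm (std_normal_density x * x ^ 0)"
        by (simp add: D_def norm_mult)
    qed (simp add: D_def[abs_def])
    have "char std_normal_distribution (b2 * r) = (\<integral>x. exp (\<i> * of_real (b2 * r * x)) \<partial>std_normal_distribution)"
      by (simp add: char_def mult_ac)
    also have "\<dots> = (\<integral>x. std_normal_density x *\<^sub>R exp (\<i> * of_real (b2 * r * x)) \<partial>lborel)"
      by (subst integral_density) (auto intro!: AE_I2)
    also have "\<dots> = integral\<^sup>L lborel D" by (simp add: D_def[abs_def] scaleR_conv_of_real)
    finally show "integral\<^sup>L lborel D = exp (of_real (- (b2 * r)\<^sup>2 / 2))"
      unfolding exp_of_real by (simp only: char_std_normal_distribution)
  qed
  have "integrable lborel (\<lambda>x. f (c * b1 + r * x))" unfolding fD by (intro integrable_mult_right D)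
  then have "integrable lborel f" using r(1) by (subst lborel_integrable_real_affine_iff[symmetric, of r _ "c * b1"]) auto
  then show "integrable lborel (\<lambda>u. exp (- (of_real u)\<^sup>2 / (2 * of_real c) + b * of_real u))" unfolding f_def[abs_def] .
  have "(\<integral>u. f u \<partial>lborel) = \<bar>r\<bar> *\<^sub>R (\<integral>x. f (c * b1 + r * x) \<partial>lborel)"
    using r(1) by (intro lborel_integral_real_affine) auto
  also have "\<dots> = of_real r * of_real (sqrt (2 * pi)) * (A * exp (of_real (- (b2 * r)\<^sup>2 / 2)))"
    unfolding fD using r(1) D(2) by (simp add: scaleR_conv_of_real)
  also have "A * exp (of_real (- (b2 * r)\<^sup>2 / 2)) = exp (of_real c * b\<^sup>2 / 2)"
  proof -
    have "of_real (c * b1\<^sup>2 / 2) + \<i> * of_real (c * b1 * b2) + of_real (- (b2 * r)\<^sup>2 / 2) = of_real c * b\<^sup>2 / 2"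
      unfolding b r(2)[symmetric] by (simp add: power2_eq_square algebra_simps add_divide_distrib diff_divide_distrib)
    then show ?thesis unfolding A_def exp_add[symmetric] by (simp only:)
  qed
  also have "of_real r * of_real (sqrt (2 * pi)) = complex_of_real (sqrt (2 * pi * c))"
    by (simp add: r_def real_sqrt_mult mult_ac)
  finally show "(\<integral>u. exp (- (of_real u)\<^sup>2 / (2 * of_real c) + b * of_real u) \<partial>lborel) = of_real (sqrt (2 * pi * c)) * exp (of_real c * b\<^sup>2 / 2)"
    unfolding f_def .
qed

lemma integral_count_space_has_sum:
  fixes f :: "'a \<Rightarrow> complex"
  assumes "(\<lambda>n. norm (f n)) summable_on A" "(f has_sum S) A"
  shows "integrable (count_space A) f" "(\<integral>n. f n \<partial>count_space A) = S"
proof -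
  have a: "Infinite_Set_Sum.abs_summable_on f A" using assms(1) by (simp only: abs_summable_equivalent)
  then show "integrable (count_space A) f" unfolding Infinite_Set_Sum.abs_summable_on_def .
  have "infsetsum f A = S" using infsetsum_infsum[OF a] infsumI[OF assms(2)] by simp
  then show "(\<integral>n. f n \<partial>count_space A) = S" by (simp add: infsetsum_def)
qed

text \<open>Folding an integral over the line onto one period: both sides integrate the same function over
  \<open>\<int> \<times> [\<alpha>, \<alpha> + c)\<close>.\<close>

lemma integral_periodize:
  fixes f :: "real \<Rightarrow> complex"
  assumes c: "c > 0" and f: "integrable lborel f"
  shows "(\<integral>u. f u \<partial>lborel) = (\<integral>v. indicator {\<alpha>..<\<alpha> + c} v *\<^sub>R (\<integral>n. f (v + of_int n * c) \<partial>count_space UNIV) \<partial>lborel)"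
proof -
  interpret Z: sigma_finite_measure "count_space (UNIV :: int set)" by (rule sigma_finite_measure_count_space)
  interpret P: pair_sigma_finite lborel "count_space (UNIV :: int set)" ..
  interpret P': pair_sigma_finite "count_space (UNIV :: int set)" lborel ..
  have fm [measurable]: "f \<in> borel_measurable borel" using f by simp
  define I where "I n = {\<alpha> + of_int n * c..<\<alpha> + (of_int n + 1) * c}" for n :: int
  define G where "G u n = indicator (I n) u *\<^sub>R f u" for u n
  have cover: "u \<in> I n \<longleftrightarrow> n = \<lfloor>(u - \<alpha>) / c\<rfloor>" for u n
  proof -
    have "u \<in> I n \<longleftrightarrow> of_int n \<le> (u - \<alpha>) / c \<and> (u - \<alpha>) / c < of_int n + 1"
      using c by (auto simp: I_def pos_le_divide_eq pos_divide_less_eq)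
    then show ?thesis unfolding floor_eq_iff[symmetric] by (simp add: eq_commute)
  qed
  have supp: "G u n = (if n = \<lfloor>(u - \<alpha>) / c\<rfloor> then f u else 0)" for u n
    by (simp add: G_def cover indicator_def)
  have sumG: "(\<integral>n. G u n \<partial>count_space UNIV) = f u" "(\<integral>n. norm (G u n) \<partial>count_space UNIV) = norm (f u)" for u
  proof -
    show "(\<integral>n. G u n \<partial>count_space UNIV) = f u"
      by (subst integral_count_space_support[of "{\<lfloor>(u - \<alpha>) / c\<rfloor>}"]) (auto simp: supp)
    show "(\<integral>n. norm (G u n) \<partial>count_space UNIV) = norm (f u)"
      by (subst integral_count_space_support[of "{\<lfloor>(u - \<alpha>) / c\<rfloor>}"]) (auto simp: supp)
  qed
  have iG: "integrable (lborel \<Otimes>\<^sub>M count_space UNIV) (case_prod G)"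
  proof (rule P.Fubini_integrable)
    show "case_prod G \<in> borel_measurable (lborel \<Otimes>\<^sub>M count_space UNIV)"
    proof -
      have "(\<lambda>(n, u). G u n) \<in> borel_measurable (count_space UNIV \<Otimes>\<^sub>M lborel)"
      proof (rule measurable_pair_measure_countable1)
        show "(\<lambda>u. case (n, u) of (n, u) \<Rightarrow> G u n) \<in> borel_measurable lborel" for n
          unfolding G_def I_def by (simp, measurable)
      qed auto
      from measurable_pair_swap[OF this] show ?thesis by simp
    qed
    show "integrable lborel (\<lambda>u. \<integral>n. norm (case_prod G (u, n)) \<partial>count_space UNIV)"
      using integrable_norm[OF f] by (simp add: sumG)
    have "integrable (count_space UNIV) (G u)" for u
    proof (rule integral_count_space_has_sum(1)[where S="f u"])
      have "(\<lambda>n. norm (G u n)) summable_on {\<lfloor>(u - \<alpha>) / c\<rfloor>}" by simp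
      then show "(\<lambda>n. norm (G u n)) summable_on UNIV"
        by (rule summable_on_cong_neutral[THEN iffD1, rotated -1]) (auto simp: supp)
      have "(G u has_sum f u) {\<lfloor>(u - \<alpha>) / c\<rfloor>}"
        using has_sum_finite[of "{\<lfloor>(u - \<alpha>) / c\<rfloor>}" "G u"] by (simp add: supp)
      then show "(G u has_sum f u) UNIV"
        by (rule has_sum_cong_neutral[THEN iffD1, rotated -1]) (auto simp: supp)
    qed
    then show "AE u in lborel. integrable (count_space UNIV) (\<lambda>n. case_prod G (u, n))" by simp
  qed
  define H where "H n v = indicator {\<alpha>..<\<alpha> + c} v *\<^sub>R f (v + of_int n * c)" for n :: int and v
  have GH: "G (of_int n * c + 1 * v) n = H n v" for n v
    by (simp add: G_def H_def I_def indicator_def algebra_simps)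
  have shift: "(\<integral>u. G u n \<partial>lborel) = (\<integral>v. H n v \<partial>lborel)" for n
    using lborel_integral_real_affine[of 1 "\<lambda>u. G u n" "of_int n * c"] by (simp add: GH[symmetric])
  have nshift: "(\<integral>u. norm (G u n) \<partial>lborel) = (\<integral>v. norm (H n v) \<partial>lborel)" for n
    using lborel_integral_real_affine[of 1 "\<lambda>u. norm (G u n)" "of_int n * c"] by (simp add: GH[symmetric])
  have iH: "integrable (count_space UNIV \<Otimes>\<^sub>M lborel) (case_prod H)"
  proof (rule P'.Fubini_integrable)
    show "case_prod H \<in> borel_measurable (count_space UNIV \<Otimes>\<^sub>M lborel)"
    proof (rule measurable_pair_measure_countable1)
      show "(\<lambda>v. case_prod H (n, v)) \<in> borel_measurable lborel" for n
        unfolding H_def by (simp, measurable)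
    qed auto
    have "integrable (count_space UNIV) (\<lambda>n. \<integral>u. norm (G u n) \<partial>lborel)"
      using P.integrable_snd[of "\<lambda>u n. norm (G u n)"] integrable_norm[OF iG] by (simp add: case_prod_unfold)
    then show "integrable (count_space UNIV) (\<lambda>n. \<integral>v. norm (case_prod H (n, v)) \<partial>lborel)" by (simp add: nshift)
    have "integrable lborel (H n)" for n
    proof -
      have "integrable lborel (\<lambda>v. f (v + of_int n * c))"
        using lborel_integrable_real_affine[OF f, of 1 "of_int n * c"] by (simp add: add.commute)
      then show ?thesis unfolding H_def[abs_def] by (rule integrable_mult_indicator[rotated]) simp
    qed
    then show "AE n in count_space UNIV. integrable lborel (\<lambda>v. case_prod H (n, v))" by (simp add: AE_count_space)
  qed
  have "(\<integral>u. f u \<partial>lborel) = (\<integral>n. (\<integral>u. G u n \<partial>lborel) \<partial>count_space UNIV)"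
    using P.Fubini_integral[OF iG] by (simp add: sumG)
  also have "\<dots> = (\<integral>v. (\<integral>n. H n v \<partial>count_space UNIV) \<partial>lborel)"
    using P'.Fubini_integral[OF iH] by (simp add: shift)
  finally show ?thesis by (simp add: H_def)
qed

context qab
begin

text \<open>The translation of \<open>ln t\<close> that corresponds to the division of \<open>t\<close> by \<open>q\<close>.\<close>

definition "log_step = - lq"
lemma log_step_pos: "log_step > 0" using lq_neg by (simp add: log_step_def)

text \<open>As a function of \<open>u = ln t\<close> the kernel is a Gaussian, because the principal logarithm of \<open>t / (z * sqrt q)\<close> is
  additive for \<open>\<bar>Arg z\<bar> < \<pi>\<close>.\<close>

lemma Egauss_moment:
  assumes z: "z \<noteq> 0" "\<bar>Arg z\<bar> < pi"
  shows "integrable lborel (\<lambda>u. Egauss q (of_real (exp u) / z) * (of_real (exp u)) powr s)"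
    and "(\<integral>u. Egauss q (of_real (exp u) / z) * (of_real (exp u)) powr s \<partial>lborel) =
      of_real (sqrt (- 2 * pi * lq)) * z powr s * of_real q powr (- (s * (s - 1) / 2))"
proof -
  define \<beta> where "\<beta> = Ln z + of_real (lq / 2)"
  define b where "b = \<beta> / of_real log_step + s"
  define c where "c = complex_of_real log_step"
  have c0: "c \<noteq> 0" using log_step_pos by (simp add: c_def)
  have f: "Egauss q (of_real (exp u) / z) * (of_real (exp u)) powr s = exp (- \<beta>\<^sup>2 / (2 * c)) * exp (- (of_real u)\<^sup>2 / (2 * c) + b * of_real u)" for u :: real
  proof -
    have sq: "complex_of_real (sqrt q) = exp (of_real (lq / 2))"
    proof -
      have "sqrt q = exp (lq / 2)" using q0 by (simp add: lq_def ln_sqrt[symmetric])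
      then show ?thesis by (simp only: exp_of_real)
    qed
    have "of_real (exp u) / z / of_real (sqrt q) = exp (of_real u - \<beta>)"
      using z(1) unfolding \<beta>_def sq by (simp add: exp_diff exp_add exp_of_real exp_Ln)
    moreover have "Im (of_real u - \<beta>) = - Arg z" using z(1) by (simp add: \<beta>_def Arg_eq_Im_Ln)
    ultimately have Ln_eq: "Ln (of_real (exp u) / z / of_real (sqrt q)) = of_real u - \<beta>"
      using z(2) by (simp add: Ln_exp)
    have "Egauss q (of_real (exp u) / z) = exp (- ((of_real u - \<beta>)\<^sup>2 / (2 * c)))"
      unfolding Egauss_def Ln_eq by (simp add: c_def log_step_def lq_def)
    moreover have "(complex_of_real (exp u)) powr s = exp (s * of_real u)"
      by (simp add: powr_def Ln_of_real del: of_real_exp)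
    ultimately have "Egauss q (of_real (exp u) / z) * (of_real (exp u)) powr s = exp (- ((of_real u - \<beta>)\<^sup>2 / (2 * c)) + s * of_real u)"
      by (simp only: exp_add)
    also have "- ((of_real u - \<beta>)\<^sup>2 / (2 * c)) + s * of_real u = - \<beta>\<^sup>2 / (2 * c) + (- (of_real u)\<^sup>2 / (2 * c) + b * of_real u)"
      unfolding b_def c_def[symmetric] using c0 by (simp add: power2_eq_square field_simps)
    finally show ?thesis by (simp only: exp_add)
  qed
  note g = gaussian_integral[OF log_step_pos, of b, folded c_def]
  show "integrable lborel (\<lambda>u. Egauss q (of_real (exp u) / z) * (of_real (exp u)) powr s)"
    unfolding f by (intro integrable_mult_right g(1))
  have "(\<integral>u. Egauss q (of_real (exp u) / z) * (of_real (exp u)) powr s \<partial>lborel) =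
    of_real (sqrt (2 * pi * log_step)) * (exp (- \<beta>\<^sup>2 / (2 * c)) * exp (c * b\<^sup>2 / 2))"
    unfolding f using g(2) by simp
  also have "exp (- \<beta>\<^sup>2 / (2 * c)) * exp (c * b\<^sup>2 / 2) = exp (s * Ln z + (- (s * (s - 1) / 2)) * of_real lq)"
  proof -
    have "- \<beta>\<^sup>2 / (2 * c) + c * b\<^sup>2 / 2 = s * \<beta> + c * s\<^sup>2 / 2"
      unfolding b_def c_def[symmetric] using c0 by (simp add: power2_eq_square field_simps)
    also have "\<dots> = s * Ln z + (- (s * (s - 1) / 2)) * of_real lq"
      by (simp add: \<beta>_def c_def log_step_def power2_eq_square field_simps)
    finally show ?thesis by (simp only: exp_add[symmetric])
  qed
  also have "\<dots> = z powr s * of_real q powr (- (s * (s - 1) / 2))"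
  proof -
    have "z powr s = exp (s * Ln z)" using z(1) by (simp add: powr_def)
    moreover have "of_real q powr (- (s * (s - 1) / 2)) = exp ((- (s * (s - 1) / 2)) * of_real lq)"
      using qp_eq[of "- (s * (s - 1) / 2)"] by (simp only: qp_def)
    ultimately show ?thesis by (simp only: exp_add)
  qed
  finally show "(\<integral>u. Egauss q (of_real (exp u) / z) * (of_real (exp u)) powr s \<partial>lborel) =
      of_real (sqrt (- 2 * pi * lq)) * z powr s * of_real q powr (- (s * (s - 1) / 2))"
    by (simp add: log_step_def)
qed

lemma powr_qpowi:
  assumes "x \<noteq> 0"
  shows "(of_real q powi n * x) powr s = qp q s powi n * x powr s"
proof -
  have "(of_real q powi n * x :: complex) = of_real (q powi n) * x" by simp
  moreover have "q powi n > 0" using q0 by simp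
  ultimately have "Ln (of_real q powi n * x) = of_real (ln (q powi n)) + Ln x"
    using Ln_times_of_real[of "q powi n" x] Ln_of_real[of "q powi n"] assms by simp
  moreover have "ln (q powi n) = of_int n * lq"
  proof -
    have "q powi n = exp (of_int n * lq)" using exp_power_int[of lq n] q0 by (simp add: lq_def)
    then show ?thesis by simp
  qed
  ultimately show ?thesis
    using assms q0 by (simp add: powr_def exp_add qp_eq exp_power_int distrib_left mult_ac)
qed

text \<open>By the difference equation of \<open>\<theta>\<close>, the summands are those of the series of \<open>\<theta>\<close> at \<open>x * q powr s\<close>.\<close>

lemma theta_moment_has_sum:
  assumes x: "x \<noteq> 0"
  shows "((\<lambda>n. qp q s powi n / theta q (of_real q powi n * x)) has_sum theta q (x * qp q s) / theta q x) UNIV"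
    and "(\<lambda>n. norm (qp q s powi n / theta q (of_real q powi n * x))) summable_on UNIV"
proof -
  have e: "qp q s powi n / theta q (of_real q powi n * x) = of_real q powi tri n * (x * qp q s) powi n * (1 / theta q x)" for n
    by (simp add: theta_powi[OF q0 q1 x] power_int_mult_distrib)
  have nz: "x * qp q s \<noteq> 0" using x by simp
  show "((\<lambda>n. qp q s powi n / theta q (of_real q powi n * x)) has_sum theta q (x * qp q s) / theta q x) UNIV"
    using has_sum_cmult_left[OF theta_has_sum[OF q0 q1 nz], of "1 / theta q x"] unfolding e by simp
  show "(\<lambda>n. norm (qp q s powi n / theta q (of_real q powi n * x))) summable_on UNIV"
    unfolding e norm_mult[of _ "1 / theta q x"]
    by (intro summable_on_cmult_left theta_series_abs_summable q0 q1 nz)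
qed

lemma theta_exp_nonzero:
  assumes z: "z \<noteq> 0" "\<bar>Arg z\<bar> < pi"
  shows "theta q (of_real (exp u) / z) \<noteq> 0"
proof
  assume "theta q (of_real (exp u) / z) = 0"
  then obtain n :: int where "of_real (exp u) / z = - (of_real q powi n)"
    using theta_eq_0_iff[OF q0 q1, of "of_real (exp u) / z"] z by auto
  define r where "r = exp u / q powi n"
  have "z = - of_real r"
    using \<open>of_real (exp u) / z = - (of_real q powi n)\<close> z(1) q0 by (simp add: r_def field_simps)
  moreover have "r > 0" using q0 by (simp add: r_def)
  ultimately have "Arg z = pi" by (simp add: Arg_eq_pi)
  then show False using z(2) by simp
qed

text \<open>The function \<open>h u * exp (K * u)\<close> does not increase under translation by \<open>c\<close> beyond \<open>u0\<close>, so it is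
  bounded by its maximum over a compact interval.\<close>

lemma step_bound:
  fixes h :: "real \<Rightarrow> real" and c K u0 :: real
  assumes c: "c > 0" and h: "continuous_on UNIV h" "\<And>u. h u \<ge> 0"
    and step: "\<And>u. u \<ge> u0 \<Longrightarrow> h (u + c) \<le> exp (- (K * c)) * h u" and K: "K > 0"
  obtains C where "C \<ge> 0" "\<And>u. u \<ge> 0 \<Longrightarrow> h u \<le> C * exp (- (K * u))"
proof -
  define v0 where "v0 = max u0 0"
  define g where "g u = h u * exp (K * u)" for u
  have gc: "continuous_on A g" for A
    unfolding g_def by (intro continuous_intros continuous_on_subset[OF h(1)]) auto
  have "bounded (g ` {0..v0 + c})" by (intro compact_imp_bounded compact_continuous_image gc) auto
  then obtain C where C: "C > 0" "\<And>u. u \<in> {0..v0 + c} \<Longrightarrow> \<bar>g u\<bar> \<le> C" unfolding bounded_pos by auto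
  have gs: "g (u + c) \<le> g u" if "u \<ge> v0" for u
  proof -
    have "g (u + c) \<le> (exp (- (K * c)) * h u) * exp (K * (u + c))"
      unfolding g_def using step[of u] that by (intro mult_right_mono) (auto simp: v0_def)
    also have "\<dots> = g u * (exp (- (K * c)) * exp (K * c))" by (simp add: g_def distrib_left exp_add)
    also have "exp (- (K * c)) * exp (K * c) = 1" by (simp add: exp_minus)
    finally show ?thesis by simp
  qed
  have "g (v + real n * c) \<le> C" if "v0 \<le> v" "v \<le> v0 + c" for v n
  proof (induction n)
    case 0
    then show ?case using C(2)[of v] that by (auto simp: v0_def)
  next
    case (Suc n)
    have "g (v + real (Suc n) * c) = g (v + real n * c + c)" by (simp add: algebra_simps)
    also have "\<dots> \<le> g (v + real n * c)" using that c by (intro gs) (simp add: add_increasing2)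
    finally show ?case using Suc by simp
  qed note large = this
  have gC: "g u \<le> C" if "u \<ge> 0" for u
  proof (cases "u \<le> v0")
    case True
    then show ?thesis using C(2)[of u] that c by auto
  next
    case False
    define n where "n = nat \<lfloor>(u - v0) / c\<rfloor>"
    have n: "real n \<le> (u - v0) / c" "(u - v0) / c < real n + 1"
    proof -
      have "0 \<le> (u - v0) / c" using False c by simp
      then have "real n = of_int \<lfloor>(u - v0) / c\<rfloor>" by (simp add: n_def)
      then show "real n \<le> (u - v0) / c" "(u - v0) / c < real n + 1" using floor_correct[of "(u - v0) / c"] by simp_all
    qed
    then have "real n * c \<le> u - v0" "u - v0 < (real n + 1) * c"
      using c by (simp_all only: pos_le_divide_eq pos_divide_less_eq)
    then show ?thesis using large[of "u - real n * c" n] by (simp add: algebra_simps)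
  qed
  have "h u \<le> C * exp (- (K * u))" if "u \<ge> 0" for u
    using gC[OF that] by (simp add: g_def exp_minus field_simps)
  with C(1) show ?thesis using that[of C] by simp
qed

text \<open>The reciprocal theta function on a ray decreases faster than every exponential in \<open>\<bar>u\<bar>\<close>, since a step by one
  period multiplies it by a factor that tends to \<open>0\<close>.\<close>

lemma theta_kernel_integrable:
  assumes z: "z \<noteq> 0" "\<bar>Arg z\<bar> < pi"
  shows "integrable lborel (\<lambda>u. (of_real (exp u)) powr s / theta q (of_real (exp u) / z))"
proof -
  define h where "h u = norm (1 / theta q (of_real (exp u) / z))" for u :: real
  have nz: "of_real (exp u) / z \<noteq> 0" for u :: real using z(1) by simp
  have hc: "continuous_on UNIV h"
    unfolding h_def using theta_exp_nonzero[OF z] nz by (intro continuous_intros q0 q1 z(1)) auto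
  have hstep: "h (u + log_step) = h u * (q * norm z * exp (- u))" for u
  proof -
    have e: "of_real q * (of_real (exp (u + log_step)) / z) = of_real (exp u) / z"
    proof -
      have "q * exp (u + log_step) = exp u" using q0 by (simp add: log_step_def lq_def exp_diff)
      then show ?thesis by (metis of_real_mult times_divide_eq_right)
    qed
    have "theta q (of_real (exp u) / z) = theta q (of_real (exp (u + log_step)) / z) / (of_real (exp (u + log_step)) / z)"
      using theta_step[OF q0 q1 nz[of "u + log_step"]] unfolding e .
    then have "h u = h (u + log_step) * norm (of_real (exp (u + log_step)) / z)"
      by (simp add: h_def norm_divide norm_mult)
    moreover have "norm (complex_of_real (exp (u + log_step)) / z) = exp u / (q * norm z)"
      using q0 by (simp add: norm_divide norm_mult log_step_def lq_def exp_diff)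
    ultimately show ?thesis using z(1) q0 by (simp add: exp_minus field_simps)
  qed
  define K where "K = \<bar>Re s\<bar> + 1"
  have K: "K > 0" by (simp add: K_def)
  have h0: "h u \<ge> 0" for u by (simp add: h_def)
  obtain C1 where C1: "C1 \<ge> 0" "\<And>u. u \<ge> 0 \<Longrightarrow> h u \<le> C1 * exp (- (K * u))"
  proof (rule step_bound[OF log_step_pos hc h0 _ K])
    fix u assume u: "u \<ge> ln (q * norm z) + K * log_step"
    have "q * norm z * exp (- u) \<le> exp (- (K * log_step))"
    proof -
      have "ln (q * norm z) - u \<le> - (K * log_step)" using u by simp
      then have "exp (ln (q * norm z) - u) \<le> exp (- (K * log_step))" by simp
      then show ?thesis using q0 z(1) by (simp add: exp_diff exp_minus divide_inverse)
    qed
    from mult_left_mono[OF this h0[of u]] show "h (u + log_step) \<le> exp (- (K * log_step)) * h u"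
      by (simp add: hstep mult_ac)
  qed blast
  obtain C2 where C2: "C2 \<ge> 0" "\<And>u. u \<ge> 0 \<Longrightarrow> h (- u) \<le> C2 * exp (- (K * u))"
  proof (rule step_bound[OF log_step_pos _ _ _ K, of "\<lambda>u. h (- u)"])
    show "continuous_on UNIV (\<lambda>u. h (- u))" by (rule continuous_on_compose2[OF hc]) (auto intro!: continuous_intros)
    fix u assume u: "u \<ge> - ln (q * norm z) - log_step + K * log_step"
    have "h (- u) = h (- (u + log_step)) * (q * norm z * exp (u + log_step))" using hstep[of "- (u + log_step)"] by simp
    moreover have "exp (K * log_step) \<le> q * norm z * exp (u + log_step)"
    proof -
      have "K * log_step \<le> ln (q * norm z) + (u + log_step)" using u by simp
      then have "exp (K * log_step) \<le> exp (ln (q * norm z) + (u + log_step))" by simp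
      then show ?thesis using q0 z(1) by (simp add: exp_add)
    qed
    ultimately have "h (- (u + log_step)) * exp (K * log_step) \<le> h (- u)"
      using h0[of "- (u + log_step)"] by (metis mult_left_mono)
    then show "h (- (u + log_step)) \<le> exp (- (K * log_step)) * h (- u)" by (simp add: exp_minus field_simps)
  qed (use h0 in auto)
  have hb: "h u \<le> (C1 + C2) * exp (- (K * \<bar>u\<bar>))" for u
  proof (cases "u \<ge> 0")
    case True
    then show ?thesis using C1(2)[of u] C2(1) by (simp add: distrib_right add_increasing2)
  next
    case False
    then show ?thesis using C2(2)[of "-u"] C1(1) by (simp add: distrib_right add_increasing)
  qed
  have pw: "norm ((complex_of_real (exp u)) powr s) = exp (Re s * u)" for u
    by (simp add: powr_def Ln_of_real mult.commute del: of_real_exp)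
  show ?thesis
  proof (rule Bochner_Integration.integrable_bound)
    show "integrable lborel (\<lambda>u. (C1 + C2) * 3 / (1 + u\<^sup>2))" by (rule integrable_inverse_1_plus_sq)
    show "(\<lambda>u. (of_real (exp u)) powr s / theta q (of_real (exp u) / z)) \<in> borel_measurable lborel"
      using measurable_theta[OF q0 q1] by measurable
    have le: "norm ((of_real (exp u)) powr s / theta q (of_real (exp u) / z)) \<le> (C1 + C2) * 3 / (1 + u\<^sup>2)" for u
    proof -
      have "norm ((of_real (exp u)) powr s / theta q (of_real (exp u) / z)) = exp (Re s * u) * h u"
        by (simp add: norm_divide pw h_def del: of_real_exp)
      also have "\<dots> \<le> exp (\<bar>Re s\<bar> * \<bar>u\<bar>) * ((C1 + C2) * exp (- (K * \<bar>u\<bar>)))"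
        using abs_ge_self[of "Re s * u"] C1 C2 by (intro mult_mono hb) (auto simp: abs_mult h0)
      also have "\<dots> = (C1 + C2) * exp (\<bar>Re s\<bar> * \<bar>u\<bar> + - (K * \<bar>u\<bar>))" by (simp only: exp_add mult_ac)
      also have "\<bar>Re s\<bar> * \<bar>u\<bar> + - (K * \<bar>u\<bar>) = - 1 * \<bar>u\<bar>" by (simp add: K_def algebra_simps)
      also have "(C1 + C2) * exp (- 1 * \<bar>u\<bar>) \<le> (C1 + C2) * (3 / (1 + u\<^sup>2))"
        using exp_decay_quadratic[of 1 u] C1 C2 by (intro mult_left_mono) auto
      finally show ?thesis by simp
    qed
    show "AE u in lborel. norm ((of_real (exp u)) powr s / theta q (of_real (exp u) / z)) \<le> norm ((C1 + C2) * 3 / (1 + u\<^sup>2))"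
      using order_trans[OF le abs_ge_self] by (simp only: real_norm_def AE_I2)
  qed
qed

text \<open>Up to the factor \<open>z powr s\<close>, the sum of the integrand of the theta moment over an orbit of multiplication by
  \<open>q\<close>, in a logarithmic variable.\<close>

definition \<Psi> :: "complex \<Rightarrow> complex \<Rightarrow> complex" where
  "\<Psi> s w = exp (s * w) * theta q (qp q s * exp w) / theta q (exp w)"

lemma \<Psi>_shift_real: "\<Psi> s (w + of_real log_step) = \<Psi> s w"
proof -
  have e: "of_real q * exp (w + of_real log_step) = exp w"
    using q0 by (simp add: log_step_def lq_def exp_diff exp_of_real del: of_real_exp)
  have st: "theta q (x * exp w) = theta q (x * exp (w + of_real log_step)) / (x * exp (w + of_real log_step))" if "x \<noteq> 0" for x
    using theta_step[OF q0 q1, of "x * exp (w + of_real log_step)"] that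
    by (simp add: mult.left_commute[of "of_real q"] e)
  have s1: "theta q (exp w) = theta q (exp (w + of_real log_step)) / exp (w + of_real log_step)" using st[of 1] by simp
  have "exp (s * (w + of_real log_step)) * qp q s = exp (s * w)"
    by (simp add: qp_eq log_step_def exp_add[symmetric] algebra_simps)
  then show ?thesis
    unfolding \<Psi>_def s1 st[OF qp_nonzero] by (simp add: divide_simps)
qed

lemma \<Psi>_shift_imag: "\<Psi> s (w + 2 * of_real pi * \<i>) = exp (2 * of_real pi * \<i> * s) * \<Psi> s w"
proof -
  have "exp (w + 2 * of_real pi * \<i>) = exp w" by (simp add: exp_add)
  moreover have "exp (s * (w + 2 * of_real pi * \<i>)) = exp (2 * of_real pi * \<i> * s) * exp (s * w)"
    by (simp add: exp_add[symmetric] algebra_simps)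
  ultimately show ?thesis by (simp add: \<Psi>_def)
qed

lemma theta_exp_zero_iff:
  assumes "\<bar>Re w\<bar> < 3 / 4 * log_step" "- pi < Im w" "Im w < 3 * pi"
  shows "theta q (exp w) = 0 \<longleftrightarrow> w = \<i> * of_real pi"
proof
  assume "theta q (exp w) = 0"
  then obtain n :: int where n: "exp w = - (of_real q powi n)"
    using theta_eq_0_iff[OF q0 q1, of "exp w"] by auto
  have qn: "(of_real q :: complex) powi n = exp (of_int n * of_real lq)"
    using exp_power_int[of "complex_of_real lq" n] q0 by (simp add: lq_def exp_of_real)
  have "exp w = exp (of_int n * of_real lq + \<i> * of_real pi)"
    unfolding n qn by (simp add: exp_add)
  then obtain m :: int where m: "w = of_int n * of_real lq + \<i> * of_real pi + of_real (of_int (2 * m) * pi) * \<i>"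
    using exp_eq[of w] by blast
  have "\<bar>of_int n * lq\<bar> < 3 / 4 * log_step" using assms(1) by (simp add: m)
  then have "\<bar>real_of_int n\<bar> * log_step < 3 / 4 * log_step" using lq_neg by (simp add: log_step_def abs_mult)
  then have "\<bar>real_of_int n\<bar> < 3 / 4" using log_step_pos by (simp only: mult_less_cancel_right_pos)
  then have "n = 0" by linarith
  have "Im w = (1 + 2 * of_int m) * pi" by (simp add: m algebra_simps)
  then have "(- 1) * pi < (1 + 2 * of_int m) * pi" "(1 + 2 * of_int m) * pi < 3 * pi" using assms(2,3) by simp_all
  then have "- 1 < 1 + 2 * real_of_int m" "1 + 2 * real_of_int m < 3" using pi_gt_zero by (simp_all only: mult_less_cancel_right_pos)
  then have "m = 0" by linarith
  then show "w = \<i> * of_real pi" using m \<open>n = 0\<close> by simp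
next
  assume "w = \<i> * of_real pi"
  then have "exp w = - (of_real q powi 0)" by simp
  then show "theta q (exp w) = 0" using theta_eq_0_iff[OF q0 q1 exp_not_eq_zero, of w] by blast
qed

text \<open>The pole comes from the factor \<open>1 + exp w\<close> of the triple product, and \<open>exp (\<i> \<pi>) = - 1\<close>.\<close>

lemma \<Psi>_residue:
  fixes s :: complex
  defines "S \<equiv> {w. \<bar>Re w\<bar> < 3 / 4 * log_step \<and> - pi < Im w \<and> Im w < 3 * pi}"
  shows "\<Psi> s holomorphic_on S - {\<i> * of_real pi}"
    and "residue (\<Psi> s) (\<i> * of_real pi) = - (exp (\<i> * of_real pi * s) * theta q (- qp q s) / qpoch_inf q (of_real q) ^ 3)"
    and "open S" "convex S"
proof -
  define p where "p = \<i> * complex_of_real pi"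
  have S: "S = {w. Re w < 3 / 4 * log_step} \<inter> {w. Re w > - (3 / 4 * log_step)} \<inter> {w. Im w > - pi} \<inter> {w. Im w < 3 * pi}"
    by (auto simp: S_def abs_less_iff)
  show op: "open S" unfolding S
    by (intro open_Int open_halfspace_Re_gt open_halfspace_Re_lt open_halfspace_Im_gt open_halfspace_Im_lt)
  show "convex S" unfolding S
    by (intro convex_Int convex_halfspace_Re_gt convex_halfspace_Re_lt convex_halfspace_Im_gt convex_halfspace_Im_lt)
  have pS: "p \<in> S" using log_step_pos by (simp add: S_def p_def)
  show holo: "\<Psi> s holomorphic_on S - {\<i> * of_real pi}"
    unfolding \<Psi>_def[abs_def] using theta_exp_zero_iff
    by (intro holomorphic_intros q0 q1) (auto simp: S_def)
  define N where "N w = exp (s * w) * theta q (qp q s * exp w)" for w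
  define r where "r w = qpoch_inf q (of_real q) * qpoch_inf q (- (exp w * of_real q)) * qpoch_inf q (- of_real q / exp w)" for w
  have th: "theta q (exp w) = (1 + exp w) * r w" for w
    using qpoch_inf_step[OF q0 q1, of "- exp w"] by (simp add: theta_def r_def)
  have ep: "exp p = -1" by (simp add: p_def)
  have rp: "r p = qpoch_inf q (of_real q) ^ 3" by (simp add: r_def ep power3_eq_cube)
  have "isCont (\<lambda>w. N w / r w) p"
  proof -
    have "continuous_on UNIV N" unfolding N_def[abs_def]
      by (intro holomorphic_on_imp_continuous_on holomorphic_intros q0 q1) auto
    moreover have "continuous_on UNIV r" unfolding r_def[abs_def] by (intro continuous_intros q0 q1) auto
    ultimately show ?thesis
      using rp qpoch_inf_self_nonzero[OF q0 q1] by (intro continuous_divide) (auto simp: continuous_on_eq_continuous_at)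
  qed
  then have l1: "((\<lambda>w. N w / r w) \<longlongrightarrow> N p / r p) (at p)" by (rule isContD)
  have "((\<lambda>w. 1 + exp w) has_field_derivative exp p) (at p)" by (auto intro!: derivative_eq_intros)
  then have l2: "((\<lambda>w. (1 + exp w) / (w - p)) \<longlongrightarrow> -1) (at p)"
    by (simp add: has_field_derivative_iff ep)
  have "((\<lambda>w. (N w / r w) / ((1 + exp w) / (w - p))) \<longlongrightarrow> (N p / r p) / (-1)) (at p)"
    by (intro tendsto_divide l1 l2) simp
  then have "((\<lambda>w. \<Psi> s w * (w - p)) \<longlongrightarrow> (N p / r p) / (-1)) (at p)"
    by (rule Lim_transform_eventually) (auto simp: eventually_at_filter \<Psi>_def N_def th)
  then have "residue (\<Psi> s) p = (N p / r p) / (-1)"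
    using residue_simple'[OF op pS] holo unfolding p_def by blast
  also have "\<dots> = - (exp (\<i> * of_real pi * s) * theta q (- qp q s) / qpoch_inf q (of_real q) ^ 3)"
    unfolding N_def ep rp by (simp add: p_def mult_ac)
  finally show "residue (\<Psi> s) (\<i> * of_real pi) = - (exp (\<i> * of_real pi * s) * theta q (- qp q s) / qpoch_inf q (of_real q) ^ 3)"
    unfolding p_def .
qed

text \<open>The rectangle whose width is the real period and whose height is the imaginary quasi-period contains one pole.
  The vertical sides cancel and the top side is a multiple of the bottom side.\<close>

lemma \<Psi>_period_integral:
  assumes y: "\<bar>y0\<bar> < pi" and s: "sin (of_real pi * s) \<noteq> 0"
  shows "((\<lambda>x. \<Psi> s (Complex x y0)) has_integral
    (of_real pi * theta q (- qp q s) / (qpoch_inf q (of_real q) ^ 3 * sin (of_real pi * s)))) {- log_step / 2..log_step / 2}"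
proof -
  define S where "S = {w. \<bar>Re w\<bar> < 3 / 4 * log_step \<and> - pi < Im w \<and> Im w < 3 * pi}"
  define p where "p = \<i> * complex_of_real pi"
  note res = \<Psi>_residue(1)[of s, folded S_def p_def] \<Psi>_residue(2)[of s, folded p_def] \<Psi>_residue(3,4)[folded S_def]
  define y1 where "y1 = y0 + 2 * pi"
  define a1 a2 a3 a4 where "a1 = Complex (- log_step / 2) y0" and "a2 = Complex (log_step / 2) y0"
    and "a3 = Complex (log_step / 2) y1" and "a4 = Complex (- log_step / 2) y1"
  have y01: "y0 < y1" using pi_gt_zero by (simp add: y1_def)
  have rp: "rectpath a1 a3 = linepath a1 a2 +++ linepath a2 a3 +++ linepath a3 a4 +++ linepath a4 a1"
    by (simp add: rectpath_def Let_def a1_def a2_def a3_def a4_def)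
  have inS: "w \<in> S - {p}" if "\<bar>Re w\<bar> \<le> log_step / 2" "y0 \<le> Im w" "Im w \<le> y1" "\<bar>Re w\<bar> = log_step / 2 \<or> Im w = y0 \<or> Im w = y1" for w
    using that y log_step_pos by (auto simp: S_def p_def y1_def abs_less_iff)
  have seg: "closed_segment a1 a2 \<subseteq> S - {p}" "closed_segment a2 a3 \<subseteq> S - {p}" "closed_segment a4 a3 \<subseteq> S - {p}" "closed_segment a1 a4 \<subseteq> S - {p}"
  proof -
    have hor: "Im w = y \<and> \<bar>Re w\<bar> \<le> log_step / 2" if "w \<in> closed_segment (Complex (- log_step / 2) y) (Complex (log_step / 2) y)" for w y
      using that log_step_pos by (subst (asm) closed_segment_same_Im) (auto simp: closed_segment_eq_real_ivl abs_le_iff)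
    have ver: "Re w = x \<and> y0 \<le> Im w \<and> Im w \<le> y1" if "w \<in> closed_segment (Complex x y0) (Complex x y1)" for w x
      using that y01 by (subst (asm) closed_segment_same_Re) (auto simp: closed_segment_eq_real_ivl)
    show "closed_segment a1 a2 \<subseteq> S - {p}" "closed_segment a4 a3 \<subseteq> S - {p}"
      unfolding a1_def a2_def a3_def a4_def using hor y01 by (intro subsetI inS; force)+
    show "closed_segment a2 a3 \<subseteq> S - {p}" "closed_segment a1 a4 \<subseteq> S - {p}"
      unfolding a1_def a2_def a3_def a4_def using ver log_step_pos by (intro subsetI inS; force)+
  qed
  have cont: "continuous_on (S - {p}) (\<Psi> s)" by (rule holomorphic_on_imp_continuous_on[OF res(1)])
  have ii: "\<Psi> s contour_integrable_on linepath u v" if "closed_segment u v \<subseteq> S - {p}" for u v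
    by (intro contour_integrable_continuous_linepath continuous_on_subset[OF cont that])
  define Bo where "Bo = contour_integral (linepath a1 a2) (\<Psi> s)"
  define V where "V = contour_integral (linepath a1 a4) (\<Psi> s)"
  have h1: "(\<Psi> s has_contour_integral Bo) (linepath a1 a2)"
    unfolding Bo_def by (intro has_contour_integral_integral ii seg)
  have hV: "(\<Psi> s has_contour_integral V) (linepath a1 a4)"
    unfolding V_def by (intro has_contour_integral_integral ii seg)
  have h2: "(\<Psi> s has_contour_integral V) (linepath a2 a3)"
  proof -
    have "linepath a2 a3 x = linepath a1 a4 x + of_real log_step" "a3 - a2 = a4 - a1" for x
      by (simp_all add: linepath_def a1_def a2_def a3_def a4_def complex_eq_iff algebra_simps)
    then show ?thesis using hV unfolding has_contour_integral_linepath by (simp add: \<Psi>_shift_real)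
  qed
  define E where "E = exp (2 * of_real pi * \<i> * s)"
  have h3: "(\<Psi> s has_contour_integral (E * Bo)) (linepath a4 a3)"
  proof -
    have l: "linepath a4 a3 x = linepath a1 a2 x + 2 * of_real pi * \<i>" "a3 - a4 = a2 - a1" for x
      by (simp_all add: linepath_def a1_def a2_def a3_def a4_def y1_def complex_eq_iff algebra_simps)
    have "((\<lambda>x. E * (\<Psi> s (linepath a1 a2 x) * (a2 - a1))) has_integral (E * Bo)) {0..1}"
      using h1 unfolding has_contour_integral_linepath by (rule has_integral_mult_right)
    then show ?thesis unfolding has_contour_integral_linepath l \<Psi>_shift_imag E_def by (simp add: mult_ac)
  qed
  have h3': "(\<Psi> s has_contour_integral - (E * Bo)) (linepath a3 a4)"
    using has_contour_integral_reversepath[OF valid_path_linepath h3] by simp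
  have h4': "(\<Psi> s has_contour_integral - V) (linepath a4 a1)"
    using has_contour_integral_reversepath[OF valid_path_linepath hV] by simp
  have "(\<Psi> s has_contour_integral (Bo + (V + (- (E * Bo) + - V)))) (rectpath a1 a3)"
    unfolding rp by (intro has_contour_integral_join h1 h2 h3' h4' valid_path_join valid_path_linepath) auto
  then have ci: "contour_integral (rectpath a1 a3) (\<Psi> s) = (1 - E) * Bo"
    by (simp add: contour_integral_unique algebra_simps)
  have image: "path_image (rectpath a1 a3) \<subseteq> S - {p}"
    unfolding rp using seg by (simp add: path_image_join closed_segment_commute)
  have "contour_integral (rectpath a1 a3) (\<Psi> s) = 2 * pi * \<i> * (\<Sum>w\<in>{p}. winding_number (rectpath a1 a3) w * residue (\<Psi> s) w)"
  proof (rule Residue_theorem[OF res(3) convex_connected[OF res(4)] _ res(1) _ _ image])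
    show "\<forall>z. z \<notin> S \<longrightarrow> winding_number (rectpath a1 a3) z = 0"
      using image by (intro allI impI winding_number_zero_outside[OF _ res(4)]) (auto simp: valid_path_imp_path)
  qed auto
  moreover have "winding_number (rectpath a1 a3) p = 1"
    using y log_step_pos by (intro winding_number_rectpath) (auto simp: in_box_complex_iff a1_def a3_def p_def y1_def abs_less_iff)
  ultimately have "(1 - E) * Bo = 2 * pi * \<i> * residue (\<Psi> s) p" using ci by simp
  also have "\<dots> = 2 * pi * \<i> * (- (exp (\<i> * of_real pi * s) * theta q (- qp q s) / qpoch_inf q (of_real q) ^ 3))"
    by (simp only: res(2)) (simp only: p_def)
  finally have main: "(1 - E) * Bo = 2 * pi * \<i> * (- (exp (\<i> * of_real pi * s) * theta q (- qp q s) / qpoch_inf q (of_real q) ^ 3))" .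
  define e where "e = exp (\<i> * (of_real pi * s))"
  have e0: "e \<noteq> 0" by (simp add: e_def)
  have "2 * of_real pi * \<i> * s = 2 * (\<i> * (of_real pi * s))" by (simp only: mult_ac)
  then have E: "E = e * e" unfolding E_def e_def by (simp only: exp_double power2_eq_square)
  have sn: "sin (of_real pi * s) = (e - 1 / e) / (2 * \<i>)"
    by (simp only: e_def sin_exp_eq mult_minus_left exp_minus inverse_eq_divide)
  have "1 - E = - (2 * \<i> * e * sin (of_real pi * s))"
    using e0 unfolding E sn by (simp add: field_simps)
  moreover have "(1 - E) * Bo = 2 * pi * \<i> * (- (e * theta q (- qp q s) / qpoch_inf q (of_real q) ^ 3))"
    using main unfolding e_def mult.assoc[of \<i>] .
  ultimately have "- (2 * \<i> * e) * (sin (of_real pi * s) * Bo) = - (2 * \<i> * e) * (of_real pi * (theta q (- qp q s) / qpoch_inf q (of_real q) ^ 3))"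
    by (simp add: mult_ac)
  then have sBo: "sin (of_real pi * s) * Bo = of_real pi * (theta q (- qp q s) / qpoch_inf q (of_real q) ^ 3)"
    using e0 by (simp only: mult_cancel_left) simp
  have "Bo = sin (of_real pi * s) * Bo / sin (of_real pi * s)" using s by simp
  also have "\<dots> = of_real pi * theta q (- qp q s) / (qpoch_inf q (of_real q) ^ 3 * sin (of_real pi * s))"
    unfolding sBo by simp
  finally have "Bo = of_real pi * theta q (- qp q s) / (qpoch_inf q (of_real q) ^ 3 * sin (of_real pi * s))" .
  moreover have "((\<lambda>x. \<Psi> s (Complex x y0)) has_integral Bo) {- log_step / 2..log_step / 2}"
  proof -
    define c1 c2 where "c1 = complex_of_real (- log_step / 2)" and "c2 = complex_of_real (log_step / 2)"
    have l: "linepath a1 a2 x = linepath c1 c2 x + Complex 0 y0" "a2 - a1 = c2 - c1" for x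
      by (simp_all add: linepath_def a1_def a2_def c1_def c2_def complex_eq_iff algebra_simps)
    have "((\<lambda>w. \<Psi> s (w + Complex 0 y0)) has_contour_integral Bo) (linepath c1 c2)"
      using h1 unfolding has_contour_integral_linepath l .
    then have "((\<lambda>x. \<Psi> s (of_real x + Complex 0 y0)) has_integral Bo) {Re c1..Re c2}"
      by (subst (asm) has_contour_integral_linepath_Reals_iff) (use log_step_pos in \<open>simp_all add: c1_def c2_def\<close>)
    moreover have "of_real x + Complex 0 y0 = Complex x y0" for x by (simp add: complex_eq_iff)
    ultimately show ?thesis by (simp only: c1_def c2_def Re_complex_of_real)
  qed
  ultimately show ?thesis by simp
qed

text \<open>Summed over the translates of \<open>u\<close> by the period, the integrand becomes \<open>\<Psi>\<close> on the line \<open>Im w = - Arg z\<close>, which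
  does not meet a zero of \<open>\<theta>\<close>.\<close>

lemma theta_moment:
  assumes z: "z \<noteq> 0" "\<bar>Arg z\<bar> < pi" and s: "sin (of_real pi * s) \<noteq> 0"
  shows "(\<integral>u. (of_real (exp u)) powr s / theta q (of_real (exp u) / z) \<partial>lborel) =
    z powr s * (of_real pi * theta q (- qp q s) / (qpoch_inf q (of_real q) ^ 3 * sin (of_real pi * s)))"
proof -
  define f where "f u = (of_real (exp u)) powr s / theta q (of_real (exp u) / z)" for u :: real
  define \<alpha> where "\<alpha> = ln (norm z) - log_step / 2"
  define y0 where "y0 = - Arg z"
  have f: "integrable lborel f" unfolding f_def[abs_def] by (rule theta_kernel_integrable[OF z])
  have Lnz: "Ln z = Complex (ln (norm z)) (Arg z)" using z(1) by (simp add: Ln_Arg Complex_eq)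
  have inner: "(\<integral>n. f (v + of_int n * log_step) \<partial>count_space UNIV) = z powr s * \<Psi> s (Complex (v - ln (norm z)) y0)" for v
  proof -
    define x where "x = of_real (exp v) / z"
    have x: "x \<noteq> 0" using z(1) by (simp add: x_def)
    have fx: "f (v + of_int (- n) * log_step) = (of_real (exp v)) powr s * (qp q s powi n / theta q (of_real q powi n * x))" for n
    proof -
      have "exp (of_int n * lq) = q powi n" using exp_power_int[of lq n] q0 by (simp add: lq_def)
      then have "exp (v + of_int (- n) * log_step) = q powi n * exp v"
        by (simp add: log_step_def exp_add mult.commute)
      then have e: "complex_of_real (exp (v + of_int (- n) * log_step)) = of_real q powi n * of_real (exp v)"
        by (simp only: of_real_mult of_real_power_int)
      have "of_real (exp v) \<noteq> (0::complex)" by simp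
      then show ?thesis unfolding f_def e powr_qpowi[OF \<open>of_real (exp v) \<noteq> 0\<close>] x_def by (simp del: of_real_exp)
    qed
    have "((\<lambda>n. f (v + of_int (- n) * log_step)) has_sum (of_real (exp v)) powr s * (theta q (x * qp q s) / theta q x)) UNIV"
      unfolding fx by (intro has_sum_cmult_right theta_moment_has_sum x)
    then have hs: "((\<lambda>n. f (v + of_int n * log_step)) has_sum (of_real (exp v)) powr s * (theta q (x * qp q s) / theta q x)) UNIV"
      using has_sum_reindex_bij_betw[OF bij_uminus, of "\<lambda>n. f (v + of_int n * log_step)"] by simp
    have "(\<lambda>n. norm (f (v + of_int (- n) * log_step))) summable_on UNIV"
      unfolding fx norm_mult[of "_ powr _"] by (intro summable_on_cmult_right theta_moment_has_sum x)
    then have sm: "(\<lambda>n. norm (f (v + of_int n * log_step))) summable_on UNIV"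
      using summable_on_reindex_bij_betw[OF bij_uminus, of "\<lambda>n. norm (f (v + of_int n * log_step))"] by simp
    have w: "Complex (v - ln (norm z)) y0 = of_real v - Ln z" by (simp add: Lnz y0_def complex_eq_iff)
    have ex: "exp (of_real v - Ln z) = x" using z(1) by (simp add: exp_diff x_def exp_of_real del: of_real_exp)
    have "(of_real (exp v)) powr s = z powr s * exp (s * (of_real v - Ln z))"
      using z(1) by (simp add: powr_def Ln_of_real right_diff_distrib exp_diff del: of_real_exp)
    then show ?thesis
      using integral_count_space_has_sum(2)[OF sm hs] unfolding \<Psi>_def w ex by (simp add: mult_ac)
  qed
  define g where "g x = \<Psi> s (Complex x y0)" for x
  have gi: "(g has_integral (of_real pi * theta q (- qp q s) / (qpoch_inf q (of_real q) ^ 3 * sin (of_real pi * s)))) {- log_step / 2..log_step / 2}"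
    unfolding g_def[abs_def] using z s by (intro \<Psi>_period_integral) (auto simp: y0_def)
  have gc: "continuous_on {- log_step / 2..log_step / 2} g"
  proof -
    have "continuous_on {- log_step / 2..log_step / 2} (\<lambda>x. \<Psi> s (Complex x y0))"
      by (rule continuous_on_compose2[OF holomorphic_on_imp_continuous_on[OF \<Psi>_residue(1)[of s]]])
         (use z log_step_pos in \<open>auto simp: y0_def abs_less_iff complex_eq_iff intro!: continuous_intros\<close>)
    then show ?thesis by (simp add: g_def[abs_def])
  qed
  have gint: "integrable lborel (\<lambda>x. indicator {- log_step / 2..log_step / 2} x *\<^sub>R g x)"
    by (intro borel_integrable_compact gc) simp
  have "(\<integral>u. f u \<partial>lborel) = (\<integral>v. indicator {\<alpha>..<\<alpha> + log_step} v *\<^sub>R (z powr s * \<Psi> s (Complex (v - ln (norm z)) y0)) \<partial>lborel)"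
    unfolding inner[symmetric] by (rule integral_periodize[OF log_step_pos f])
  also have "\<dots> = (\<integral>x. indicator {\<alpha>..<\<alpha> + log_step} (ln (norm z) + 1 * x) *\<^sub>R (z powr s * \<Psi> s (Complex ((ln (norm z) + 1 * x) - ln (norm z)) y0)) \<partial>lborel)"
    by (subst lborel_integral_real_affine[of 1 _ "ln (norm z)"]) auto
  also have "\<dots> = (\<integral>x. z powr s * (indicator {- log_step / 2..<log_step / 2} x *\<^sub>R g x) \<partial>lborel)"
    by (intro Bochner_Integration.integral_cong) (auto simp: \<alpha>_def g_def indicator_def)
  also have "\<dots> = z powr s * (\<integral>x. indicator {- log_step / 2..<log_step / 2} x *\<^sub>R g x \<partial>lborel)"
    by (simp only: integral_mult_right_zero)
  also have "(\<integral>x. indicator {- log_step / 2..<log_step / 2} x *\<^sub>R g x \<partial>lborel) = (\<integral>x. indicator {- log_step / 2..log_step / 2} x *\<^sub>R g x \<partial>lborel)"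
  proof (rule integral_cong_AE)
    have [measurable]: "(\<lambda>x. indicator {- log_step / 2..log_step / 2} x *\<^sub>R g x) \<in> borel_measurable borel"
      using borel_measurable_integrable[OF gint] by (simp only: measurable_lborel2)
    have "(\<lambda>x. indicator {- log_step / 2..<log_step / 2} x *\<^sub>R g x) = (\<lambda>x. indicator {- log_step / 2..<log_step / 2} x *\<^sub>R (indicator {- log_step / 2..log_step / 2} x *\<^sub>R g x))"
      by (auto simp: indicator_def)
    also have "\<dots> \<in> borel_measurable borel" by measurable
    finally show "(\<lambda>x. indicator {- log_step / 2..<log_step / 2} x *\<^sub>R g x) \<in> borel_measurable lborel" by simp
    have "AE x in lborel. x \<noteq> log_step / 2" by (rule AE_lborel_singleton)
    then show "AE x in lborel. indicator {- log_step / 2..<log_step / 2} x *\<^sub>R g x = indicator {- log_step / 2..log_step / 2} x *\<^sub>R g x"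
      by eventually_elim (auto simp: indicator_def)
  qed (rule borel_measurable_integrable[OF gint])
  also have "\<dots> = of_real pi * theta q (- qp q s) / (qpoch_inf q (of_real q) ^ 3 * sin (of_real pi * s))"
  proof -
    have "set_integrable lborel {- log_step / 2..log_step / 2} g" using gint by (simp add: set_integrable_def)
    from set_borel_integral_eq_integral(2)[OF this] show ?thesis
      using integral_unique[OF gi] by (simp add: set_lebesgue_integral_def)
  qed
  finally show ?thesis by (simp only: f_def)
qed

end

section \<open>The Mellin--Barnes representations\<close>

text \<open>Countably many parameters do not matter for the integral along the contour.\<close>

lemma line_integral_transfer:
  assumes g: "integrable lborel g" and N: "countable N"
    and eq: "\<And>t. t \<notin> N \<Longrightarrow> f (\<gamma> t) * vector_derivative \<gamma> (at t) = g t"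
  shows "line_integrable \<gamma> f" and "line_integral \<gamma> f = (\<integral>t. g t \<partial>lborel)"
proof -
  have neg: "negligible N"
    using countable_imp_null_set_lborel[OF N] by (simp add: negligible_iff_null_sets null_sets_completionI)
  have ga: "g absolutely_integrable_on UNIV"
    using integrable_completion[of g lborel] g borel_measurable_integrable[OF g] by (simp add: set_integrable_def)
  show "line_integrable \<gamma> f" unfolding line_integrable_def
    by (rule absolutely_integrable_spike[OF ga neg]) (simp add: eq)
  have "integral UNIV (\<lambda>t. f (\<gamma> t) * vector_derivative \<gamma> (at t)) = integral UNIV g"
    by (rule integral_spike[OF neg]) (simp add: eq)
  also have "\<dots> = (\<integral>t. g t \<partial>lborel)"
    using has_integral_integral_lborel[OF g] by (rule integral_unique)
  finally show "line_integral \<gamma> f = (\<integral>t. g t \<partial>lborel)" by (simp add: line_integral_def)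
qed

locale mb_inj = mb +
  assumes inj: "inj \<gamma>"
begin

text \<open>The parameters at which the contour meets an integer. There the integrands of the theorem divide by \<open>0\<close> instead
  of taking the limit value. They are countable because the contour is injective.\<close>

definition "NZ = {t. \<gamma> t \<in> \<int>}"

lemma countable_NZ: "countable NZ"
proof -
  have "countable (\<gamma> ` NZ)"
    by (rule countable_subset[OF _ countable_int]) (auto simp: NZ_def)
  moreover have "inj_on \<gamma> NZ" using inj by (rule inj_on_subset) simp
  ultimately show ?thesis by (simp add: countable_image_inj_eq)
qed

lemma weight_eq:
  assumes "t \<notin> NZ"
  shows "weight t = of_real pi * qpoch_inf q (of_real q powr (1 + \<gamma> t)) /
    (sin (of_real pi * \<gamma> t) * (qpoch_inf q (a * of_real q powr \<gamma> t) * qpoch_inf q (b * of_real q powr \<gamma> t))) * velocity t"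
proof -
  have "\<gamma> t \<noteq> of_int j" for j using assms by (auto simp: NZ_def)
  then have "numer (\<gamma> t) = raw_numer (\<gamma> t)" by (rule numer_eq)
  then show ?thesis by (simp add: weight_def Q_def raw_numer_def den_def qp_def)
qed

lemma sin_nonzero: "t \<notin> NZ \<Longrightarrow> sin (of_real pi * \<gamma> t) \<noteq> 0"
  by (auto simp: sin_pi_eq_0_iff NZ_def)

lemma kernel_integrable_powr:
  fixes \<kappa> \<psi> :: "'x \<Rightarrow> complex"
  assumes "integrable M (\<lambda>x. \<kappa> x * \<psi> x powr (of_real R))" "integrable M (\<lambda>x. \<kappa> x * \<psi> x powr (of_real (- R)))"
  shows "integrable M (\<lambda>x. norm (\<kappa> x) * (norm (\<psi> x) powr R + norm (\<psi> x) powr (- R)))"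
proof -
  have "norm (\<kappa> x * \<psi> x powr (of_real r)) = norm (\<kappa> x) * norm (\<psi> x) powr r" for x r
    by (simp add: norm_mult norm_powr_real_powr')
  then show ?thesis
    using Bochner_Integration.integrable_add[OF integrable_norm[OF assms(1)] integrable_norm[OF assms(2)]]
    by (simp only: distrib_left)
qed

theorem UE_representation:
  assumes z: "z \<noteq> 0" "\<bar>Arg z\<bar> < pi"
  shows "UE_integrand q a b z absolutely_integrable_on {0<..}"
    and "line_integrable \<gamma> (MB_E q a b z)"
    and "UE q a b z = - K0 q a b / (2 * of_real pi * \<i>) * line_integral \<gamma> (MB_E q a b z)"
proof -
  define \<kappa> where "\<kappa> u = Egauss q (of_real (exp u) / z)" for u :: real
  define \<psi> where "\<psi> u = complex_of_real (exp u)" for u :: real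
  define D where "D = complex_of_real (sqrt (- 2 * pi * lq))"
  have D0: "D \<noteq> 0" using lq_neg by (simp add: D_def)
  have m1 [measurable]: "\<kappa> \<in> borel_measurable lborel" unfolding \<kappa>_def[abs_def] Egauss_def by measurable
  have m2 [measurable]: "\<psi> \<in> borel_measurable lborel" unfolding \<psi>_def[abs_def] by measurable
  have mom: "integrable lborel (\<lambda>u. \<kappa> u * \<psi> u powr s)"
    "(\<integral>u. \<kappa> u * \<psi> u powr s \<partial>lborel) = D * z powr s * of_real q powr (- (s * (s - 1) / 2))" for s
    unfolding \<kappa>_def \<psi>_def D_def by (rule Egauss_moment[OF z])+
  note sup = MB_superposition[OF sigma_finite_lborel m1 m2, of 0, OF _ _ _ kernel_integrable_powr[OF mom(1) mom(1)]]
  have \<psi>: "\<psi> u \<noteq> 0" "\<bar>Arg (\<psi> u)\<bar> \<le> 0" for u by (simp_all add: \<psi>_def Arg_of_real del: of_real_exp)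
  note sup = sup[OF \<psi> pi_gt_zero]
  have e: "of_real (exp u) * UE_integrand q a b z (exp u) = \<kappa> u * phi21 q a b (- \<psi> u)" for u
    by (simp add: UE_integrand_def \<kappa>_def \<psi>_def del: of_real_exp)
  note sub = exp_substitution[of "UE_integrand q a b z", unfolded e, OF sup(1)]
  show "UE_integrand q a b z absolutely_integrable_on {0<..}" by (rule sub(1))
  define g where "g t = 1 / D * (weight t * (\<integral>u. \<kappa> u * \<psi> u powr \<gamma> t \<partial>lborel))" for t
  have g: "integrable lborel g" unfolding g_def[abs_def] by (intro integrable_mult_right sup(2))
  have eq: "MB_E q a b z (\<gamma> t) * velocity t = g t" if "t \<notin> NZ" for t
    unfolding g_def mom(2) weight_eq[OF that] MB_E_def using D0 by (simp add: mult_ac)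
  show "line_integrable \<gamma> (MB_E q a b z)" by (rule line_integral_transfer(1)[OF g countable_NZ eq])
  have tr: "line_integral \<gamma> (MB_E q a b z) = (\<integral>t. g t \<partial>lborel)" by (rule line_integral_transfer(2)[OF g countable_NZ eq])
  have CD: "of_real (Cconst q) * D = 1"
    using lq_neg by (simp add: Cconst_def D_def lq_def of_real_mult[symmetric] del: of_real_mult)
  have "UE q a b z = of_real (Cconst q) * (- K0 q a b / (2 * of_real pi * \<i>) * (\<integral>t. weight t * (\<integral>u. \<kappa> u * \<psi> u powr \<gamma> t \<partial>lborel) \<partial>lborel))"
    unfolding UE_def sub(2) sup(3) ..
  also have "(\<integral>t. weight t * (\<integral>u. \<kappa> u * \<psi> u powr \<gamma> t \<partial>lborel) \<partial>lborel) = D * line_integral \<gamma> (MB_E q a b z)"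
    unfolding tr g_def[abs_def] using D0 by simp
  also have "of_real (Cconst q) * (- K0 q a b / (2 * of_real pi * \<i>) * (D * line_integral \<gamma> (MB_E q a b z))) =
    (of_real (Cconst q) * D) * (- K0 q a b / (2 * of_real pi * \<i>) * line_integral \<gamma> (MB_E q a b z))"
    by (simp only: mult_ac)
  finally show "UE q a b z = - K0 q a b / (2 * of_real pi * \<i>) * line_integral \<gamma> (MB_E q a b z)"
    unfolding CD by simp
qed

theorem Utheta_representation:
  assumes z: "z \<noteq> 0" "\<bar>Arg z\<bar> < pi"
  shows "Utheta_integrand q a b z absolutely_integrable_on {0<..}"
    and "line_integrable \<gamma> (MB_theta q a b z)"
    and "Utheta q a b z = K0 q a b / (2 * of_real pi * \<i> * qpoch_inf q (of_real q) ^ 3 * of_real (ln q)) *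
          line_integral \<gamma> (MB_theta q a b z)"
proof -
  define \<kappa> where "\<kappa> u = 1 / theta q (of_real (exp u) / z)" for u :: real
  define \<psi> where "\<psi> u = complex_of_real (exp u)" for u :: real
  define D where "D = qpoch_inf q (of_real q) ^ 3"
  have D0: "D \<noteq> 0" using qpoch_inf_self_nonzero[OF q0 q1] by (simp add: D_def)
  have m1 [measurable]: "\<kappa> \<in> borel_measurable lborel" unfolding \<kappa>_def[abs_def]
    using measurable_theta[OF q0 q1] by measurable
  have m2 [measurable]: "\<psi> \<in> borel_measurable lborel" unfolding \<psi>_def[abs_def] by measurable
  have mom1: "integrable lborel (\<lambda>u. \<kappa> u * \<psi> u powr s)" for s
    using theta_kernel_integrable[OF z, of s] by (simp add: \<kappa>_def \<psi>_def del: of_real_exp)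
  have mom2: "(\<integral>u. \<kappa> u * \<psi> u powr s \<partial>lborel) = z powr s * (of_real pi * theta q (- qp q s) / (D * sin (of_real pi * s)))"
    if "sin (of_real pi * s) \<noteq> 0" for s
    using theta_moment[OF z that] by (simp add: \<kappa>_def \<psi>_def D_def del: of_real_exp)
  have \<psi>: "\<psi> u \<noteq> 0" "\<bar>Arg (\<psi> u)\<bar> \<le> 0" for u by (simp_all add: \<psi>_def Arg_of_real del: of_real_exp)
  note sup = MB_superposition[OF sigma_finite_lborel m1 m2 \<psi> pi_gt_zero kernel_integrable_powr[OF mom1 mom1]]
  have e: "of_real (exp u) * Utheta_integrand q a b z (exp u) = \<kappa> u * phi21 q a b (- \<psi> u)" for u
    by (simp add: Utheta_integrand_def \<kappa>_def \<psi>_def del: of_real_exp)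
  note sub = exp_substitution[of "Utheta_integrand q a b z", unfolded e, OF sup(1)]
  show "Utheta_integrand q a b z absolutely_integrable_on {0<..}" by (rule sub(1))
  define g where "g t = D * (weight t * (\<integral>u. \<kappa> u * \<psi> u powr \<gamma> t \<partial>lborel))" for t
  have g: "integrable lborel g" unfolding g_def[abs_def] by (intro integrable_mult_right sup(2))
  have eq: "MB_theta q a b z (\<gamma> t) * velocity t = g t" if "t \<notin> NZ" for t
    unfolding g_def mom2[OF sin_nonzero[OF that]] weight_eq[OF that] MB_theta_def using D0
    by (simp add: mult_ac power2_eq_square qp_def)
  show "line_integrable \<gamma> (MB_theta q a b z)" by (rule line_integral_transfer(1)[OF g countable_NZ eq])
  have tr: "line_integral \<gamma> (MB_theta q a b z) = (\<integral>t. g t \<partial>lborel)" by (rule line_integral_transfer(2)[OF g countable_NZ eq])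
  have "Utheta q a b z = - 1 / of_real (ln q) * (- K0 q a b / (2 * of_real pi * \<i>) * (\<integral>t. weight t * (\<integral>u. \<kappa> u * \<psi> u powr \<gamma> t \<partial>lborel) \<partial>lborel))"
    unfolding Utheta_def sub(2) sup(3) ..
  also have "(\<integral>t. weight t * (\<integral>u. \<kappa> u * \<psi> u powr \<gamma> t \<partial>lborel) \<partial>lborel) = line_integral \<gamma> (MB_theta q a b z) / D"
    unfolding tr g_def[abs_def] using D0 by simp
  finally show "Utheta q a b z = K0 q a b / (2 * of_real pi * \<i> * qpoch_inf q (of_real q) ^ 3 * of_real (ln q)) *
          line_integral \<gamma> (MB_theta q a b z)"
    unfolding D_def[symmetric] by (simp add: mult_ac)
qed

theorem Ulambda_representation:
  assumes lam: "lam \<noteq> 0" "\<bar>Arg lam\<bar> < pi" and z: "z \<noteq> 0"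
  shows "Ulambda_summand q lam a b z summable_on UNIV"
    and "line_integrable \<gamma> (MB_lambda q lam a b z)"
    and "Ulambda q lam a b z = - K0 q a b / (2 * of_real pi * \<i>) * line_integral \<gamma> (MB_lambda q lam a b z)"
proof -
  define \<kappa> where "\<kappa> n = 1 / theta q (of_real q powi n * (lam / z))" for n :: int
  define \<psi> where "\<psi> n = of_real q powi n * lam" for n :: int
  have x: "lam / z \<noteq> 0" using lam z by simp
  have pw: "\<kappa> n * \<psi> n powr s = lam powr s * (qp q s powi n / theta q (of_real q powi n * (lam / z)))" for n s
    unfolding \<kappa>_def \<psi>_def powr_qpowi[OF lam(1)] by simp
  have mom: "integrable (count_space UNIV) (\<lambda>n. \<kappa> n * \<psi> n powr s)"
    "(\<integral>n. \<kappa> n * \<psi> n powr s \<partial>count_space UNIV) = lam powr s * (theta q (lam / z * qp q s) / theta q (lam / z))" for s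
  proof -
    have "(\<lambda>n. norm (\<kappa> n * \<psi> n powr s)) summable_on UNIV"
      unfolding pw norm_mult[of "lam powr s"] by (intro summable_on_cmult_right theta_moment_has_sum x)
    moreover have "((\<lambda>n. \<kappa> n * \<psi> n powr s) has_sum lam powr s * (theta q (lam / z * qp q s) / theta q (lam / z))) UNIV"
      unfolding pw by (intro has_sum_cmult_right theta_moment_has_sum x)
    ultimately show "integrable (count_space UNIV) (\<lambda>n. \<kappa> n * \<psi> n powr s)"
      "(\<integral>n. \<kappa> n * \<psi> n powr s \<partial>count_space UNIV) = lam powr s * (theta q (lam / z * qp q s) / theta q (lam / z))"
      by (rule integral_count_space_has_sum)+
  qed
  have \<psi>: "\<psi> n \<noteq> 0" "\<bar>Arg (\<psi> n)\<bar> \<le> \<bar>Arg lam\<bar>" for n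
  proof -
    show "\<psi> n \<noteq> 0" using q0 lam by (simp add: \<psi>_def)
    have "\<psi> n = of_real (q powi n) * lam" by (simp add: \<psi>_def)
    moreover have "q powi n > 0" using q0 by simp
    ultimately have "Arg (\<psi> n) = Arg lam" by (simp only: Arg_times_of_real)
    then show "\<bar>Arg (\<psi> n)\<bar> \<le> \<bar>Arg lam\<bar>" by simp
  qed
  have sf: "sigma_finite_measure (count_space (UNIV :: int set))" by (rule sigma_finite_measure_count_space)
  have m: "\<kappa> \<in> borel_measurable (count_space UNIV)" "\<psi> \<in> borel_measurable (count_space UNIV)" by simp_all
  note sup = MB_superposition[OF sf m \<psi> lam(2) kernel_integrable_powr[OF mom(1) mom(1)]]
  have e: "\<kappa> n * phi21 q a b (- \<psi> n) = Ulambda_summand q lam a b z n" for n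
    by (simp add: Ulambda_summand_def \<kappa>_def \<psi>_def)
  have abs: "Infinite_Set_Sum.abs_summable_on (Ulambda_summand q lam a b z) UNIV"
    using sup(1) unfolding e Infinite_Set_Sum.abs_summable_on_def .
  then have "(\<lambda>n. norm (Ulambda_summand q lam a b z n)) summable_on UNIV" by (simp only: abs_summable_equivalent)
  then show "Ulambda_summand q lam a b z summable_on UNIV" by (rule abs_summable_summable)
  define g where "g t = weight t * (\<integral>n. \<kappa> n * \<psi> n powr \<gamma> t \<partial>count_space UNIV)" for t
  have g: "integrable lborel g" unfolding g_def[abs_def] by (rule sup(2))
  have eq: "MB_lambda q lam a b z (\<gamma> t) * velocity t = g t" if "t \<notin> NZ" for t
    unfolding g_def mom(2) weight_eq[OF that] MB_lambda_def by (simp add: mult_ac qp_def)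
  show "line_integrable \<gamma> (MB_lambda q lam a b z)" by (rule line_integral_transfer(1)[OF g countable_NZ eq])
  have tr: "line_integral \<gamma> (MB_lambda q lam a b z) = (\<integral>t. g t \<partial>lborel)" by (rule line_integral_transfer(2)[OF g countable_NZ eq])
  have "Ulambda q lam a b z = (\<integral>n. Ulambda_summand q lam a b z n \<partial>count_space UNIV)"
    using infsetsum_infsum[OF abs] by (simp add: Ulambda_def infsetsum_def)
  also have "\<dots> = - K0 q a b / (2 * of_real pi * \<i>) * line_integral \<gamma> (MB_lambda q lam a b z)"
    using sup(3) unfolding e tr g_def[abs_def] .
  finally show "Ulambda q lam a b z = - K0 q a b / (2 * of_real pi * \<i>) * line_integral \<gamma> (MB_lambda q lam a b z)" .
qed

end

theorem theorem5p3:
  fixes q :: real and a b :: complex and \<gamma> :: "real \<Rightarrow> complex"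
  assumes "0 < q" and "q < 1"
    and "a \<noteq> 0" and "b \<noteq> 0"
    and "vertical_contour \<gamma>"
    and "separates \<gamma> (pole_family q a \<union> pole_family q b) (range of_nat)"
  shows
    "(\<forall>z. z \<noteq> 0 \<and> \<bar>Arg z\<bar> < pi \<longrightarrow>
        UE_integrand q a b z absolutely_integrable_on {0<..} \<and>
        line_integrable \<gamma> (MB_E q a b z) \<and>
        UE q a b z = - K0 q a b / (2 * of_real pi * \<i>) * line_integral \<gamma> (MB_E q a b z)) \<and>
     (\<forall>z. z \<noteq> 0 \<and> \<bar>Arg z\<bar> < pi \<longrightarrow>
        Utheta_integrand q a b z absolutely_integrable_on {0<..} \<and>
        line_integrable \<gamma> (MB_theta q a b z) \<and>
        Utheta q a b z =
          K0 q a b / (2 * of_real pi * \<i> * qpoch_inf q (of_real q) ^ 3 * of_real (ln q)) *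
          line_integral \<gamma> (MB_theta q a b z)) \<and>
     (\<forall>lam z. lam \<noteq> 0 \<and> \<bar>Arg lam\<bar> < pi \<and> z \<noteq> 0 \<and> (\<forall>n::int. z \<noteq> - (of_real q powi n * lam)) \<longrightarrow>
        Ulambda_summand q lam a b z summable_on UNIV \<and>
        line_integrable \<gamma> (MB_lambda q lam a b z) \<and>
        Ulambda q lam a b z =
          - K0 q a b / (2 * of_real pi * \<i>) * line_integral \<gamma> (MB_lambda q lam a b z))"
proof -
  have vc: "inj \<gamma>" "\<forall>T>0. \<gamma> piecewise_C1_differentiable_on {-T..T}"
    using assms(5) by (simp_all add: vertical_contour_def)
  obtain B where B: "B-lipschitz_on UNIV \<gamma>" using assms(5) by (auto simp: vertical_contour_def)
  have "bounded (range (\<lambda>t. \<gamma> t - \<i> * of_real t))" using assms(5) by (simp add: vertical_contour_def)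
  then obtain R where R: "\<And>t. norm (\<gamma> t - \<i> * of_real t) \<le> R" by (auto simp: bounded_iff)
  interpret qab q a b by unfold_locales (use assms in auto)
  have sep: "\<forall>s\<in>left_poles. left_of \<gamma> s" "\<forall>s\<in>nat_poles. right_of \<gamma> s"
    "\<exists>\<delta>>0. \<forall>s\<in>left_poles \<union> nat_poles. \<forall>t. \<delta> \<le> dist (\<gamma> t) s"
    using assms(6) unfolding separates_def left_poles_def nat_poles_def by - (elim conjE, assumption)+
  from sep(3) obtain \<delta> where \<delta>: "\<delta> > 0" "\<forall>s\<in>left_poles \<union> nat_poles. \<forall>t. \<delta> \<le> dist (\<gamma> t) s" by (elim exE conjE)
  interpret mb_inj \<gamma> R B q a b \<delta>
  proof unfold_locales
    show "left_of \<gamma> p" if "p \<in> left_poles" for p using sep(1) that by (rule bspec)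
    show "right_of \<gamma> p" if "p \<in> nat_poles" for p using sep(2) that by (rule bspec)
    show "\<delta> \<le> norm (\<gamma> t - p)" if "p \<in> left_poles \<union> nat_poles" for p t
      using \<delta>(2) that unfolding dist_norm by blast
  qed (use vc B R \<delta>(1) in simp_all)
  have "UE_integrand q a b z absolutely_integrable_on {0<..} \<and> line_integrable \<gamma> (MB_E q a b z) \<and>
      UE q a b z = - K0 q a b / (2 * of_real pi * \<i>) * line_integral \<gamma> (MB_E q a b z)"
    if "z \<noteq> 0" "\<bar>Arg z\<bar> < pi" for z
    by (intro conjI UE_representation that)
  moreover have "Utheta_integrand q a b z absolutely_integrable_on {0<..} \<and> line_integrable \<gamma> (MB_theta q a b z) \<and>
      Utheta q a b z = K0 q a b / (2 * of_real pi * \<i> * qpoch_inf q (of_real q) ^ 3 * of_real (ln q)) *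
        line_integral \<gamma> (MB_theta q a b z)"
    if "z \<noteq> 0" "\<bar>Arg z\<bar> < pi" for z
    by (intro conjI Utheta_representation that)
  moreover have "Ulambda_summand q lam a b z summable_on UNIV \<and> line_integrable \<gamma> (MB_lambda q lam a b z) \<and>
      Ulambda q lam a b z = - K0 q a b / (2 * of_real pi * \<i>) * line_integral \<gamma> (MB_lambda q lam a b z)"
    if "lam \<noteq> 0" "\<bar>Arg lam\<bar> < pi" "z \<noteq> 0" for lam z
    by (intro conjI Ulambda_representation that)
  ultimately show ?thesis by blast
qed

end
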